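(* Let $n\ge 4$, $2\le r\le n-2$, $e\ge 1$. The number of irreducible components of the locus of degree $e$ morphisms $\varphi$ from $\mathbb{P}^1$ to $G(r,n)$ with the restricted tangent bundle $\varphi^*T_{G(r,n)}$ having a given splitting type $\{c_l\}_{1\le l\le r(n-r)}$ is bounded below by the number of distinct minimal fillings of the given splitting type. In particular, this locus need not always be irreducible (i.e. there exist integers $n\ge 4$, $2\le r\le n-2$, $e\ge 1$ and a splitting type $\{c_l\}_{1\le l\le r(n-r)}$ for which the locus of degree $e$ morphisms $\varphi$ from $\mathbb{P}^1$ to $G(r,n)$ with $\varphi^*T_{G(r,n)}$ having splitting type $\{c_l\}_{1\le l\le r(n-r)}$ is not irreducible).
   Context: $\mathbb{K}$ is an algebraically closed field of characteristic zero and $\mathbb{P}^1=\mathbb{P}^1_{\mathbb{K}}$. $G(r,n)$ is the Grassmannian of $r$-dimensional subspaces of an $n$-dimensional $\mathbb{K}$-vector space, with universal sub-bundle $\mathcal{S}$ and universal quotient bundle $\mathcal{Q}$; $T_{G(r,n)}\cong\mathcal{S}^*\otimes\mathcal{Q}$. The locus is taken inside $\mathrm{Mor}_e(\mathbb{P}^1,G(r,n))$, the scheme of degree $e$ morphisms. The splitting type of $\bigoplus_i\mathcal{O}(\alpha_i)$ on $\mathbb{P}^1$ is the collection of integers $\alpha_i$. A collection of integers $\alpha_1,\dots,\alpha_\nu$ is non-negative if all $\alpha_i\ge 0$, and increasing if $\alpha_1\le\cdots\le\alpha_\nu$. A filling for $\{c_l\}_{1\le l\le r(n-r)}$ is an $r\times(n-r)$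 matrix $(a_{i,j})$ whose entries are the $c_l$ (each used exactly once, with multiplicity), such that entries are weakly increasing along each row and down each column, the difference $a_{i+1,j}-a_{i,j}$ is independent of $j$ for each $i$, and the difference $a_{i,j+1}-a_{i,j}$ is independent of $i$ for each $j$. A filling determines the non-negative increasing splitting types $a_1\le\cdots\le a_r$ of $\varphi^*\mathcal{S}^*$ and $b_1\le\cdots\le b_{n-r}$ of $\varphi^*\mathcal{Q}$, with $\sum a_i=\sum b_j=e$ and $a_i+b_j=a_{i,j}$, by $e=\frac1n\sum_{i,j}a_{i,j}$, $a_i=\frac1{n-r}\left(\sum_j a_{i,j}-e\right)$, $b_j=\frac1r\left(\sum_i a_{i,j}-e\right)$. For a non-negative increasing collection, $\mathfrak{P}(\alpha_1,\dots,\alpha_\nu)=(\alpha_\nu,\alpha_\nu+\alpha_{\nu-1},\dots,\alpha_\nu+\cdots+\alpha_1)$, and $\mathfrak{P}(\alpha'_\bullet)\ge\mathfrak{P}(\alpha_\bullet)$ means entrywise inequality. A filling of $\{c_l\}$ determining the non-negative increasing splitting types $a_\bullet,b_\bullet$ is minimal if for all non-negative increasing integers $a'_1,\dots,a'_r$ and $b'_1,\dots,b'_{n-r}$ with $\sum a'_i=\sum b'_j=e$, $\mathfrak{P}(a'_\bullet)\ge\mathfrak{P}(a_\bullet)$ and $\mathfrak{P}(b'_\bullet)\ge\mathfrak{P}(b_\bullet)$, with at least one of these inequalities strict, the matrix $(a'_i+b'_j)$ is not a filling for $\{c_l\}$. *)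

theory Defs
  imports
    "HOL-Analysis.Function_Topology"
    "HOL-Library.Equipollence"
    "HOL-Library.FuncSet"
    "HOL-Library.Multiset"
    "HOL-Library.Poly_Mapping"
    "HOL-Computational_Algebra.Computational_Algebra"
    "Jordan_Normal_Form.DL_Submatrix"
    "Jordan_Normal_Form.Determinant"
    "Jordan_Normal_Form.VS_Connect"
begin

section \<open>Irreducible spaces and irreducible components\<close>

definition irreducible_space :: "'b topology \<Rightarrow> bool" where
  "irreducible_space X \<longleftrightarrow> topspace X \<noteq> {} \<and>
     (\<forall>C D. closedin X C \<and> closedin X D \<and> C \<union> D = topspace X \<longrightarrow> C = topspace X \<or> D = topspace X)"

definition irreducible_components :: "'b topology \<Rightarrow> 'b set set" where
  "irreducible_components X =
     {Z. Z \<subseteq> topspace X \<and> irreducible_space (subtopology X Z) \<and>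
         (\<forall>Z'. Z \<subseteq> Z' \<and> Z' \<subseteq> topspace X \<and> irreducible_space (subtopology X Z') \<longrightarrow> Z' = Z)}"


section \<open>Grassmannians and morphisms from the projective line\<close>

definition grassmannian :: "nat \<Rightarrow> nat \<Rightarrow> 'a::field vec set set" where
  "grassmannian r n =
     {W. VectorSpace.subspace class_ring W (module_vec TYPE('a) n) \<and>
         vectorspace.dim class_ring ((module_vec TYPE('a) n)\<lparr>carrier := W\<rparr>) = r}"

abbreviation column_space :: "'a::field mat \<Rightarrow> 'a vec set" where
  "column_space B \<equiv> vec_space.col_space (dim_row B) B"

definition proj_point :: "'a::field \<Rightarrow> 'a \<Rightarrow> 'a vec set" where
  "proj_point s t = column_space (mat_of_cols 2 [vec_of_list [s, t]])"

text \<open>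
  The Pluecker coordinates of the column space of a matrix: its maximal minors, indexed by sets
  of rows.
\<close>

definition plucker :: "'a::field mat \<Rightarrow> nat set \<Rightarrow> 'a" where
  "plucker B I = det (submatrix B I UNIV)"

text \<open>
  A map to the Grassmannian is a morphism of degree \<open>e\<close> if and only if its composition with the
  Pluecker embedding is given by binary forms of degree \<open>e\<close> without common zero. Here the form
  with index \<open>I\<close> is the sum of the terms \<open>c (I, k) * s ^ (e - k) * t ^ k\<close>. The absence
  of common zeros is implied, since the maximal minors of a basis do not all vanish. The
  coefficient vector \<open>c\<close> is unique up to a nonzero scalar.
\<close>

definition plucker_forms ::
  "nat \<Rightarrow> nat \<Rightarrow> nat \<Rightarrow> ('a::field vec set \<Rightarrow> 'a vec set) \<Rightarrow> (nat set \<times> nat \<Rightarrow> 'a) \<Rightarrow> bool" where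
  "plucker_forms r n e \<phi> c \<longleftrightarrow>
     (\<forall>I k. c (I, k) \<noteq> 0 \<longrightarrow> I \<subseteq> {..<n} \<and> card I = r \<and> k \<le> e) \<and>
     (\<forall>s t. (s, t) \<noteq> (0, 0) \<longrightarrow>
        (\<exists>B \<in> carrier_mat n r. column_space B = \<phi> (proj_point s t) \<and>
           (\<forall>I. I \<subseteq> {..<n} \<and> card I = r \<longrightarrow>
              plucker B I = (\<Sum>k\<le>e. c (I, k) * s ^ (e - k) * t ^ k))))"

definition Mor :: "nat \<Rightarrow> nat \<Rightarrow> nat \<Rightarrow> ('a::field vec set \<Rightarrow> 'a vec set) set" where
  "Mor r n e = {\<phi> \<in> grassmannian 1 2 \<rightarrow>\<^sub>E grassmannian r n. \<exists>c. plucker_forms r n e \<phi> c}"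


section \<open>The Zariski topology on the space of morphisms\<close>

text \<open>
  \<open>('v \<Rightarrow>\<^sub>0 nat) \<Rightarrow>\<^sub>0 'a\<close> is the ring of polynomials over \<open>'a\<close> in the variables \<open>'v\<close>.
\<close>

definition mpoly_eval :: "('v \<Rightarrow> 'a::comm_ring_1) \<Rightarrow> (('v \<Rightarrow>\<^sub>0 nat) \<Rightarrow>\<^sub>0 'a) \<Rightarrow> 'a" where
  "mpoly_eval x F =
     (\<Sum>m\<in>Poly_Mapping.keys F. Poly_Mapping.lookup F m * (\<Prod>v\<in>Poly_Mapping.keys m. x v ^ Poly_Mapping.lookup m v))"

definition homogeneous :: "(('v \<Rightarrow>\<^sub>0 nat) \<Rightarrow>\<^sub>0 'a::comm_ring_1) \<Rightarrow> bool" where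
  "homogeneous F \<longleftrightarrow>
     (\<exists>d. \<forall>m\<in>Poly_Mapping.keys F. (\<Sum>v\<in>Poly_Mapping.keys m. Poly_Mapping.lookup m v) = d)"

text \<open>
  The coefficients of the Pluecker forms identify \<open>Mor r n e\<close> with (the closed points of) a locally
  closed subscheme of the projective space with homogeneous coordinates \<open>c (I, k)\<close>. The open sets
  below are the traces of the principal open sets of that projective space, which form a base of
  its Zariski topology. Whether \<open>F\<close> vanishes at \<open>c\<close> does not depend on the choice of \<open>c\<close> because
  \<open>F\<close> is homogeneous.
\<close>

definition Mor_topology :: "nat \<Rightarrow> nat \<Rightarrow> nat \<Rightarrow> ('a::field vec set \<Rightarrow> 'a vec set) topology" where
  "Mor_topology r n e =
     topology_generated_by
       {{\<phi> \<in> Mor r n e. \<exists>c. plucker_forms r n e \<phi> c \<and> mpoly_eval c F \<noteq> 0} | F. homogeneous F}"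


section \<open>Vector bundles on the projective line\<close>

text \<open>
  Let \<open>z = t/s\<close> be the coordinate on the chart \<open>s \<noteq> 0\<close>; the chart \<open>t \<noteq> 0\<close> has coordinate \<open>1/z\<close>.
  A vector bundle of rank \<open>m\<close> is given by its transition matrix \<open>g\<close> over the field of rational
  functions in \<open>z\<close>: if \<open>u\<close> and \<open>v\<close> are frames (rows of sections) over the first and the second
  chart, then \<open>v = u g\<close> on the overlap. Changing the two frames replaces \<open>g\<close> by \<open>P g Q\<close> with \<open>P\<close>
  invertible over \<open>K[z]\<close> and \<open>Q\<close> invertible over \<open>K[1/z]\<close>. The line bundle \<open>O(d)\<close> has the
  frames \<open>s^d\<close> and \<open>t^d\<close>, hence transition function \<open>z^d\<close>.
\<close>

definition coord :: "'a::field poly fract" where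
  "coord = to_fract [:0, 1:]"

definition at_inverse_coord :: "'a::field poly \<Rightarrow> 'a poly fract" where
  "at_inverse_coord p = poly (map_poly (\<lambda>a. to_fract [:a:]) p) (inverse coord)"

definition has_splitting_type :: "'a::field poly fract mat \<Rightarrow> int multiset \<Rightarrow> bool" where
  "has_splitting_type g M \<longleftrightarrow>
     (\<exists>\<alpha> P Q. mset \<alpha> = M \<and> g \<in> carrier_mat (length \<alpha>) (length \<alpha>) \<and>
        P \<in> carrier_mat (length \<alpha>) (length \<alpha>) \<and> invertible_mat P \<and>
        Q \<in> carrier_mat (length \<alpha>) (length \<alpha>) \<and> invertible_mat Q \<and>
        map_mat to_fract P * g * map_mat at_inverse_coord Q =
          mat_diag (length \<alpha>) (\<lambda>i. coord powi (\<alpha> ! i)))"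

definition dual_transition :: "'a::field mat \<Rightarrow> 'a mat \<Rightarrow> bool" where
  "dual_transition g g' \<longleftrightarrow> inverts_mat g g'\<^sup>T \<and> inverts_mat g'\<^sup>T g"

definition tensor_mat :: "'a::comm_ring_1 mat \<Rightarrow> 'a mat \<Rightarrow> 'a mat" where
  "tensor_mat A B =
     mat (dim_row A * dim_row B) (dim_col A * dim_col B)
       (\<lambda>(i, j). A $$ (i div dim_row B, j div dim_col B) * B $$ (i mod dim_row B, j mod dim_col B))"


section \<open>The restricted tangent bundle\<close>

text \<open>
  The pullback of the universal sub-bundle under \<open>\<phi>\<close> is the sub-bundle of the trivial bundle of rank
  \<open>n\<close> whose fibre at a point is the value of \<open>\<phi>\<close> there. A matrix \<open>F\<close> as below is a
  frame of the trivial bundle over a chart with parametrization \<open>pt\<close> by the affine line; its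
  first \<open>r\<close> columns are a frame of the pullback of the universal sub-bundle, and the
  classes of the remaining columns are a frame of the pullback of the universal quotient bundle.
  All frames of these two bundles over the chart arise in this way.
\<close>

definition adapted_frame ::
  "nat \<Rightarrow> nat \<Rightarrow> ('a::field vec set \<Rightarrow> 'a vec set) \<Rightarrow> ('a \<Rightarrow> 'a vec set) \<Rightarrow> 'a poly mat \<Rightarrow> bool" where
  "adapted_frame r n \<phi> pt F \<longleftrightarrow> F \<in> carrier_mat n n \<and>
     (\<forall>x. invertible_mat (map_mat (\<lambda>p. poly p x) F) \<and>
          column_space (mat_of_cols n (take r (cols (map_mat (\<lambda>p. poly p x) F)))) = \<phi> (pt x))"

text \<open>
  Transition matrices \<open>g\<close> and \<open>h\<close> of the pullbacks of the universal sub-bundle and of the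
  universal quotient bundle.
\<close>

definition universal_transitions ::
  "nat \<Rightarrow> nat \<Rightarrow> ('a::field vec set \<Rightarrow> 'a vec set) \<Rightarrow> 'a poly fract mat \<Rightarrow> 'a poly fract mat \<Rightarrow> bool" where
  "universal_transitions r n \<phi> g h \<longleftrightarrow>
     g \<in> carrier_mat r r \<and> h \<in> carrier_mat (n - r) (n - r) \<and>
     (\<exists>F F' k. adapted_frame r n \<phi> (\<lambda>x. proj_point 1 x) F \<and>
        adapted_frame r n \<phi> (\<lambda>x. proj_point x 1) F' \<and>
        k \<in> carrier_mat r (n - r) \<and>
        map_mat at_inverse_coord F' =
          map_mat to_fract F * four_block_mat g k (0\<^sub>m (n - r) r) h)"

text \<open>
  The tangent bundle of the Grassmannian is the tensor product of the dual of the universal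
  sub-bundle and the universal quotient bundle.
\<close>

definition tangent_splitting_type ::
  "nat \<Rightarrow> nat \<Rightarrow> ('a::field vec set \<Rightarrow> 'a vec set) \<Rightarrow> int multiset \<Rightarrow> bool" where
  "tangent_splitting_type r n \<phi> M \<longleftrightarrow>
     (\<exists>g g' h. universal_transitions r n \<phi> g h \<and> dual_transition g g' \<and>
        has_splitting_type (tensor_mat g' h) M)"

definition tangent_locus ::
  "nat \<Rightarrow> nat \<Rightarrow> nat \<Rightarrow> int multiset \<Rightarrow> ('a::field vec set \<Rightarrow> 'a vec set) set" where
  "tangent_locus r n e M = {\<phi> \<in> Mor r n e. tangent_splitting_type r n \<phi> M}"

definition tangent_locus_topology ::
  "nat \<Rightarrow> nat \<Rightarrow> nat \<Rightarrow> int multiset \<Rightarrow> ('a::field vec set \<Rightarrow> 'a vec set) topology" where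
  "tangent_locus_topology r n e M = subtopology (Mor_topology r n e) (tangent_locus r n e M)"


section \<open>Fillings\<close>

definition filling :: "nat \<Rightarrow> nat \<Rightarrow> int multiset \<Rightarrow> int mat \<Rightarrow> bool" where
  "filling r n M A \<longleftrightarrow> A \<in> carrier_mat r (n - r) \<and>
     image_mset (\<lambda>ij. A $$ ij) (mset_set ({..<r} \<times> {..<n - r})) = M \<and>
     (\<forall>i j. i < r \<and> Suc j < n - r \<longrightarrow> A $$ (i, j) \<le> A $$ (i, Suc j)) \<and>
     (\<forall>i j. Suc i < r \<and> j < n - r \<longrightarrow> A $$ (i, j) \<le> A $$ (Suc i, j)) \<and>
     (\<forall>i j j'. Suc i < r \<and> j < n - r \<and> j' < n - r \<longrightarrow>
        A $$ (Suc i, j) - A $$ (i, j) = A $$ (Suc i, j') - A $$ (i, j')) \<and>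
     (\<forall>i i' j. i < r \<and> i' < r \<and> Suc j < n - r \<longrightarrow>
        A $$ (i, Suc j) - A $$ (i, j) = A $$ (i', Suc j) - A $$ (i', j))"

definition nonneg_increasing :: "int list \<Rightarrow> bool" where
  "nonneg_increasing \<alpha> \<longleftrightarrow> sorted \<alpha> \<and> (\<forall>x\<in>set \<alpha>. 0 \<le> x)"

text \<open>
  A matrix can satisfy the conditions of a filling although the values prescribed by the three
  formulas fail to be integers or are negative; such a matrix determines no splitting types.
\<close>

definition determines :: "nat \<Rightarrow> nat \<Rightarrow> nat \<Rightarrow> int mat \<Rightarrow> int list \<Rightarrow> int list \<Rightarrow> bool" where
  "determines r n e A a b \<longleftrightarrow>
     length a = r \<and> length b = n - r \<and> nonneg_increasing a \<and> nonneg_increasing b \<and>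
     real e = (\<Sum>i<r. \<Sum>j<n - r. real_of_int (A $$ (i, j))) / real n \<and>
     (\<forall>i<r. real_of_int (a ! i) =
        ((\<Sum>j<n - r. real_of_int (A $$ (i, j))) - real e) / real (n - r)) \<and>
     (\<forall>j<n - r. real_of_int (b ! j) =
        ((\<Sum>i<r. real_of_int (A $$ (i, j))) - real e) / real r)"

definition tail_sums :: "int list \<Rightarrow> int list" where
  "tail_sums \<alpha> = map (\<lambda>k. \<Sum>i\<le>k. rev \<alpha> ! i) [0..<length \<alpha>]"

definition minimal_filling :: "nat \<Rightarrow> nat \<Rightarrow> nat \<Rightarrow> int multiset \<Rightarrow> int mat \<Rightarrow> bool" where
  "minimal_filling r n e M A \<longleftrightarrow> filling r n M A \<and>
     (\<exists>a b. determines r n e A a b \<and>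
        (\<forall>a' b'. length a' = r \<and> length b' = n - r \<and>
           nonneg_increasing a' \<and> nonneg_increasing b' \<and>
           sum_list a' = int e \<and> sum_list b' = int e \<and>
           list_all2 (\<le>) (tail_sums a) (tail_sums a') \<and>
           list_all2 (\<le>) (tail_sums b) (tail_sums b') \<and>
           (tail_sums a \<noteq> tail_sums a' \<or> tail_sums b \<noteq> tail_sums b') \<longrightarrow>
           \<not> filling r n M (mat r (n - r) (\<lambda>(i, j). a' ! i + b' ! j))))"

end

theory Submission
  imports
    Defs
    "HOL-Library.Function_Algebras"
    "Jordan_Normal_Form.Char_Poly"
    "Jordan_Normal_Form.DL_Rank"
begin

text \<open>
  Let \<open>a\<close> and \<open>b\<close> be the splitting types of the dual of the pulled back sub-bundle \<open>S\<close> and of the pulled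
  back quotient bundle \<open>Q\<close>. They exist by the theorem of Birkhoff and Grothendieck
  (\<open>birkhoff_grothendieck\<close>), the tangent bundle has the exponents \<open>a\<^sub>i + b\<^sub>j\<close> (\<open>splits_as_tensor\<close>), and
  splitting types are unique (\<open>splitting_type_unique\<close>). The types are encoded in the dimensions of the
  spaces of sections of the twists \<open>S(m)\<close> and \<open>Q\<^sup>*(m)\<close>, which are \<open>\<Sum>\<^sub>i max 0 (m + 1 - a\<^sub>i)\<close> and
  \<open>\<Sum>\<^sub>j max 0 (m + 1 - b\<^sub>j)\<close> (\<open>universal_sections\<close>).

  These dimensions are upper semicontinuous: the sections of bounded degree are the solutions of a linear
  system whose coefficients are linear in the coefficients of the Pluecker forms
  (\<open>sub_sections_semicontinuous\<close>, \<open>conormal_sections_semicontinuous\<close>). On the other hand, the sum over all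
  \<open>m \<le> N\<close> of \<open>n - r\<close> times the first and \<open>r\<close> times the second dimension is, for large \<open>N\<close>, a polynomial in
  the sum and the sum of the squares of the \<open>a\<^sub>i + b\<^sub>j\<close>, because \<open>\<Sum>a\<^sub>i = \<Sum>b\<^sub>j\<close> (\<open>weighted_section_dims\<close>). So it is
  constant on the locus of a given tangent splitting type. If a sum of upper semicontinuous integers
  with positive weights is constant, each of them is locally constant. Hence \<open>a\<close> and \<open>b\<close> are constant on each
  irreducible subset of the locus (\<open>section_dims_constant\<close>).

  A filling determines \<open>a\<close> and \<open>b\<close> and is determined by them. All pairs of nonnegative types with
  \<open>\<Sum>a\<^sub>i = \<Sum>b\<^sub>j = e\<close> occur for some map of degree \<open>e\<close>: an explicit frame of \<open>S\<close> by vectors of monomials, and a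
  frame of its annihilator of the same kind, are built by an induction that peels off one exponent
  at a time (\<open>staircase_exists\<close>, \<open>map_from_staircase\<close>). Components through maps chosen for different minimal
  fillings are therefore different. The splitting type with exponents \<open>1, 1, 3, 3\<close> arises from two
  different pairs of types for \<open>n = 4\<close>, \<open>r = 2\<close> and \<open>e = 2\<close>, so its locus is reducible.
\<close>

no_notation fps_nth (infixl \<open>$\<close> 75)

section \<open>Laurent polynomials\<close>

interpretation frac_hom: inj_idom_hom "to_fract :: 'a::field poly \<Rightarrow> 'a poly fract"
  by unfold_locales auto

interpretation const_hom: inj_idom_hom "\<lambda>a::'a::field. to_fract [:a:]"
  by unfold_locales (auto simp flip: to_fract_add to_fract_mult simp: one_pCons)

interpretation const_poly_hom: map_poly_inj_idom_hom "\<lambda>a::'a::field. to_fract [:a:]" ..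

lemma coord_nonzero [simp]: "coord \<noteq> 0"
  by (simp add: coord_def)

lemma to_fract_monom: "to_fract (monom c k) = to_fract [:c:] * coord ^ k"
  by (simp add: coord_def frac_hom.hom_power[symmetric] monom_altdef flip: to_fract_mult)

lemma at_inverse_coord_monom:
  "at_inverse_coord (monom c k) = to_fract [:c:] * inverse coord ^ k"
  by (simp add: at_inverse_coord_def poly_monom map_poly_monom)

lemma at_inverse_coord_sum: "at_inverse_coord (sum f A) = (\<Sum>x\<in>A. at_inverse_coord (f x))"
  unfolding at_inverse_coord_def by (simp add: const_poly_hom.hom_sum poly_sum)

text \<open>The polynomial whose homogenization of degree \<open>N\<close> is that of \<open>f\<close> with the two variables
  exchanged.\<close>

definition reversal :: "nat \<Rightarrow> 'a::field poly \<Rightarrow> 'a poly" where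
  "reversal N f = (\<Sum>k\<le>N. monom (coeff f k) (N - k))"

lemma coeff_reversal: "coeff (reversal N f) i = (if i \<le> N then coeff f (N - i) else 0)"
proof -
  have "coeff (reversal N f) i = (\<Sum>k\<le>N. if k = N - i \<and> i \<le> N then coeff f k else 0)"
    unfolding reversal_def coeff_sum by (rule sum.cong) auto
  also have "\<dots> = (if i \<le> N then coeff f (N - i) else 0)"
    by (cases "i \<le> N") (auto simp: sum.delta)
  finally show ?thesis .
qed

lemma degree_reversal_le: "degree (reversal N f) \<le> N"
  by (rule degree_le) (auto simp: coeff_reversal)

lemma reversal_reversal: "degree f \<le> N \<Longrightarrow> reversal N (reversal N f) = f"
  by (rule poly_eqI) (auto simp: coeff_reversal coeff_eq_0)

lemma poly_as_monom_sum: "degree f \<le> N \<Longrightarrow> f = (\<Sum>k\<le>N. monom (coeff f k) k)"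
  by (metis poly_as_sum_of_monoms')

text \<open>Multiplication by \<open>z ^ N\<close> turns a polynomial in \<open>1/z\<close> of degree at most \<open>N\<close> into the reversed polynomial
  in \<open>z\<close>.\<close>

lemma to_fract_reversal:
  assumes "degree f \<le> N"
  shows "to_fract (reversal N f) = at_inverse_coord f * coord ^ N"
proof -
  have "at_inverse_coord f = (\<Sum>k\<le>N. to_fract [:coeff f k:] * inverse coord ^ k)"
    by (subst poly_as_monom_sum[OF assms]) (simp add: at_inverse_coord_sum at_inverse_coord_monom)
  moreover have "inverse coord ^ k * coord ^ N = (coord :: 'a poly fract) ^ (N - k)" if "k \<le> N" for k
    using that by (simp add: power_inverse power_diff field_simps)
  ultimately show ?thesis
    by (auto simp: reversal_def to_fract_sum to_fract_monom sum_distrib_right mult.assoc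
        intro!: sum.cong)
qed

interpretation at_inverse_hom: inj_idom_hom "at_inverse_coord :: 'a::field poly \<Rightarrow> 'a poly fract"
proof
  show "at_inverse_coord (0::'a poly) = 0" "at_inverse_coord (1::'a poly) = 1"
    by (simp_all add: at_inverse_coord_def)
  fix p q :: "'a poly"
  show "at_inverse_coord (p + q) = at_inverse_coord p + at_inverse_coord q"
       "at_inverse_coord (p * q) = at_inverse_coord p * at_inverse_coord q"
    by (simp_all add: at_inverse_coord_def const_poly_hom.hom_add const_poly_hom.hom_mult)
  assume "at_inverse_coord p = 0"
  hence "reversal (degree p) p = 0"
    using to_fract_reversal[of p "degree p"] by simp
  thus "p = 0"
    using reversal_reversal[of p "degree p"] by (simp add: reversal_def)
qed

lemma at_inverse_coord_reversal:
  assumes "degree f \<le> N"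
  shows "at_inverse_coord (reversal N f) = to_fract f * coord powi (- int N)"
  using to_fract_reversal[OF degree_reversal_le, of N f] reversal_reversal[OF assms]
  by (simp add: power_int_minus field_simps)

text \<open>The exponents that occur in a polynomial times \<open>z ^ j\<close> are at least \<open>j\<close>, and those in a polynomial
  in \<open>1/z\<close> are at most \<open>0\<close>. This is what makes sections of bundles on the projective line polynomials of
  bounded degree.\<close>

lemma degree_le_of_at_inverse_coord:
  assumes eq: "to_fract f * coord powi j = at_inverse_coord q" and "f \<noteq> 0"
  shows "int (degree f) \<le> - j"
proof -
  define N where "N = degree q"
  have "to_fract f * coord powi (j + int N) = to_fract (reversal N q)"
    using eq by (simp add: N_def to_fract_reversal power_int_add)
  hence *: "to_fract f * coord powi (j + int N) = to_fract (reversal N q)" .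
  show ?thesis
  proof (cases "j + int N \<ge> 0")
    case True
    define d where "d = nat (j + int N)"
    have "coord powi (j + int N) = to_fract (monom (1::'a) d)"
      using True by (simp add: to_fract_monom d_def power_int_def one_pCons[symmetric])
    hence "f * monom 1 d = reversal N q"
      using * by (simp flip: to_fract_mult)
    hence "degree f + d \<le> N"
      using degree_reversal_le[of N q] \<open>f \<noteq> 0\<close> by (metis degree_mult_eq degree_monom_eq monom_eq_0_iff one_neq_zero)
    thus ?thesis using True by (simp add: d_def)
  next
    case False
    define d where "d = nat (- (j + int N))"
    have "coord powi (- (j + int N)) = to_fract (monom (1::'a) d)"
      using False by (simp add: to_fract_monom d_def power_int_def one_pCons[symmetric])
    moreover have "to_fract f = to_fract (reversal N q) * coord powi (- (j + int N))"
      by (simp flip: * power_int_add add: mult.assoc del: minus_add_distrib)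
    ultimately have f: "f = reversal N q * monom 1 d"
      by (simp flip: to_fract_mult)
    hence "reversal N q \<noteq> 0" using \<open>f \<noteq> 0\<close> by auto
    hence "degree f \<le> N + d"
      unfolding f using degree_reversal_le[of N q] by (simp add: degree_mult_eq degree_monom_eq)
    thus ?thesis using False by (simp add: d_def)
  qed
qed

lemma at_inverse_coord_eqD:
  assumes "to_fract f * coord powi (- int N) = at_inverse_coord q"
  shows "degree f \<le> N" "q = reversal N f"
proof -
  show d: "degree f \<le> N"
    using degree_le_of_at_inverse_coord[OF assms] by (cases "f = 0") auto
  show "q = reversal N f"
    using at_inverse_coord_reversal[OF d] assms by (metis at_inverse_hom.eq_iff)
qed

lemma poly_reversal:
  assumes "degree f \<le> N" "y \<noteq> 0"
  shows "poly (reversal N f) y = y ^ N * poly f (inverse y)"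
proof -
  have "poly f (inverse y) = (\<Sum>k\<le>N. coeff f k * inverse y ^ k)"
    by (subst poly_as_monom_sum[OF assms(1)]) (simp add: poly_sum poly_monom)
  moreover have "y ^ (N - k) = y ^ N * inverse y ^ k" if "k \<le> N" for k
    using that assms(2) by (simp add: power_diff power_inverse field_simps)
  ultimately show ?thesis
    by (auto simp: reversal_def poly_sum poly_monom sum_distrib_left mult_ac intro!: sum.cong)
qed

lemma poly_reversal_0: "poly (reversal N f) 0 = coeff f N"
  by (simp add: poly_0_coeff_0 coeff_reversal)


section \<open>Splitting types\<close>

lemma invertible_matE:
  assumes "invertible_mat P" "P \<in> carrier_mat n n"
  obtains P' where "P' \<in> carrier_mat n n" "P * P' = 1\<^sub>m n" "P' * P = 1\<^sub>m n"
proof -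
  obtain B where B: "P * B = 1\<^sub>m (dim_row P)" "B * P = 1\<^sub>m (dim_row B)"
    using assms unfolding invertible_mat_def inverts_mat_def by auto
  have "dim_col B = n" using B(1) assms(2) by (metis carrier_matD(1) index_mult_mat(3) index_one_mat(3))
  moreover have "dim_row B = n" using B(2) assms(2) by (metis carrier_matD(2) index_mult_mat(3) index_one_mat(3))
  ultimately show ?thesis using that[of B] B assms(2) by auto
qed

lemma invertible_matI:
  assumes "P \<in> carrier_mat n n" "P' \<in> carrier_mat n n" "P * P' = 1\<^sub>m n" "P' * P = 1\<^sub>m n"
  shows "invertible_mat P"
  unfolding invertible_mat_def inverts_mat_def using assms by auto

abbreviation power_diag :: "int list \<Rightarrow> 'a::field poly fract mat" where
  "power_diag \<alpha> \<equiv> mat_diag (length \<alpha>) (\<lambda>i. coord powi (\<alpha> ! i))"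

lemma power_diag_mult_uminus:
  "power_diag \<alpha> * mat_diag (length \<alpha>) (\<lambda>i. coord powi (- \<alpha> ! i)) = 1\<^sub>m (length \<alpha>)"
  by (simp flip: power_int_add)

text \<open>The entry \<open>(i, j)\<close> of the equation says that \<open>R $$ (i, j) * z ^ (\<alpha> ! j - \<beta> ! i)\<close> is a polynomial in \<open>1/z\<close>,
  so \<open>R $$ (i, j)\<close> vanishes unless \<open>\<alpha> ! j \<le> \<beta> ! i\<close>. A nonzero term of the Leibniz formula for \<open>det R\<close> is
  the permutation.\<close>

lemma diag_equivalence_le:
  fixes R S :: "'a::field poly mat"
  assumes len: "length \<alpha> = m" "length \<beta> = m"
    and R: "R \<in> carrier_mat m m" "R' \<in> carrier_mat m m" "R * R' = 1\<^sub>m m"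
    and S: "S \<in> carrier_mat m m"
    and eq: "map_mat to_fract R * power_diag \<alpha> = power_diag \<beta> * map_mat at_inverse_coord S"
  shows "\<exists>\<pi>. \<pi> permutes {0..<m} \<and> (\<forall>i<m. \<alpha> ! \<pi> i \<le> \<beta> ! i)"
proof -
  have le: "\<alpha> ! j \<le> \<beta> ! i" if ij: "i < m" "j < m" and nz: "R $$ (i, j) \<noteq> 0" for i j
  proof -
    have "to_fract (R $$ (i, j)) * coord powi (\<alpha> ! j) = coord powi (\<beta> ! i) * at_inverse_coord (S $$ (i, j))"
      using arg_cong[OF eq, of "\<lambda>M. M $$ (i, j)"] ij R S len
      by (simp add: mat_diag_mult_left[of _ m m] mat_diag_mult_right[of _ m m])
    hence "to_fract (R $$ (i, j)) * coord powi (\<alpha> ! j - \<beta> ! i) = at_inverse_coord (S $$ (i, j))"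
      by (simp add: power_int_diff field_simps)
    from degree_le_of_at_inverse_coord[OF this nz] show ?thesis by linarith
  qed
  have "det R * det R' = 1"
    using R by (metis det_mult det_one)
  hence "det R \<noteq> 0" by auto
  then obtain \<pi> where \<pi>: "\<pi> permutes {0..<m}" and nz: "signof \<pi> * (\<Prod>i = 0..<m. R $$ (i, \<pi> i)) \<noteq> 0"
    unfolding det_def'[OF R(1)] by (metis (mono_tags, lifting) mem_Collect_eq sum.not_neutral_contains_not_neutral)
  have "\<alpha> ! \<pi> i \<le> \<beta> ! i" if "i < m" for i
  proof (rule le)
    show "\<pi> i < m" using \<pi> that by (metis atLeastLessThan_iff permutes_in_image zero_le)
    show "R $$ (i, \<pi> i) \<noteq> 0" using nz that by auto
  qed (use that in auto)
  thus ?thesis using \<pi> by blast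
qed

text \<open>The two chains of inequalities give the same total on both sides, so each inequality is an
  equality.\<close>

lemma mset_eq_of_permuted_le:
  fixes \<alpha> \<beta> :: "int list"
  assumes len: "length \<alpha> = m" "length \<beta> = m"
    and \<pi>: "\<pi> permutes {0..<m}" "\<forall>i<m. \<alpha> ! \<pi> i \<le> \<beta> ! i"
    and \<rho>: "\<rho> permutes {0..<m}" "\<forall>i<m. \<beta> ! \<rho> i \<le> \<alpha> ! i"
  shows "mset \<alpha> = mset \<beta>"
proof -
  have perm: "(\<Sum>i<m. f (\<sigma> i)) = (\<Sum>i<m. f i)" if "\<sigma> permutes {0..<m}" for f :: "nat \<Rightarrow> int" and \<sigma>
    using sum.permute[OF that, of f] by (simp add: o_def atLeast0LessThan)
  have "(\<Sum>i<m. \<beta> ! i) = (\<Sum>i<m. \<beta> ! \<rho> i)" using perm[OF \<rho>(1)] by simp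
  also have "\<dots> \<le> (\<Sum>i<m. \<alpha> ! i)" using \<rho>(2) by (intro sum_mono) auto
  also have "\<dots> = (\<Sum>i<m. \<alpha> ! \<pi> i)" using perm[OF \<pi>(1)] by simp
  finally have "(\<Sum>i<m. \<beta> ! i - \<alpha> ! \<pi> i) \<le> 0" by (simp add: sum_subtractf)
  moreover have "\<forall>i\<in>{..<m}. 0 \<le> \<beta> ! i - \<alpha> ! \<pi> i" using \<pi>(2) by auto
  ultimately have "\<forall>i\<in>{..<m}. \<beta> ! i - \<alpha> ! \<pi> i = 0"
    by (metis (no_types, lifting) finite_lessThan order_antisym sum_nonneg sum_nonneg_eq_0_iff)
  hence "permute_list \<pi> \<alpha> = \<beta>"
    using len by (intro nth_equalityI) (auto simp: permute_list_def)
  moreover have "\<pi> permutes {..<length \<alpha>}" using \<pi>(1) len by (simp add: atLeast0LessThan)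
  ultimately show ?thesis by (metis mset_permute_list)
qed

lemma left_inverse_mult:
  fixes P Y U P' :: "'a::comm_ring_1 mat"
  assumes "P \<in> carrier_mat l k" "Y \<in> carrier_mat k n" "U \<in> carrier_mat n k" "P' \<in> carrier_mat k l"
    and "Y * U = 1\<^sub>m k" "P * P' = 1\<^sub>m l"
  shows "P * Y * (U * P') = 1\<^sub>m l"
proof -
  have "P * Y * (U * P') = P * (Y * U) * P'"
    using assms(1-4) by (simp add: assoc_mult_mat[of _ l k _ n _ l] assoc_mult_mat[of _ k n _ k _ l]
        assoc_mult_mat[of _ l k _ k _ l] mult_carrier_mat[of _ k n _ k] mult_carrier_mat[of _ n k _ l])
  thus ?thesis using assms by simp
qed

text \<open>Two diagonal forms of the same transition matrix differ by base changes over the two charts, and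
  the comparison of exponents applies in both directions.\<close>

lemma splitting_type_unique:
  assumes "has_splitting_type g M" "has_splitting_type g N"
  shows "M = N"
proof -
  obtain \<alpha> P Q where \<alpha>: "mset \<alpha> = M" "g \<in> carrier_mat (length \<alpha>) (length \<alpha>)"
      "P \<in> carrier_mat (length \<alpha>) (length \<alpha>)" "invertible_mat P"
      "Q \<in> carrier_mat (length \<alpha>) (length \<alpha>)" "invertible_mat Q"
    and \<alpha>eq: "map_mat to_fract P * g * map_mat at_inverse_coord Q = power_diag \<alpha>"
    using assms(1) unfolding has_splitting_type_def by blast
  obtain \<beta> A B where \<beta>: "mset \<beta> = N" "g \<in> carrier_mat (length \<beta>) (length \<beta>)"
      "A \<in> carrier_mat (length \<beta>) (length \<beta>)" "invertible_mat A"
      "B \<in> carrier_mat (length \<beta>) (length \<beta>)" "invertible_mat B"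
    and \<beta>eq: "map_mat to_fract A * g * map_mat at_inverse_coord B = power_diag \<beta>"
    using assms(2) unfolding has_splitting_type_def by blast
  define m where "m = length \<alpha>"
  have len: "length \<alpha> = m" "length \<beta> = m" using \<alpha>(2) \<beta>(2) by (auto simp: m_def)
  note car = \<alpha>(2,3,5) \<beta>(3,5)
  note car = car[unfolded len]
  obtain P' where P': "P' \<in> carrier_mat m m" "P * P' = 1\<^sub>m m" "P' * P = 1\<^sub>m m"
    using invertible_matE[OF \<alpha>(4)] car by metis
  obtain Q' where Q': "Q' \<in> carrier_mat m m" "Q * Q' = 1\<^sub>m m" "Q' * Q = 1\<^sub>m m"
    using invertible_matE[OF \<alpha>(6)] car by metis
  obtain A' where A': "A' \<in> carrier_mat m m" "A * A' = 1\<^sub>m m" "A' * A = 1\<^sub>m m"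
    using invertible_matE[OF \<beta>(4)] car by metis
  obtain B' where B': "B' \<in> carrier_mat m m" "B * B' = 1\<^sub>m m" "B' * B = 1\<^sub>m m"
    using invertible_matE[OF \<beta>(6)] car by metis
  have key: "map_mat to_fract (Y * X') * power_diag \<gamma> = power_diag \<delta> * map_mat at_inverse_coord (W' * Z)"
    if "X \<in> carrier_mat m m" "X' \<in> carrier_mat m m" "X' * X = 1\<^sub>m m"
      "Y \<in> carrier_mat m m" "Z \<in> carrier_mat m m"
      "W \<in> carrier_mat m m" "W' \<in> carrier_mat m m" "W * W' = 1\<^sub>m m"
      "length \<gamma> = m" "length \<delta> = m"
      "map_mat to_fract X * g * map_mat at_inverse_coord Z = power_diag \<gamma>"
      "map_mat to_fract Y * g * map_mat at_inverse_coord W = power_diag \<delta>"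
    for X X' Y Z W W' :: "'a poly mat" and \<gamma> \<delta>
  proof -
    let ?f = "map_mat (to_fract :: 'a poly \<Rightarrow> _)" and ?a = "map_mat (at_inverse_coord :: 'a poly \<Rightarrow> _)"
    have f1: "?f X' * ?f X = 1\<^sub>m m"
      using that by (simp flip: frac_hom.mat_hom_mult[of X' m m X m] add: frac_hom.mat_hom_one)
    have a1: "?a W * ?a W' = 1\<^sub>m m"
      using that by (simp flip: at_inverse_hom.mat_hom_mult[of W m m W' m] add: at_inverse_hom.mat_hom_one)
    have [simp]: "?f X \<in> carrier_mat m m" "?f X' \<in> carrier_mat m m" "?f Y \<in> carrier_mat m m"
      "?a Z \<in> carrier_mat m m" "?a W \<in> carrier_mat m m" "?a W' \<in> carrier_mat m m"
      using that by auto
    note g = car(1)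
    have "?f (Y * X') * power_diag \<gamma> = ?f Y * ?f X' * (?f X * g * ?a Z)"
      using that by (simp add: frac_hom.mat_hom_mult[of Y m m X' m])
    also have "\<dots> = ?f Y * (?f X' * ?f X) * g * ?a Z"
      using that g by (simp add: assoc_mult_mat[of _ m m _ m _ m] mult_carrier_mat[of _ m m _ m])
    also have "\<dots> = ?f Y * g * ?a Z"
      unfolding f1 using that by simp
    also have "\<dots> = ?f Y * g * (?a W * ?a W') * ?a Z"
      unfolding a1 using that g by simp
    also have "\<dots> = (?f Y * g * ?a W) * (?a W' * ?a Z)"
      using that(1,2,4-7) g by (simp add: assoc_mult_mat[of _ m m _ m _ m] mult_carrier_mat[of _ m m _ m])
    also have "\<dots> = power_diag \<delta> * ?a (W' * Z)"
      using that by (simp add: at_inverse_hom.mat_hom_mult[of W' m m Z m])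
    finally show ?thesis .
  qed
  have eq1: "map_mat to_fract (A * P') * power_diag \<alpha> = power_diag \<beta> * map_mat at_inverse_coord (B' * Q)"
    by (rule key[of P P' A Q B B']) (use car P' Q' A' B' len \<alpha>eq \<beta>eq in auto)
  have eq2: "map_mat to_fract (P * A') * power_diag \<beta> = power_diag \<alpha> * map_mat at_inverse_coord (Q' * B)"
    by (rule key[of A A' P B Q Q']) (use car P' Q' A' B' len \<alpha>eq \<beta>eq in auto)
  have inv1: "A * P' * (P * A') = 1\<^sub>m m" by (rule left_inverse_mult[where k = m and n = m]) (use car P' A' in auto)
  have inv2: "P * A' * (A * P') = 1\<^sub>m m" by (rule left_inverse_mult[where k = m and n = m]) (use car P' A' in auto)
  have "\<exists>\<pi>. \<pi> permutes {0..<m} \<and> (\<forall>i<m. \<alpha> ! \<pi> i \<le> \<beta> ! i)"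
    by (rule diag_equivalence_le[OF len _ _ inv1 _ eq1]) (use car P' Q' A' B' in auto)
  moreover have "\<exists>\<rho>. \<rho> permutes {0..<m} \<and> (\<forall>i<m. \<beta> ! \<rho> i \<le> \<alpha> ! i)"
    by (rule diag_equivalence_le[OF len(2,1) _ _ inv2 _ eq2]) (use car P' Q' A' B' in auto)
  ultimately have "mset \<alpha> = mset \<beta>" using mset_eq_of_permuted_le[OF len] by metis
  thus ?thesis using \<alpha> \<beta> by simp
qed

text \<open>The exponents form a list here, because the basis of a tensor product is indexed by the pairs of
  positions in two lists; and the inverses of the base changes are named, because duals use them.\<close>

definition splits_as :: "'a::field poly fract mat \<Rightarrow> int list \<Rightarrow> bool" where
  "splits_as g \<alpha> \<longleftrightarrow> (\<exists>P P' Q Q'. g \<in> carrier_mat (length \<alpha>) (length \<alpha>) \<and>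
     P \<in> carrier_mat (length \<alpha>) (length \<alpha>) \<and> P' \<in> carrier_mat (length \<alpha>) (length \<alpha>) \<and>
     P * P' = 1\<^sub>m (length \<alpha>) \<and> P' * P = 1\<^sub>m (length \<alpha>) \<and>
     Q \<in> carrier_mat (length \<alpha>) (length \<alpha>) \<and> Q' \<in> carrier_mat (length \<alpha>) (length \<alpha>) \<and>
     Q * Q' = 1\<^sub>m (length \<alpha>) \<and> Q' * Q = 1\<^sub>m (length \<alpha>) \<and>
     map_mat to_fract P * g * map_mat at_inverse_coord Q = power_diag \<alpha>)"

lemma has_splitting_type_iff: "has_splitting_type g M \<longleftrightarrow> (\<exists>\<alpha>. mset \<alpha> = M \<and> splits_as g \<alpha>)"
proof
  assume "has_splitting_type g M"
  then obtain \<alpha> P Q where "mset \<alpha> = M" "g \<in> carrier_mat (length \<alpha>) (length \<alpha>)"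
    and P: "invertible_mat P" "P \<in> carrier_mat (length \<alpha>) (length \<alpha>)"
    and Q: "invertible_mat Q" "Q \<in> carrier_mat (length \<alpha>) (length \<alpha>)"
    and "map_mat to_fract P * g * map_mat at_inverse_coord Q = power_diag \<alpha>"
    unfolding has_splitting_type_def by blast
  with invertible_matE[OF P] invertible_matE[OF Q] show "\<exists>\<alpha>. mset \<alpha> = M \<and> splits_as g \<alpha>"
    unfolding splits_as_def by metis
next
  assume "\<exists>\<alpha>. mset \<alpha> = M \<and> splits_as g \<alpha>"
  thus "has_splitting_type g M"
    unfolding splits_as_def has_splitting_type_def using invertible_matI by blast
qed

lemma mult_mat_cancel_left:
  fixes A B C :: "'a::comm_ring_1 mat"
  assumes "A * B = 1\<^sub>m n" "A \<in> carrier_mat n k" "B \<in> carrier_mat k n" "C \<in> carrier_mat n m"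
  shows "A * (B * C) = C"
  unfolding assoc_mult_mat[OF assms(2,3,4), symmetric] assms(1)
  using assms(4) by (rule left_mult_one_mat)

lemma hom_mult_eq_one:
  assumes "A * B = 1\<^sub>m n" "A \<in> carrier_mat n k" "B \<in> carrier_mat k n"
  shows "map_mat to_fract A * map_mat to_fract B = 1\<^sub>m n"
    and "map_mat at_inverse_coord A * map_mat at_inverse_coord B = 1\<^sub>m n"
  using assms by (simp_all flip: frac_hom.mat_hom_mult[of A n k B n] at_inverse_hom.mat_hom_mult[of A n k B n]
      add: frac_hom.mat_hom_one at_inverse_hom.mat_hom_one)

lemma transpose_mat_diag: "transpose_mat (mat_diag n f) = mat_diag n f"
  by (rule eq_matI) (auto simp: mat_diag_def)

lemma transpose_mult_eq_one:
  fixes A B :: "'a::comm_semiring_1 mat"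
  assumes "A * B = 1\<^sub>m n" "A \<in> carrier_mat n k" "B \<in> carrier_mat k n"
  shows "transpose_mat B * transpose_mat A = 1\<^sub>m n"
  using assms by (metis transpose_mult transpose_one)

lemma splits_as_invertible:
  assumes "splits_as g \<alpha>"
  obtains g' where "g' \<in> carrier_mat (length \<alpha>) (length \<alpha>)"
    "g * g' = 1\<^sub>m (length \<alpha>)" "g' * g = 1\<^sub>m (length \<alpha>)"
proof -
  define m where "m = length \<alpha>"
  obtain P P' Q Q' where car: "g \<in> carrier_mat m m" "P \<in> carrier_mat m m" "P' \<in> carrier_mat m m"
      "Q \<in> carrier_mat m m" "Q' \<in> carrier_mat m m"
    and PP: "P * P' = 1\<^sub>m m" "P' * P = 1\<^sub>m m" and QQ: "Q * Q' = 1\<^sub>m m" "Q' * Q = 1\<^sub>m m"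
    and eq: "map_mat to_fract P * g * map_mat at_inverse_coord Q = power_diag \<alpha>"
    using assms unfolding splits_as_def m_def by blast
  define D' where "D' = mat_diag m (\<lambda>i. (coord :: 'a poly fract) powi (- \<alpha> ! i))"
  define g' where "g' = map_mat at_inverse_coord Q * D' * map_mat to_fract P"
  have D'car: "D' \<in> carrier_mat m m" by (simp add: D'_def)
  have g'car: "g' \<in> carrier_mat m m" using car D'car by (simp add: g'_def mult_carrier_mat[of _ m m _ m])
  have "map_mat to_fract P * g * map_mat at_inverse_coord Q * D' = 1\<^sub>m m"
    using eq power_diag_mult_uminus[of \<alpha>] by (simp add: D'_def m_def)
  hence 1: "map_mat to_fract P * (g * map_mat at_inverse_coord Q * D') = 1\<^sub>m m"
    using car D'car by (simp add: assoc_mult_mat[of _ m m _ m _ m] mult_carrier_mat[of _ m m _ m])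
  have "(g * map_mat at_inverse_coord Q * D') * map_mat to_fract P = 1\<^sub>m m"
    by (rule mat_mult_left_right_inverse[OF _ _ 1])
      (use car D'car in \<open>auto simp: mult_carrier_mat[of _ m m _ m]\<close>)
  hence gg': "g * g' = 1\<^sub>m m"
    using car D'car by (simp add: g'_def assoc_mult_mat[of _ m m _ m _ m] mult_carrier_mat[of _ m m _ m])
  have "g' * g = 1\<^sub>m m" by (rule mat_mult_left_right_inverse[OF car(1) g'car gg'])
  with gg' g'car show ?thesis using that by (simp add: m_def)
qed

text \<open>The transposed inverses of the base changes that diagonalize \<open>g\<close> diagonalize the contragredient.\<close>

lemma splits_as_dual:
  assumes "splits_as g \<alpha>" "dual_transition g g'"
  shows "splits_as g' (map uminus \<alpha>)"
proof -
  define m where "m = length \<alpha>"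
  obtain P P' Q Q' where car: "g \<in> carrier_mat m m" "P \<in> carrier_mat m m" "P' \<in> carrier_mat m m"
      "Q \<in> carrier_mat m m" "Q' \<in> carrier_mat m m"
    and PP: "P * P' = 1\<^sub>m m" "P' * P = 1\<^sub>m m" and QQ: "Q * Q' = 1\<^sub>m m" "Q' * Q = 1\<^sub>m m"
    and eq: "map_mat to_fract P * g * map_mat at_inverse_coord Q = power_diag \<alpha>"
    using assms(1) unfolding splits_as_def m_def by blast
  have gg: "g * transpose_mat g' = 1\<^sub>m m" "transpose_mat g' * g = 1\<^sub>m (dim_col g')"
    using assms(2) car(1) by (auto simp: dual_transition_def inverts_mat_def)
  have "dim_row g' = m" using gg(1) by (metis index_mult_mat(3) index_one_mat(3) index_transpose_mat(3))
  moreover have "dim_col g' = m" using gg(2) car(1) by (metis carrier_matD(2) index_mult_mat(3) index_one_mat(3))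
  ultimately have g': "g' \<in> carrier_mat m m" by auto
  note gg = gg[unfolded \<open>dim_col g' = m\<close>]
  define D' where "D' = mat_diag m (\<lambda>i. (coord :: 'a poly fract) powi (- \<alpha> ! i))"
  have D'car: "D' \<in> carrier_mat m m" by (simp add: D'_def)
  have DD: "power_diag \<alpha> * D' = 1\<^sub>m m"
    using power_diag_mult_uminus[of \<alpha>] by (simp add: D'_def m_def)
  let ?f = "map_mat (to_fract :: 'a poly \<Rightarrow> _)" and ?a = "map_mat (at_inverse_coord :: 'a poly \<Rightarrow> _)"
  have c: "?f P \<in> carrier_mat m m" "?f P' \<in> carrier_mat m m" "?a Q \<in> carrier_mat m m"
    "?a Q' \<in> carrier_mat m m" "transpose_mat g' \<in> carrier_mat m m"
    using car g' by auto
  have cancel: "?f P' * (?f P * X) = X" "?a Q' * (?a Q * X) = X" "transpose_mat g' * (g * X) = X"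
    if "X \<in> carrier_mat m m" for X
    using mult_mat_cancel_left[OF hom_mult_eq_one(1)[OF PP(2) car(3,2)] c(2,1) that]
      mult_mat_cancel_left[OF hom_mult_eq_one(2)[OF QQ(2) car(5,4)] c(4,3) that]
      mult_mat_cancel_left[OF gg(2) c(5) car(1) that] by auto
  have "?a Q' * transpose_mat g' * ?f P' * (?f P * g * ?a Q * D') = D'"
    using c car D'car by (simp add: assoc_mult_mat[of _ m m _ m _ m] mult_carrier_mat[of _ m m _ m] cancel)
  hence *: "?a Q' * transpose_mat g' * ?f P' = D'"
    unfolding eq DD using c by (simp add: mult_carrier_mat[of _ m m _ m])
  have "?f (transpose_mat P') * g' * ?a (transpose_mat Q') = transpose_mat D'"
    unfolding *[symmetric] using c g' car
    by (simp add: transpose_mult[of _ m m _ m] assoc_mult_mat[of _ m m _ m _ m] mult_carrier_mat[of _ m m _ m]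
        map_mat_transpose)
  hence "?f (transpose_mat P') * g' * ?a (transpose_mat Q') = power_diag (map uminus \<alpha>)"
    by (simp add: D'_def transpose_mat_diag m_def) (auto simp: mat_diag_def)
  moreover have "transpose_mat P' * transpose_mat P = 1\<^sub>m m" "transpose_mat P * transpose_mat P' = 1\<^sub>m m"
    "transpose_mat Q' * transpose_mat Q = 1\<^sub>m m" "transpose_mat Q * transpose_mat Q' = 1\<^sub>m m"
    using transpose_mult_eq_one[OF PP(1) car(2,3)] transpose_mult_eq_one[OF PP(2) car(3,2)]
      transpose_mult_eq_one[OF QQ(1) car(4,5)] transpose_mult_eq_one[OF QQ(2) car(5,4)] by auto
  ultimately show ?thesis
    unfolding splits_as_def using g' car
    by (intro exI[of _ "transpose_mat P'"] exI[of _ "transpose_mat P"]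
        exI[of _ "transpose_mat Q'"] exI[of _ "transpose_mat Q"]) (auto simp: m_def)
qed

section \<open>Tensor products\<close>

lemma sum_lessThan_mult:
  fixes f :: "nat \<Rightarrow> 'a::comm_monoid_add"
  shows "(\<Sum>k<p * q. f k) = (\<Sum>a<p. \<Sum>b<q. f (a * q + b))"
proof -
  have "(\<Sum>k<p * q. f k) = (\<Sum>a<p. sum f {a * q..<a * q + q})"
    by (rule sum.nat_group[symmetric])
  also have "\<dots> = (\<Sum>a<p. \<Sum>b<q. f (a * q + b))"
  proof (rule sum.cong[OF refl])
    fix a
    show "sum f {a * q..<a * q + q} = (\<Sum>b<q. f (a * q + b))"
      using sum.shift_bounds_nat_ivl[of f 0 "a * q" q]
      unfolding atLeast0LessThan add_0_left by (simp only: add.commute)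
  qed
  finally show ?thesis .
qed

lemma tensor_mat_carrier [simp]:
  "A \<in> carrier_mat p q \<Longrightarrow> B \<in> carrier_mat p' q' \<Longrightarrow> tensor_mat A B \<in> carrier_mat (p * p') (q * q')"
  by (auto simp: tensor_mat_def)

lemma div_less_of_less_mult: "(i::nat) < p * q \<Longrightarrow> i div q < p"
  by (simp add: less_mult_imp_div_less)

lemma mod_less_of_less_mult: "(i::nat) < p * q \<Longrightarrow> i mod q < q"
  by (cases "q = 0") auto

lemma mult_add_less_mult:
  assumes "(a::nat) < p" "b < q"
  shows "a * q + b < p * q"
proof -
  have "a * q + b < Suc a * q" using assms(2) by simp
  also have "\<dots> \<le> p * q" using assms(1) by (intro mult_le_mono1) simp
  finally show ?thesis .
qed

text \<open>The row and column indices of a Kronecker product are pairs, encoded by quotient and remainder; in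
  terms of pairs the sum over the middle index is a product of two sums.\<close>

lemma tensor_mat_mult:
  fixes A B C D :: "'a::comm_ring_1 mat"
  assumes A: "A \<in> carrier_mat p q" and B: "B \<in> carrier_mat q s"
    and C: "C \<in> carrier_mat p' q'" and D: "D \<in> carrier_mat q' s'"
  shows "tensor_mat (A * B) (C * D) = tensor_mat A C * tensor_mat B D"
proof (rule eq_matI)
  fix i j assume "i < dim_row (tensor_mat A C * tensor_mat B D)" "j < dim_col (tensor_mat A C * tensor_mat B D)"
  hence ij: "i < p * p'" "j < s * s'" using assms by (auto simp: tensor_mat_def)
  note bounds = div_less_of_less_mult[OF ij(1)] div_less_of_less_mult[OF ij(2)]
    mod_less_of_less_mult[OF ij(1)] mod_less_of_less_mult[OF ij(2)]
  have lt: "a * q' + b < q * q'" if "a < q" "b < q'" for a b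
    using that by (rule mult_add_less_mult)
  have "(tensor_mat A C * tensor_mat B D) $$ (i, j) =
      (\<Sum>k<q * q'. A $$ (i div p', k div q') * C $$ (i mod p', k mod q') *
        (B $$ (k div q', j div s') * D $$ (k mod q', j mod s')))"
    using assms ij by (simp add: tensor_mat_def scalar_prod_def atLeast0LessThan)
  also have "\<dots> = (\<Sum>a<q. \<Sum>b<q'. A $$ (i div p', a) * C $$ (i mod p', b) *
        (B $$ (a, j div s') * D $$ (b, j mod s')))"
    unfolding sum_lessThan_mult by (intro sum.cong refl) auto
  also have "\<dots> = (\<Sum>a<q. A $$ (i div p', a) * B $$ (a, j div s')) *
        (\<Sum>b<q'. C $$ (i mod p', b) * D $$ (b, j mod s'))"
    by (simp add: sum_product mult_ac)
  also have "\<dots> = tensor_mat (A * B) (C * D) $$ (i, j)"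
    using assms ij bounds by (simp add: tensor_mat_def scalar_prod_def atLeast0LessThan)
  finally show "tensor_mat (A * B) (C * D) $$ (i, j) = (tensor_mat A C * tensor_mat B D) $$ (i, j)" ..
qed (use assms in \<open>auto simp: tensor_mat_def\<close>)

lemma tensor_mat_diag:
  "tensor_mat (mat_diag p f) (mat_diag q g) = mat_diag (p * q) (\<lambda>i. f (i div q) * g (i mod q))"
proof (rule eq_matI)
  fix i j assume "i < dim_row (mat_diag (p * q) (\<lambda>i. f (i div q) * g (i mod q)))"
    "j < dim_col (mat_diag (p * q) (\<lambda>i. f (i div q) * g (i mod q)))"
  hence ij: "i < p * q" "j < p * q" by (auto simp: mat_diag_def)
  have "i = j \<longleftrightarrow> i div q = j div q \<and> i mod q = j mod q"
    by (metis div_mult_mod_eq)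
  thus "tensor_mat (mat_diag p f) (mat_diag q g) $$ (i, j) =
      mat_diag (p * q) (\<lambda>i. f (i div q) * g (i mod q)) $$ (i, j)"
    using ij div_less_of_less_mult[OF ij(1)] div_less_of_less_mult[OF ij(2)]
    mod_less_of_less_mult[OF ij(1)] mod_less_of_less_mult[OF ij(2)]
    by (auto simp: tensor_mat_def mat_diag_def)
qed (auto simp: tensor_mat_def mat_diag_def)

lemma tensor_mat_one: "tensor_mat (1\<^sub>m p) (1\<^sub>m q) = 1\<^sub>m (p * q)"
  using tensor_mat_diag[of p "\<lambda>_. 1" q "\<lambda>_. 1"] by simp

lemma (in comm_ring_hom) mat_hom_tensor: "map_mat hom (tensor_mat A B) = tensor_mat (map_mat hom A) (map_mat hom B)"
proof (rule eq_matI)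
  fix i j assume "i < dim_row (tensor_mat (map_mat hom A) (map_mat hom B))"
    "j < dim_col (tensor_mat (map_mat hom A) (map_mat hom B))"
  hence ij: "i < dim_row A * dim_row B" "j < dim_col A * dim_col B" by (auto simp: tensor_mat_def)
  thus "map_mat hom (tensor_mat A B) $$ (i, j) = tensor_mat (map_mat hom A) (map_mat hom B) $$ (i, j)"
    using div_less_of_less_mult[OF ij(1)] div_less_of_less_mult[OF ij(2)]
    mod_less_of_less_mult[OF ij(1)] mod_less_of_less_mult[OF ij(2)]
    by (simp add: tensor_mat_def hom_mult)
qed (auto simp: tensor_mat_def)

definition tensor_exponents :: "int list \<Rightarrow> int list \<Rightarrow> int list" where
  "tensor_exponents \<alpha> \<beta> =
     map (\<lambda>k. \<alpha> ! (k div length \<beta>) + \<beta> ! (k mod length \<beta>)) [0..<length \<alpha> * length \<beta>]"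

lemma splits_as_tensor:
  assumes "splits_as g \<alpha>" "splits_as h \<beta>"
  shows "splits_as (tensor_mat g h) (tensor_exponents \<alpha> \<beta>)"
proof -
  define p where "p = length \<alpha>"
  define q where "q = length \<beta>"
  obtain P P' Q Q' where g: "g \<in> carrier_mat p p" "P \<in> carrier_mat p p" "P' \<in> carrier_mat p p"
      "Q \<in> carrier_mat p p" "Q' \<in> carrier_mat p p"
    and gi: "P * P' = 1\<^sub>m p" "P' * P = 1\<^sub>m p" "Q * Q' = 1\<^sub>m p" "Q' * Q = 1\<^sub>m p"
    and geq: "map_mat to_fract P * g * map_mat at_inverse_coord Q = power_diag \<alpha>"
    using assms(1) unfolding splits_as_def p_def by blast
  obtain R R' S S' where h: "h \<in> carrier_mat q q" "R \<in> carrier_mat q q" "R' \<in> carrier_mat q q"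
      "S \<in> carrier_mat q q" "S' \<in> carrier_mat q q"
    and hi: "R * R' = 1\<^sub>m q" "R' * R = 1\<^sub>m q" "S * S' = 1\<^sub>m q" "S' * S = 1\<^sub>m q"
    and heq: "map_mat to_fract R * h * map_mat at_inverse_coord S = power_diag \<beta>"
    using assms(2) unfolding splits_as_def q_def by blast
  have inv: "tensor_mat X Y * tensor_mat X' Y' = 1\<^sub>m (p * q)"
    if "X * X' = 1\<^sub>m p" "Y * Y' = 1\<^sub>m q" "X \<in> carrier_mat p p" "X' \<in> carrier_mat p p"
      "Y \<in> carrier_mat q q" "Y' \<in> carrier_mat q q" for X X' Y Y' :: "'a poly mat"
    using that tensor_mat_mult[of X p p X' p Y q q Y' q] by (simp add: tensor_mat_one)
  have "map_mat to_fract (tensor_mat P R) * tensor_mat g h * map_mat at_inverse_coord (tensor_mat Q S) =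
      tensor_mat (map_mat to_fract P) (map_mat to_fract R) * tensor_mat g h *
      tensor_mat (map_mat at_inverse_coord Q) (map_mat at_inverse_coord S)"
    by (simp add: frac_hom.mat_hom_tensor at_inverse_hom.mat_hom_tensor)
  also have "\<dots> = tensor_mat (power_diag \<alpha>) (power_diag \<beta>)"
    unfolding geq[symmetric] heq[symmetric] using g h
    by (simp add: tensor_mat_mult[of _ p p _ p _ q q _ q] assoc_mult_mat[of _ "p * q" "p * q" _ "p * q" _ "p * q"] mult_carrier_mat[of _ p p _ p] mult_carrier_mat[of _ q q _ q])
  also have "\<dots> = power_diag (tensor_exponents \<alpha> \<beta>)"
    unfolding tensor_mat_diag
    by (rule eq_matI) (auto simp: tensor_exponents_def mat_diag_def power_int_add)
  finally have "map_mat to_fract (tensor_mat P R) * tensor_mat g h * map_mat at_inverse_coord (tensor_mat Q S) =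
    power_diag (tensor_exponents \<alpha> \<beta>)" .
  moreover have "length (tensor_exponents \<alpha> \<beta>) = p * q"
    by (simp add: tensor_exponents_def p_def q_def)
  ultimately show ?thesis
    unfolding splits_as_def
    using inv[OF gi(1) hi(1) g(2,3) h(2,3)] inv[OF gi(2) hi(2) g(3,2) h(3,2)]
      inv[OF gi(3) hi(3) g(4,5) h(4,5)] inv[OF gi(4) hi(4) g(5,4) h(5,4)]
    by (intro exI[of _ "tensor_mat P R"] exI[of _ "tensor_mat P' R'"]
        exI[of _ "tensor_mat Q S"] exI[of _ "tensor_mat Q' S'"]) (simp add: g h)
qed

lemma mset_tensor_exponents:
  "mset (tensor_exponents \<alpha> \<beta>) =
     image_mset (\<lambda>(i, j). \<alpha> ! i + \<beta> ! j) (mset_set ({..<length \<alpha>} \<times> {..<length \<beta>}))"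
proof -
  define p where "p = length \<alpha>"
  define q where "q = length \<beta>"
  have bij: "bij_betw (\<lambda>k. (k div q, k mod q)) {..<p * q} ({..<p} \<times> {..<q})"
  proof (rule bij_betw_byWitness[where f' = "\<lambda>(a, b). a * q + b"])
    show "(\<lambda>(a, b). a * q + b) ` ({..<p} \<times> {..<q}) \<subseteq> {..<p * q}"
      by (auto intro: mult_add_less_mult)
  qed (auto simp: div_less_of_less_mult mod_less_of_less_mult)
  have "mset (tensor_exponents \<alpha> \<beta>) =
      image_mset (\<lambda>k. \<alpha> ! (k div q) + \<beta> ! (k mod q)) (mset_set {..<p * q})"
    by (simp add: tensor_exponents_def p_def q_def mset_map atLeast0LessThan)
  also have "\<dots> = image_mset (\<lambda>(i, j). \<alpha> ! i + \<beta> ! j) (image_mset (\<lambda>k. (k div q, k mod q)) (mset_set {..<p * q}))"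
    by (simp add: multiset.map_comp o_def)
  also have "image_mset (\<lambda>k. (k div q, k mod q)) (mset_set {..<p * q}) = mset_set ({..<p} \<times> {..<q})"
    using image_mset_mset_set[OF bij_betw_imp_inj_on[OF bij]] bij_betw_imp_surj_on[OF bij] by simp
  finally show ?thesis by (simp add: p_def q_def)
qed

section \<open>Sub-bundles of a trivial bundle\<close>

text \<open>A sub-bundle of rank \<open>k\<close> of the trivial bundle of rank \<open>n\<close>, given by frames over the two charts whose
  columns are sections. The left inverses express that the fibres of the sub-bundle have rank
  \<open>k\<close> at each point of the chart.\<close>

definition chart_pair ::
  "nat \<Rightarrow> nat \<Rightarrow> 'a::field poly mat \<Rightarrow> 'a poly mat \<Rightarrow> 'a poly fract mat \<Rightarrow> bool" where
  "chart_pair n k U U' g \<longleftrightarrow> U \<in> carrier_mat n k \<and> U' \<in> carrier_mat n k \<and> g \<in> carrier_mat k k \<and>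
     map_mat at_inverse_coord U' = map_mat to_fract U * g \<and>
     (\<exists>Y\<in>carrier_mat k n. Y * U = 1\<^sub>m k) \<and> (\<exists>Y'\<in>carrier_mat k n. Y' * U' = 1\<^sub>m k)"

lemma chart_pair_change:
  assumes cp: "chart_pair n k U U' g"
    and P: "P \<in> carrier_mat k k" "P' \<in> carrier_mat k k" "P * P' = 1\<^sub>m k" "P' * P = 1\<^sub>m k"
    and Q: "Q \<in> carrier_mat k k" "Q' \<in> carrier_mat k k" "Q * Q' = 1\<^sub>m k" "Q' * Q = 1\<^sub>m k"
  shows "chart_pair n k (U * P') (U' * Q) (map_mat to_fract P * g * map_mat at_inverse_coord Q)"
proof -
  obtain Y Y' where U: "U \<in> carrier_mat n k" "U' \<in> carrier_mat n k" "g \<in> carrier_mat k k"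
    and eq: "map_mat at_inverse_coord U' = map_mat to_fract U * g"
    and Y: "Y \<in> carrier_mat k n" "Y * U = 1\<^sub>m k" and Y': "Y' \<in> carrier_mat k n" "Y' * U' = 1\<^sub>m k"
    using cp unfolding chart_pair_def by blast
  let ?f = "map_mat (to_fract :: 'a poly \<Rightarrow> _)" and ?a = "map_mat (at_inverse_coord :: 'a poly \<Rightarrow> _)"
  have c: "?f P \<in> carrier_mat k k" "?f P' \<in> carrier_mat k k" "?a Q \<in> carrier_mat k k" "?f U \<in> carrier_mat n k"
    using P Q U by auto
  have "?a (U' * Q) = ?f U * g * ?a Q"
    using U Q by (simp add: at_inverse_hom.mat_hom_mult[of _ n k _ k] eq)
  also have "\<dots> = ?f U * (g * ?a Q)"
    using c U by (simp add: assoc_mult_mat[of _ n k _ k _ k])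
  also have "g * ?a Q = ?f P' * (?f P * (g * ?a Q))"
    using mult_mat_cancel_left[OF hom_mult_eq_one(1)[OF P(4,2,1)] c(2,1), of "g * ?a Q" k] U c
    by (simp add: mult_carrier_mat[of _ k k _ k])
  also have "?f U * \<dots> = ?f U * ?f P' * (?f P * g * ?a Q)"
    using c U by (simp add: assoc_mult_mat[of _ n k _ k _ k] assoc_mult_mat[of _ k k _ k _ k] mult_carrier_mat[of _ k k _ k])
  also have "?f U * ?f P' = ?f (U * P')"
    using U P by (simp add: frac_hom.mat_hom_mult[of _ n k _ k])
  finally have 1: "?a (U' * Q) = ?f (U * P') * (?f P * g * ?a Q)" .
  have 2: "P * Y * (U * P') = 1\<^sub>m k" "Q' * Y' * (U' * Q) = 1\<^sub>m k"
    using left_inverse_mult[OF P(1) Y(1) U(1) P(2) Y(2) P(3)]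
      left_inverse_mult[OF Q(2) Y'(1) U(2) Q(1) Y'(2) Q(4)] .
  have "P * Y \<in> carrier_mat k n" "Q' * Y' \<in> carrier_mat k n" "?f P * g * ?a Q \<in> carrier_mat k k"
    using P Q Y Y' U by (auto simp: mult_carrier_mat[of _ k k _ k])
  thus ?thesis
    unfolding chart_pair_def using 1 2 mult_carrier_mat[OF U(1) P(2)] mult_carrier_mat[OF U(2) Q(1)] by blast
qed

lemma left_inverse_sum:
  fixes U :: "'a::comm_ring_1 mat"
  assumes "Y * U = 1\<^sub>m k" "Y \<in> carrier_mat k n" "U \<in> carrier_mat n k" "i < k" "j < k"
  shows "(\<Sum>r<n. Y $$ (i, r) * U $$ (r, j)) = (if i = j then 1 else 0)"
proof -
  have "(\<Sum>r<n. Y $$ (i, r) * U $$ (r, j)) = (Y * U) $$ (i, j)"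
    using assms(2-5) by (simp add: scalar_prod_def atLeast0LessThan)
  thus ?thesis unfolding assms(1) using assms(4,5) by simp
qed

lemma left_inverse_sum_combination:
  fixes U :: "'a::comm_ring_1 mat"
  assumes "Y * U = 1\<^sub>m k" "Y \<in> carrier_mat k n" "U \<in> carrier_mat n k" "j < k"
  shows "(\<Sum>r<n. Y $$ (j, r) * (\<Sum>i<k. U $$ (r, i) * f i)) = f j"
proof -
  have "(\<Sum>r<n. Y $$ (j, r) * (\<Sum>i<k. U $$ (r, i) * f i)) =
      (\<Sum>i<k. (\<Sum>r<n. Y $$ (j, r) * U $$ (r, i)) * f i)"
    by (simp add: sum_distrib_left sum_distrib_right mult.assoc) (rule sum.swap)
  also have "\<dots> = (\<Sum>i<k. if i = j then f i else 0)"
    using left_inverse_sum[OF assms(1-3) assms(4)] by (intro sum.cong) auto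
  finally show ?thesis using assms(4) by simp
qed

text \<open>When the transition matrix is diagonal, the columns of the frame have homogenizations of the
  degrees given by the exponents.\<close>

lemma chart_pair_diag:
  assumes cp: "chart_pair n k U U' (mat_diag k (\<lambda>i. coord powi (- a i)))" and i: "i < k"
  shows "0 \<le> a i" and "r < n \<Longrightarrow> degree (U $$ (r, i)) \<le> nat (a i)"
    and "r < n \<Longrightarrow> to_fract (U $$ (r, i)) * coord powi (- a i) = at_inverse_coord (U' $$ (r, i))"
proof -
  obtain Y where U: "U \<in> carrier_mat n k" "U' \<in> carrier_mat n k"
    and eq: "map_mat at_inverse_coord U' = map_mat to_fract U * mat_diag k (\<lambda>i. coord powi (- a i))"
    and Y: "Y \<in> carrier_mat k n" "Y * U = 1\<^sub>m k"
    using cp unfolding chart_pair_def by blast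
  show entry: "to_fract (U $$ (r, i)) * coord powi (- a i) = at_inverse_coord (U' $$ (r, i))" if "r < n" for r
    using arg_cong[OF eq, of "\<lambda>M. M $$ (r, i)"] that i U
    by (simp add: mat_diag_mult_right[of _ n k])
  have deg: "int (degree (U $$ (r, i))) \<le> a i" if "r < n" "U $$ (r, i) \<noteq> 0" for r
    using degree_le_of_at_inverse_coord[OF entry] that by force
  have "\<exists>r<n. U $$ (r, i) \<noteq> 0"
  proof (rule ccontr)
    assume "\<not> (\<exists>r<n. U $$ (r, i) \<noteq> 0)"
    thus False using left_inverse_sum[OF Y(2,1) U(1) i i] by simp
  qed
  thus "0 \<le> a i" using deg by force
  thus "degree (U $$ (r, i)) \<le> nat (a i)" if "r < n"
    using deg[OF that] by (cases "U $$ (r, i) = 0") auto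
qed

text \<open>Vectors of \<open>n\<close> polynomials are functions that vanish from \<open>n\<close> on. They form an infinite-dimensional space
  over the constants, in which the sections of bounded degree are finite-dimensional.\<close>

definition pscale :: "'a::field \<Rightarrow> (nat \<Rightarrow> 'a poly) \<Rightarrow> nat \<Rightarrow> 'a poly" where
  "pscale c v = (\<lambda>i. Polynomial.smult c (v i))"

interpretation pv: vector_space pscale
  by unfold_locales (auto simp: pscale_def fun_eq_iff smult_add_right smult_add_left)

lemma sum_fun_apply: "(\<Sum>x\<in>A. f x) i = (\<Sum>x\<in>A. (f x :: 'b \<Rightarrow> 'c::comm_monoid_add) i)"
  by (induction A rule: infinite_finite_induct) auto

text \<open>A section over the first chart is a section of the twist by \<open>m\<close> of the sub-bundle if and only if its
  entries, as polynomials, have degree at most \<open>m\<close>.\<close>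

definition bounded_sections :: "nat \<Rightarrow> nat \<Rightarrow> 'a::field poly mat \<Rightarrow> (nat \<Rightarrow> 'a poly) set" where
  "bounded_sections n m U = {v. (\<forall>i\<ge>n. v i = 0) \<and> (\<forall>i. degree (v i) \<le> m) \<and>
     (\<exists>f. \<forall>r<n. v r = (\<Sum>i<dim_col U. U $$ (r, i) * f i))}"

lemma bounded_sections_change:
  assumes U: "U \<in> carrier_mat n k"
    and P: "P \<in> carrier_mat k k" "P' \<in> carrier_mat k k" "P' * P = 1\<^sub>m k"
  shows "bounded_sections n m (U * P') = bounded_sections n m U"
proof -
  have sub: "\<exists>f'. \<forall>r<n. v r = (\<Sum>i<k. W $$ (r, i) * f' i)"
    if f: "\<forall>r<n. v r = (\<Sum>i<k. (W * R) $$ (r, i) * f i)" and W: "W \<in> carrier_mat n k" "R \<in> carrier_mat k k"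
    for v f and W R :: "'a poly mat"
  proof (intro exI[of _ "\<lambda>i. \<Sum>j<k. R $$ (i, j) * f j"] allI impI)
    fix r assume "r < n"
    hence "v r = (\<Sum>j<k. (\<Sum>i<k. W $$ (r, i) * R $$ (i, j)) * f j)"
      using f W by (simp add: scalar_prod_def atLeast0LessThan)
    also have "\<dots> = (\<Sum>i<k. W $$ (r, i) * (\<Sum>j<k. R $$ (i, j) * f j))"
      by (simp add: sum_distrib_left sum_distrib_right mult.assoc) (rule sum.swap)
    finally show "v r = \<dots>" .
  qed
  have UP: "U * P' * P = U" using U P by (simp add: assoc_mult_mat[of _ n k _ k _ k])
  have "(\<exists>f. \<forall>r<n. v r = (\<Sum>i<k. (U * P') $$ (r, i) * f i)) \<longleftrightarrow>
        (\<exists>f. \<forall>r<n. v r = (\<Sum>i<k. U $$ (r, i) * f i))" for v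
  proof
    assume "\<exists>f. \<forall>r<n. v r = (\<Sum>i<k. (U * P') $$ (r, i) * f i)"
    then obtain f where "\<forall>r<n. v r = (\<Sum>i<k. (U * P') $$ (r, i) * f i)" ..
    from sub[OF this U P(2)] show "\<exists>f. \<forall>r<n. v r = (\<Sum>i<k. U $$ (r, i) * f i)" .
  next
    assume "\<exists>f. \<forall>r<n. v r = (\<Sum>i<k. U $$ (r, i) * f i)"
    then obtain f where "\<forall>r<n. v r = (\<Sum>i<k. (U * P' * P) $$ (r, i) * f i)" unfolding UP ..
    from sub[OF this mult_carrier_mat[OF U P(2)] P(1)]
    show "\<exists>f. \<forall>r<n. v r = (\<Sum>i<k. (U * P') $$ (r, i) * f i)" .
  qed
  thus ?thesis using U P by (auto simp: bounded_sections_def)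
qed

text \<open>A section \<open>\<Sum>\<^sub>i f\<^sub>i u\<^sub>i\<close> has degree at most \<open>m\<close> if and only if each \<open>f\<^sub>i\<close> has degree
  at most \<open>m - a\<^sub>i\<close>, because the reversed columns are a frame near infinity. So the products of the
  columns \<open>u\<^sub>i\<close> with monomials of these degrees are a basis.\<close>

lemma dim_bounded_sections_diag:
  assumes cp: "chart_pair n k U U' (mat_diag k (\<lambda>i. coord powi (- a i)))"
  shows "pv.dim (bounded_sections n m U) = (\<Sum>i<k. nat (int m + 1 - a i))"
proof -
  obtain Y Y' where U: "U \<in> carrier_mat n k" "U' \<in> carrier_mat n k"
    and Y: "Y \<in> carrier_mat k n" "Y * U = 1\<^sub>m k" and Y': "Y' \<in> carrier_mat k n" "Y' * U' = 1\<^sub>m k"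
    using cp unfolding chart_pair_def by blast
  define N where "N i = nat (int m + 1 - a i)" for i
  define I where "I = (SIGMA i:{..<k}. {..<N i})"
  define e where "e = (\<lambda>(i, t) r. if r < n then U $$ (r, i) * monom 1 t else 0)"
  have finI: "finite I" by (simp add: I_def)
  have cardI: "card I = (\<Sum>i<k. N i)" by (simp add: I_def)
  have comb: "(\<Sum>p\<in>I. pscale (c p) (e p)) r = (\<Sum>i<k. U $$ (r, i) * (\<Sum>t<N i. monom (c (i, t)) t))"
    if "r < n" for c r
  proof -
    have "(\<Sum>p\<in>I. pscale (c p) (e p)) r = (\<Sum>i<k. \<Sum>t<N i. pscale (c (i, t)) (e (i, t)) r)"
      unfolding sum_fun_apply I_def by (subst sum.Sigma) auto
    also have "\<dots> = (\<Sum>i<k. \<Sum>t<N i. U $$ (r, i) * monom (c (i, t)) t)"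
      using that by (intro sum.cong refl) (auto simp: pscale_def e_def smult_monom simp flip: mult_smult_right)
    finally show ?thesis by (simp add: sum_distrib_left)
  qed
  have zero: "c p = 0" if "(\<Sum>p\<in>I. pscale (c p) (e p)) = 0" "p \<in> I" for c p
  proof -
    obtain j t where p: "p = (j, t)" "j < k" "t < N j" using \<open>p \<in> I\<close> by (auto simp: I_def)
    have "(\<Sum>r<n. Y $$ (j, r) * (\<Sum>i<k. U $$ (r, i) * (\<Sum>t<N i. monom (c (i, t)) t))) = 0"
    proof (rule sum.neutral, rule ballI)
      fix r assume "r \<in> {..<n}"
      hence "(\<Sum>i<k. U $$ (r, i) * (\<Sum>t<N i. monom (c (i, t)) t)) = 0"
        using comb[of r c] that(1) by simp
      thus "Y $$ (j, r) * (\<Sum>i<k. U $$ (r, i) * (\<Sum>t<N i. monom (c (i, t)) t)) = 0" by simp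
    qed
    hence "(\<Sum>t<N j. monom (c (j, t)) t) = 0"
      using left_inverse_sum_combination[OF Y(2,1) U(1) p(2)] by simp
    hence "coeff (\<Sum>t<N j. monom (c (j, t)) t) t = 0" by simp
    thus ?thesis using p by (simp add: coeff_sum)
  qed
  have inj: "inj_on e I"
  proof (rule inj_onI, rule ccontr)
    fix p q assume pq: "p \<in> I" "q \<in> I" "e p = e q" "p \<noteq> q"
    define c where "c x = (if x = p then 1 else if x = q then - 1 else (0 :: 'a))" for x
    have "(\<Sum>x\<in>I. pscale (c x) (e x)) = (\<Sum>x\<in>{p, q}. pscale (c x) (e x))"
      using pq finI by (intro sum.mono_neutral_right) (auto simp: c_def pscale_def)
    also have "\<dots> = 0" using pq by (auto simp: c_def pscale_def fun_eq_iff)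
    finally have "c p = 0" using zero pq by blast
    thus False by (simp add: c_def)
  qed
  have indep: "pv.independent (e ` I)"
  proof (rule pv.independent_if_scalars_zero)
    fix f v assume *: "(\<Sum>x\<in>e ` I. pscale (f x) x) = 0" "v \<in> e ` I"
    have "(\<Sum>p\<in>I. pscale (f (e p)) (e p)) = 0" using *(1) by (simp add: sum.reindex[OF inj])
    with *(2) show "f v = 0" using zero[of "\<lambda>p. f (e p)"] by blast
  qed (simp add: finI)
  have sub: "e ` I \<subseteq> bounded_sections n m U"
  proof
    fix v assume "v \<in> e ` I"
    then obtain j t where v: "v = e (j, t)" "j < k" "t < N j" by (auto simp: I_def)
    have deg: "degree (U $$ (r, j) * monom 1 t) \<le> m" if "r < n" for r
    proof -
      have "degree (U $$ (r, j) * monom 1 t) \<le> degree (U $$ (r, j)) + t"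
        by (rule order_trans[OF degree_mult_le]) (simp add: degree_monom_eq)
      thus ?thesis using chart_pair_diag(1,2)[OF cp v(2)] that v(3) by (fastforce simp: N_def)
    qed
    have "\<exists>f. \<forall>r<n. v r = (\<Sum>i<dim_col U. U $$ (r, i) * f i)"
      using v U by (intro exI[of _ "\<lambda>i. if i = j then monom 1 t else 0"])
        (auto simp: e_def if_distrib[of "(*) _"] cong: if_cong)
    thus "v \<in> bounded_sections n m U" using v deg by (auto simp: bounded_sections_def e_def)
  qed
  have span: "bounded_sections n m U \<subseteq> pv.span (e ` I)"
  proof
    fix v assume "v \<in> bounded_sections n m U"
    then obtain f where v: "\<forall>i\<ge>n. v i = 0" "\<forall>i. degree (v i) \<le> m"
      and f: "\<forall>r<n. v r = (\<Sum>i<k. U $$ (r, i) * f i)"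
      using U by (auto simp: bounded_sections_def)
    have deg: "coeff (f j) t = 0" if "j < k" "t \<ge> N j" for j t
    proof (rule ccontr)
      assume nz: "coeff (f j) t \<noteq> 0"
      have "at_inverse_coord (\<Sum>r<n. Y' $$ (j, r) * reversal m (v r)) =
          (\<Sum>r<n. at_inverse_coord (Y' $$ (j, r)) * (to_fract (v r) * coord powi (- int m)))"
        using v(2) by (simp add: at_inverse_coord_sum at_inverse_hom.hom_mult at_inverse_coord_reversal)
      also have "\<dots> = (\<Sum>r<n. at_inverse_coord (Y' $$ (j, r)) *
          (\<Sum>i<k. at_inverse_coord (U' $$ (r, i)) * (to_fract (f i) * coord powi (a i - int m))))"
      proof (intro sum.cong refl arg_cong2[of _ _ _ _ "(*)"])
        fix r assume r: "r \<in> {..<n}"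
        have "to_fract (U $$ (r, i)) * to_fract (f i) * coord powi (- int m) =
            at_inverse_coord (U' $$ (r, i)) * (to_fract (f i) * coord powi (a i - int m))" if "i < k" for i
        proof -
          have "(coord :: 'a poly fract) powi (- a i) * coord powi (a i - int m) = coord powi (- int m)"
            by (simp flip: power_int_add)
          thus ?thesis
            using chart_pair_diag(3)[OF cp that, of r] r by (simp add: mult_ac flip: \<open>_ = coord powi (- int m)\<close>)
        qed
        hence "(\<Sum>i<k. to_fract (U $$ (r, i)) * to_fract (f i) * coord powi (- int m)) =
          (\<Sum>i<k. at_inverse_coord (U' $$ (r, i)) * (to_fract (f i) * coord powi (a i - int m)))"
          by (intro sum.cong) auto
        thus "to_fract (v r) * coord powi (- int m) =
          (\<Sum>i<k. at_inverse_coord (U' $$ (r, i)) * (to_fract (f i) * coord powi (a i - int m)))"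
          using f r by (simp add: to_fract_sum sum_distrib_right)
      qed
      also have "\<dots> = to_fract (f j) * coord powi (a j - int m)"
      proof -
        have "map_mat at_inverse_coord Y' * map_mat at_inverse_coord U' = 1\<^sub>m k"
          by (rule hom_mult_eq_one(2)[OF Y'(2,1) U(2)])
        from left_inverse_sum_combination[OF this, of n j "\<lambda>i. to_fract (f i) * coord powi (a i - int m)"]
        show ?thesis using Y' U that by simp
      qed
      finally have "to_fract (f j) * coord powi (a j - int m) =
          at_inverse_coord (\<Sum>r<n. Y' $$ (j, r) * reversal m (v r))" ..
      moreover have "f j \<noteq> 0" using nz by auto
      ultimately have "int (degree (f j)) \<le> int m - a j"
        using degree_le_of_at_inverse_coord by fastforce
      moreover have "t \<le> degree (f j)" using nz by (rule le_degree)
      ultimately show False using that by (simp add: N_def)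
    qed
    have fj: "(\<Sum>t<N j. monom (coeff (f j) t) t) = f j" if "j < k" for j
      by (rule poly_eqI) (auto simp: coeff_sum deg[OF that])
    have "v = (\<Sum>p\<in>I. pscale (coeff (f (fst p)) (snd p)) (e p))"
    proof
      fix r
      show "v r = (\<Sum>p\<in>I. pscale (coeff (f (fst p)) (snd p)) (e p)) r"
      proof (cases "r < n")
        case True
        thus ?thesis using f by (simp add: comb[OF True] fj)
      next
        case False
        thus ?thesis using v(1) by (auto simp: sum_fun_apply pscale_def e_def intro!: sum.neutral)
      qed
    qed
    also have "\<dots> \<in> pv.span (e ` I)"
      by (intro pv.span_sum pv.span_scale pv.span_base) auto
    finally show "v \<in> pv.span (e ` I)" .
  qed
  have "card (e ` I) = pv.dim (bounded_sections n m U)"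
    by (rule pv.basis_card_eq_dim[OF sub span indep])
  thus ?thesis by (simp add: card_image[OF inj] cardI N_def)
qed

lemma dim_bounded_sections:
  assumes cp: "chart_pair n k U U' g" and g: "splits_as g (map uminus \<alpha>)"
  shows "\<forall>x\<in>set \<alpha>. 0 \<le> x" and "pv.dim (bounded_sections n m U) = (\<Sum>x\<leftarrow>\<alpha>. nat (int m + 1 - x))"
proof -
  obtain P P' Q Q' where k: "g \<in> carrier_mat (length \<alpha>) (length \<alpha>)"
    and P: "P \<in> carrier_mat (length \<alpha>) (length \<alpha>)" "P' \<in> carrier_mat (length \<alpha>) (length \<alpha>)"
      "P * P' = 1\<^sub>m (length \<alpha>)" "P' * P = 1\<^sub>m (length \<alpha>)"
    and Q: "Q \<in> carrier_mat (length \<alpha>) (length \<alpha>)" "Q' \<in> carrier_mat (length \<alpha>) (length \<alpha>)"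
      "Q * Q' = 1\<^sub>m (length \<alpha>)" "Q' * Q = 1\<^sub>m (length \<alpha>)"
    and eq: "map_mat to_fract P * g * map_mat at_inverse_coord Q = power_diag (map uminus \<alpha>)"
    using g unfolding splits_as_def by auto
  have U: "U \<in> carrier_mat n k" and len: "length \<alpha> = k"
    using cp k unfolding chart_pair_def by auto
  note P = P[unfolded len] and Q = Q[unfolded len]
  have diag: "power_diag (map uminus \<alpha>) = mat_diag k (\<lambda>i. coord powi (- (\<alpha> ! i)))"
    using len by (intro eq_matI) (auto simp: mat_diag_def)
  note cp' = chart_pair_change[OF cp P Q, unfolded eq diag]
  show "\<forall>x\<in>set \<alpha>. 0 \<le> x"
    using chart_pair_diag(1)[OF cp'] len by (metis in_set_conv_nth)
  show "pv.dim (bounded_sections n m U) = (\<Sum>x\<leftarrow>\<alpha>. nat (int m + 1 - x))"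
    using dim_bounded_sections_diag[OF cp', of m] bounded_sections_change[OF U P(1,2,4), of m] len
    by (simp add: sum_list_sum_nth atLeast0LessThan)
qed

section \<open>Splitting of bundles on the projective line\<close>

lemmas eval_det = comm_ring_hom.hom_det[OF poly_hom.comm_ring_hom_axioms]
lemmas eval_mat_mult = semiring_hom.mat_hom_mult[OF poly_hom.semiring_hom_axioms]
lemmas eval_mat_one = semiring_hom.mat_hom_one[OF poly_hom.semiring_hom_axioms]

text \<open>A polynomial without zeros over an algebraically closed field is constant, so a matrix that is
  invertible at every point has a unit as determinant, and the adjugate yields the inverse.\<close>

lemma poly_mat_invertible:
  fixes Q :: "'a::alg_closed_field poly mat"
  assumes Q: "Q \<in> carrier_mat k k" and det: "\<And>y. det (map_mat (\<lambda>p. poly p y) Q) \<noteq> 0"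
  obtains Q' where "Q' \<in> carrier_mat k k" "Q * Q' = 1\<^sub>m k" "Q' * Q = 1\<^sub>m k"
proof -
  have "poly (det Q) y \<noteq> 0" for y
    using det[of y] by (simp add: eval_det)
  hence "degree (det Q) = 0"
    using alg_closed_imp_poly_has_root[of "det Q"] by blast
  then obtain c where c: "det Q = [:c:]" by (metis degree_eq_zeroE)
  hence "c \<noteq> 0" using \<open>\<And>y. poly (det Q) y \<noteq> 0\<close> by auto
  hence unit: "det Q * [:inverse c:] = 1" "[:inverse c:] * det Q = 1"
    by (simp_all add: c one_pCons)
  note adj = adj_mat[OF Q]
  show ?thesis
  proof (rule that[of "[:inverse c:] \<cdot>\<^sub>m adj_mat Q"])
    show "[:inverse c:] \<cdot>\<^sub>m adj_mat Q \<in> carrier_mat k k" using adj by simp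
    have "Q * ([:inverse c:] \<cdot>\<^sub>m adj_mat Q) = [:inverse c:] \<cdot>\<^sub>m (det Q \<cdot>\<^sub>m 1\<^sub>m k)"
      using mult_smult_distrib[OF Q adj(1)] adj(2) by simp
    also have "\<dots> = 1\<^sub>m k" using unit by (intro eq_matI) auto
    finally show "Q * ([:inverse c:] \<cdot>\<^sub>m adj_mat Q) = 1\<^sub>m k" .
    have "([:inverse c:] \<cdot>\<^sub>m adj_mat Q) * Q = [:inverse c:] \<cdot>\<^sub>m (det Q \<cdot>\<^sub>m 1\<^sub>m k)"
      using mult_smult_assoc_mat[OF adj(1) Q] adj(3) by simp
    also have "\<dots> = 1\<^sub>m k" using unit by (intro eq_matI) auto
    finally show "([:inverse c:] \<cdot>\<^sub>m adj_mat Q) * Q = 1\<^sub>m k" .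
  qed
qed

text \<open>The elementary base change that replaces the \<open>j\<close>-th column by the combination of all columns with
  coefficients \<open>c\<close>.\<close>

definition column_replacement :: "nat \<Rightarrow> nat \<Rightarrow> (nat \<Rightarrow> 'a::comm_ring_1) \<Rightarrow> 'a mat" where
  "column_replacement k j c = mat k k (\<lambda>(i, l). if l = j then c i else if i = l then 1 else 0)"

lemma column_replacement_mult:
  assumes "j < k" "c j * d j = 1" "\<And>i. i < k \<Longrightarrow> i \<noteq> j \<Longrightarrow> d i = - c i * d j"
  shows "column_replacement k j c * column_replacement k j d = 1\<^sub>m k"
proof (rule eq_matI)
  fix i l assume "i < dim_row (1\<^sub>m k :: 'a mat)" "l < dim_col (1\<^sub>m k :: 'a mat)"
  hence il: "i < k" "l < k" by auto
  have "(column_replacement k j c * column_replacement k j d) $$ (i, l) =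
      (\<Sum>m<k. (if m = j then c i else if i = m then 1 else 0) * (if l = j then d m else if m = l then 1 else 0))"
    using il by (simp add: column_replacement_def scalar_prod_def atLeast0LessThan)
  also have "\<dots> = (if i = l then 1 else 0)"
  proof (cases "l = j")
    case True
    have "(\<Sum>m<k. (if m = j then c i else if i = m then 1 else 0) * d m) =
        c i * d j + (\<Sum>m\<in>{..<k} - {j}. (if m = j then c i else if i = m then 1 else 0) * d m)"
      using assms(1) by (subst sum.remove[of _ j]) auto
    also have "(\<Sum>m\<in>{..<k} - {j}. (if m = j then c i else if i = m then 1 else 0) * d m) =
        (\<Sum>m\<in>{..<k} - {j}. if i = m then d m else 0)"
      by (intro sum.cong) auto
    also have "\<dots> = (if i = j then 0 else d i)" using il by (simp add: sum.delta')
    finally show ?thesis using True assms il by (auto split: if_splits)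
  next
    case False
    hence "(\<Sum>m<k. (if m = j then c i else if i = m then 1 else 0) * (if l = j then d m else if m = l then 1 else 0)) =
        (\<Sum>m<k. if m = l then (if i = m then 1 else 0) else 0)"
      by (intro sum.cong) auto
    thus ?thesis using il by simp
  qed
  finally show "(column_replacement k j c * column_replacement k j d) $$ (i, l) = 1\<^sub>m k $$ (i, l)"
    using il by simp
qed (auto simp: column_replacement_def)

lemma column_replacement_carrier [simp]: "column_replacement k j c \<in> carrier_mat k k"
  by (simp add: column_replacement_def)

text \<open>If the coefficient vectors of \<open>z ^ a i\<close> in the columns of a frame are linearly dependent, then
  a column of the largest degree that occurs in a relation can be replaced by a combination of
  smaller degree.\<close>

lemma reduce_column_degree:
  fixes U :: "'a::field poly mat"
  assumes U: "U \<in> carrier_mat n k" and Y: "Y \<in> carrier_mat k n" "Y * U = 1\<^sub>m k"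
    and deg: "\<And>r i. r < n \<Longrightarrow> i < k \<Longrightarrow> degree (U $$ (r, i)) \<le> a i"
    and rel: "\<And>r. r < n \<Longrightarrow> (\<Sum>i<k. coeff (U $$ (r, i)) (a i) * l i) = 0"
    and nz: "i0 < k" "l i0 \<noteq> 0"
  obtains E E' a' where "E \<in> carrier_mat k k" "E' \<in> carrier_mat k k" "E * E' = 1\<^sub>m k" "E' * E = 1\<^sub>m k"
    "\<And>r i. r < n \<Longrightarrow> i < k \<Longrightarrow> degree ((U * E) $$ (r, i)) \<le> a' i"
    "(\<Sum>i<k. a' i) < (\<Sum>i<k. (a i :: nat))"
proof -
  define S where "S = {i. i < k \<and> l i \<noteq> 0}"
  have S: "finite S" "S \<noteq> {}" using nz by (auto simp: S_def)
  obtain j where j: "j \<in> S" "\<And>i. i \<in> S \<Longrightarrow> a i \<le> a j"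
  proof -
    have "Max (a ` S) \<in> a ` S" using S by (intro Max_in) auto
    then obtain j where "j \<in> S" "a j = Max (a ` S)" by auto
    thus ?thesis using that[of j] S by (metis Max_ge finite_imageI imageI)
  qed
  hence jk: "j < k" "l j \<noteq> 0" by (auto simp: S_def)
  define c where "c i = (if i \<in> S then monom (l i) (a j - a i) else 0)" for i
  \<comment> \<open>The inverse base change; \<open>c j\<close> is the constant \<open>l j\<close>.\<close>
  define d where "d i = (if i = j then [:inverse (l j):] else - c i * [:inverse (l j):])" for i
  define E where "E = column_replacement k j c"
  define E' where "E' = column_replacement k j d"
  have cj: "c j = [:l j:]" using j(1) by (simp add: c_def monom_0)
  have E: "E \<in> carrier_mat k k" "E' \<in> carrier_mat k k" by (simp_all add: E_def E'_def)
  have EE': "E * E' = 1\<^sub>m k"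
    unfolding E_def E'_def using jk by (intro column_replacement_mult) (auto simp: d_def cj one_pCons)
  have E'E: "E' * E = 1\<^sub>m k"
    unfolding E_def E'_def using jk by (intro column_replacement_mult) (auto simp: d_def cj one_pCons)
  have entry: "(U * E) $$ (r, i) = U $$ (r, i)" if "r < n" "i < k" "i \<noteq> j" for r i
  proof -
    have "(U * E) $$ (r, i) = (\<Sum>m<k. U $$ (r, m) * (if m = i then 1 else 0))"
      using that U by (simp add: E_def column_replacement_def scalar_prod_def atLeast0LessThan)
    also have "\<dots> = (\<Sum>m<k. if m = i then U $$ (r, m) else 0)" by (intro sum.cong) auto
    finally have "(U * E) $$ (r, i) = \<dots>" .
    thus ?thesis using that by simp
  qed
  have entry_j: "(U * E) $$ (r, j) = (\<Sum>i<k. U $$ (r, i) * c i)" if "r < n" for r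
    using that U jk by (simp add: E_def column_replacement_def scalar_prod_def atLeast0LessThan)
  have coeff_j: "coeff ((U * E) $$ (r, j)) t = 0" if "r < n" "t \<ge> a j" for r t
  proof -
    have "coeff (U $$ (r, i) * c i) t = (if t = a j then coeff (U $$ (r, i)) (a i) * l i else 0)" if "i < k" for i
    proof (cases "i \<in> S")
      case True
      have "coeff (U $$ (r, i) * c i) t = coeff (U $$ (r, i)) (t - (a j - a i)) * l i"
        using True \<open>t \<ge> a j\<close> by (simp add: c_def mult.commute[of _ "monom _ _"] coeff_monom_mult)
      moreover have "coeff (U $$ (r, i)) (t - (a j - a i)) = 0" if "t \<noteq> a j"
        using deg[OF \<open>r < n\<close> \<open>i < k\<close>] that \<open>t \<ge> a j\<close> j(2)[OF True] by (intro coeff_eq_0) linarith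
      ultimately show ?thesis using j(2)[OF True] by auto
    next
      case False
      thus ?thesis using \<open>i < k\<close> by (auto simp: c_def S_def)
    qed
    thus ?thesis using that rel[OF that(1)] by (cases "t = a j") (simp_all add: entry_j coeff_sum)
  qed
  \<comment> \<open>Otherwise the new column would vanish, and the frame would lose rank.\<close>
  have "a j \<noteq> 0"
  proof
    assume "a j = 0"
    hence zero: "(U * E) $$ (r, j) = 0" if "r < n" for r
      using coeff_j[OF that] by (intro poly_eqI) simp
    have "E' * Y * (U * E) = 1\<^sub>m k"
      by (rule left_inverse_mult[OF E(2) Y(1) U E(1) Y(2) E'E])
    hence "(\<Sum>r<n. (E' * Y) $$ (j, r) * (U * E) $$ (r, j)) = 1"
      using left_inverse_sum[of "E' * Y" "U * E" k n j j] E U Y jk by simp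
    thus False using zero by simp
  qed
  define a' where "a' = a(j := a j - 1)"
  have "degree ((U * E) $$ (r, i)) \<le> a' i" if "r < n" "i < k" for r i
  proof (cases "i = j")
    case True
    have "degree ((U * E) $$ (r, j)) \<le> a j - 1"
      using coeff_j[OF that(1)] by (intro degree_le) (auto simp: le_diff_conv)
    thus ?thesis by (simp add: True a'_def)
  next
    case False
    thus ?thesis using entry[OF that False] deg[OF that] by (simp add: a'_def)
  qed
  moreover have "(\<Sum>i<k. a' i) < (\<Sum>i<k. a i)"
  proof (rule sum_strict_mono_ex1)
    show "\<exists>i\<in>{..<k}. a' i < a i" using jk \<open>a j \<noteq> 0\<close> by (intro bexI[of _ j]) (auto simp: a'_def)
  qed (auto simp: a'_def)
  ultimately show ?thesis using that[OF E EE' E'E] by blast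
qed

text \<open>A frame whose column degrees have the least possible sum has independent leading coefficient
  vectors. So its reversed columns are independent at every point of the chart at infinity and
  form a frame there, and the transition matrix between the two frames is diagonal.\<close>

lemma birkhoff_grothendieck:
  fixes U U' :: "'a::alg_closed_field poly mat"
  assumes cp: "chart_pair n k U U' g"
  obtains \<alpha> where "length \<alpha> = k" "splits_as g (map uminus \<alpha>)"
proof -
  obtain Y Y' where U: "U \<in> carrier_mat n k" "U' \<in> carrier_mat n k" "g \<in> carrier_mat k k"
    and eq: "map_mat at_inverse_coord U' = map_mat to_fract U * g"
    and Y: "Y \<in> carrier_mat k n" "Y * U = 1\<^sub>m k" and Y': "Y' \<in> carrier_mat k n" "Y' * U' = 1\<^sub>m k"
    using cp unfolding chart_pair_def by blast
  define good where "good = (\<lambda>(P, P', a :: nat \<Rightarrow> nat). P \<in> carrier_mat k k \<and> P' \<in> carrier_mat k k \<and>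
    P * P' = 1\<^sub>m k \<and> P' * P = 1\<^sub>m k \<and> (\<forall>r<n. \<forall>i<k. degree ((U * P) $$ (r, i)) \<le> a i))"
  have "good (1\<^sub>m k, 1\<^sub>m k, \<lambda>i. \<Sum>r<n. degree (U $$ (r, i)))"
    using U by (auto simp: good_def intro!: member_le_sum[of _ "{..<n}"])
  then obtain x where x: "good x" "\<And>y. good y \<Longrightarrow> (\<Sum>i<k. snd (snd x) i) \<le> (\<Sum>i<k. snd (snd y) i)"
    using arg_min_nat_lemma[of good _ "\<lambda>x. \<Sum>i<k. snd (snd x) i"] by blast
  obtain P P' a where xx: "x = (P, P', a)" by (cases x)
  have P: "P \<in> carrier_mat k k" "P' \<in> carrier_mat k k" "P * P' = 1\<^sub>m k" "P' * P = 1\<^sub>m k"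
    and deg: "\<And>r i. r < n \<Longrightarrow> i < k \<Longrightarrow> degree ((U * P) $$ (r, i)) \<le> a i"
    using x(1) by (auto simp: good_def xx)
  define V where "V = U * P"
  define V' where "V' = mat n k (\<lambda>(r, i). reversal (a i) (V $$ (r, i)))"
  define Z where "Z = P' * Y"
  have V: "V \<in> carrier_mat n k" "V' \<in> carrier_mat n k" "Z \<in> carrier_mat k n"
    using U P Y by (auto simp: V_def V'_def Z_def)
  have ZV: "Z * V = 1\<^sub>m k"
    unfolding Z_def V_def by (rule left_inverse_mult[OF P(2) Y(1) U(1) P(1) Y(2) P(4)])
  note degV = deg[folded V_def]
  have inj: "\<forall>i<k. l i = 0"
    if "\<And>r. r < n \<Longrightarrow> (\<Sum>i<k. poly (V' $$ (r, i)) y * l i) = 0" for y :: 'a and l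
  proof (cases "y = 0")
    case True
    hence rel: "(\<Sum>i<k. coeff (V $$ (r, i)) (a i) * l i) = 0" if "r < n" for r
      using \<open>\<And>r. r < n \<Longrightarrow> (\<Sum>i<k. poly (V' $$ (r, i)) y * l i) = 0\<close>[OF that] that
      by (simp add: V'_def poly_reversal_0)
    show ?thesis
    proof (rule ccontr)
      assume "\<not> (\<forall>i<k. l i = 0)"
      then obtain i0 where i0: "i0 < k" "l i0 \<noteq> 0" by blast
      obtain E E' a' where E: "E \<in> carrier_mat k k" "E' \<in> carrier_mat k k" "E * E' = 1\<^sub>m k" "E' * E = 1\<^sub>m k"
        and E_deg: "\<And>r i. r < n \<Longrightarrow> i < k \<Longrightarrow> degree ((V * E) $$ (r, i)) \<le> a' i"
        and less: "(\<Sum>i<k. a' i) < (\<Sum>i<k. a i)"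
        using reduce_column_degree[OF V(1,3) ZV degV rel i0] by metis
      have VE: "V * E = U * (P * E)"
        unfolding V_def using U P E by (simp add: assoc_mult_mat[of _ n k _ k _ k])
      have "P * E * (E' * P') = 1\<^sub>m k" "E' * P' * (P * E) = 1\<^sub>m k"
        using left_inverse_mult[OF P(1) E(1,2) P(2) E(3) P(3)] left_inverse_mult[OF E(2) P(2,1) E(1) P(4) E(4)] .
      hence "good (P * E, E' * P', a')"
        using P E E_deg by (auto simp: good_def VE)
      from x(2)[OF this] less show False by (simp add: xx)
    qed
  next
    case False
    show ?thesis
    proof (intro allI impI)
      fix j assume j: "j < k"
      let ?ev = "\<lambda>p. poly p (inverse y)"
      have ZVe: "map_mat ?ev Z * map_mat ?ev V = 1\<^sub>m k"
        using ZV V by (simp flip: eval_mat_mult[of Z k n V k] add: eval_mat_one)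
      have "(\<Sum>i<k. map_mat ?ev V $$ (r, i) * (y ^ a i * l i)) = 0" if "r < n" for r
      proof -
        have "(\<Sum>i<k. map_mat ?ev V $$ (r, i) * (y ^ a i * l i)) = (\<Sum>i<k. poly (V' $$ (r, i)) y * l i)"
          using \<open>r < n\<close> V(1) False degV by (intro sum.cong) (auto simp: V'_def poly_reversal)
        thus ?thesis using \<open>\<And>r. r < n \<Longrightarrow> (\<Sum>i<k. poly (V' $$ (r, i)) y * l i) = 0\<close>[OF that] by simp
      qed
      hence "(\<Sum>r<n. map_mat ?ev Z $$ (j, r) * (\<Sum>i<k. map_mat ?ev V $$ (r, i) * (y ^ a i * l i))) = 0"
        by simp
      hence "y ^ a j * l j = 0"
        using left_inverse_sum_combination[OF ZVe _ _ j, of n] V by simp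
      thus "l j = 0" using False by simp
    qed
  qed
  let ?f = "map_mat (to_fract :: 'a poly \<Rightarrow> _)" and ?a = "map_mat (at_inverse_coord :: 'a poly \<Rightarrow> _)"
  define D where "D = mat_diag k (\<lambda>i. (coord :: 'a poly fract) powi (- int (a i)))"
  define Q where "Q = Y' * V'"
  have Q: "Q \<in> carrier_mat k k" using Y' V by (simp add: Q_def)
  have D: "D \<in> carrier_mat k k" by (simp add: D_def)
  have V'D: "?a V' = ?f V * D"
    unfolding D_def using V degV
    by (intro eq_matI) (auto simp: mat_diag_mult_right[of _ n k] V'_def at_inverse_coord_reversal)
  have c: "?a Y' \<in> carrier_mat k n" "?f U \<in> carrier_mat n k" "?f P \<in> carrier_mat k k" "?f P' \<in> carrier_mat k k"
    "?a Q \<in> carrier_mat k k"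
    using Y' U P Q by auto
  have left: "?a Y' * ?f U * g = 1\<^sub>m k"
    using hom_mult_eq_one(2)[OF Y'(2,1) U(2)] c U eq by (simp add: assoc_mult_mat[of _ k n _ k _ k])
  have right: "g * (?a Y' * ?f U) = 1\<^sub>m k"
    by (rule mat_mult_left_right_inverse[OF _ _ left]) (use c U in auto)
  have aQ: "?a Q = ?a Y' * ?f U * (?f P * D)"
    unfolding Q_def at_inverse_hom.mat_hom_mult[OF Y'(1) V(2)] V'D V_def frac_hom.mat_hom_mult[OF U(1) P(1)]
    using c D by (simp add: assoc_mult_mat[of _ k n _ k _ k] assoc_mult_mat[of _ n k _ k _ k] mult_carrier_mat[of _ k k _ k])
  have gQ: "g * ?a Q = ?f P * D"
  proof -
    have "g * ?a Q = (g * (?a Y' * ?f U)) * (?f P * D)"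
      unfolding aQ using c D U(3) by (simp add: assoc_mult_mat[of _ k k _ k _ k] mult_carrier_mat[of _ k n _ k] mult_carrier_mat[of _ k k _ k])
    thus ?thesis unfolding right using c D by simp
  qed
  have U'Q: "U' * Q = V'"
  proof (rule at_inverse_hom.mat_hom_inj)
    have "?a (U' * Q) = ?f U * g * ?a Q"
      by (simp add: at_inverse_hom.mat_hom_mult[OF U(2) Q] eq)
    also have "\<dots> = ?f U * (g * ?a Q)" using c U by (simp add: assoc_mult_mat[of _ n k _ k _ k])
    also have "\<dots> = ?a V'" unfolding gQ V'D V_def frac_hom.mat_hom_mult[OF U(1) P(1)]
      using c D by (simp add: assoc_mult_mat[of _ n k _ k _ k])
    finally show "?a (U' * Q) = ?a V'" .
  qed
  have "det (map_mat (\<lambda>p. poly p y) Q) \<noteq> 0" for y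
  proof
    let ?ev = "\<lambda>p. poly p y"
    assume "det (map_mat ?ev Q) = 0"
    then obtain v where v: "v \<in> carrier_vec k" "v \<noteq> 0\<^sub>v k" "map_mat ?ev Q *\<^sub>v v = 0\<^sub>v k"
      using det_0_iff_vec_prod_zero_field[of "map_mat ?ev Q" k] Q by auto
    have "map_mat ?ev V' *\<^sub>v v = map_mat ?ev U' *\<^sub>v (map_mat ?ev Q *\<^sub>v v)"
      unfolding U'Q[symmetric] eval_mat_mult[OF U(2) Q]
      using U Q v by (intro assoc_mult_mat_vec[of _ n k _ k]) auto
    also have "\<dots> = 0\<^sub>v n" unfolding v(3) using U by (intro eq_vecI) auto
    finally have *: "map_mat ?ev V' *\<^sub>v v = 0\<^sub>v n" .
    have "(\<Sum>i<k. poly (V' $$ (r, i)) y * v $ i) = 0" if "r < n" for r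
      using arg_cong[OF *, of "\<lambda>w. vec_index w r"] that V v(1) by (simp add: scalar_prod_def atLeast0LessThan)
    hence "\<forall>i<k. v $ i = 0" using inj by blast
    hence "v = 0\<^sub>v k" using v(1) by (intro eq_vecI) auto
    thus False using v(2) by simp
  qed
  then obtain Q' where Q': "Q' \<in> carrier_mat k k" "Q * Q' = 1\<^sub>m k" "Q' * Q = 1\<^sub>m k"
    using poly_mat_invertible[OF Q] by metis
  define \<alpha> where "\<alpha> = map (\<lambda>i. int (a i)) [0..<k]"
  have "?f P' * g * ?a Q = D"
  proof -
    have "?f P' * g * ?a Q = ?f P' * (?f P * D)"
      using c U(3) by (simp add: assoc_mult_mat[of _ k k _ k _ k] gQ)
    also have "\<dots> = D"
      using mult_mat_cancel_left[OF hom_mult_eq_one(1)[OF P(4,2,1)] c(4,3) D] .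
    finally show ?thesis .
  qed
  moreover have "D = power_diag (map uminus \<alpha>)"
    unfolding D_def \<alpha>_def by (intro eq_matI) (auto simp: mat_diag_def)
  ultimately have "?f P' * g * ?a Q = power_diag (map uminus \<alpha>)" by simp
  moreover have "length (map uminus \<alpha>) = k" by (simp add: \<alpha>_def)
  ultimately have "splits_as g (map uminus \<alpha>)"
    unfolding splits_as_def using U(3) P Q Q' by metis
  thus ?thesis using that[of \<alpha>] by (simp add: \<alpha>_def)
qed

section \<open>Sections of the pulled back universal bundles\<close>

lemma sum_lessThan_split:
  fixes f :: "nat \<Rightarrow> 'a::comm_monoid_add"
  assumes "r \<le> n"
  shows "(\<Sum>l<n. f l) = (\<Sum>l<r. f l) + (\<Sum>j<n - r. f (j + r))"
proof -
  have "(\<Sum>l<n. f l) = sum f {0..<r} + sum f {r..<n}"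
    using assms by (simp add: sum.atLeastLessThan_concat lessThan_atLeast0)
  also have "sum f {r..<n} = (\<Sum>j<n - r. f (j + r))"
    using sum.shift_bounds_nat_ivl[of f 0 r "n - r"] assms by (simp add: lessThan_atLeast0)
  finally show ?thesis by (simp add: lessThan_atLeast0)
qed

lemma mat_mult_entry:
  assumes "A * B = C" "A \<in> carrier_mat p q" "B \<in> carrier_mat q s" "i < p" "j < s"
  shows "(\<Sum>l<q. A $$ (i, l) * B $$ (l, j)) = C $$ (i, j)"
proof -
  have "(A * B) $$ (i, j) = (\<Sum>l<q. A $$ (i, l) * B $$ (l, j))"
    using assms(2-5) by (simp add: scalar_prod_def lessThan_atLeast0)
  thus ?thesis using assms(1) by simp
qed

lemma in_column_space_iff:
  fixes B :: "'a::field mat"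
  assumes B: "B \<in> carrier_mat n k"
  shows "v \<in> column_space B \<longleftrightarrow> v \<in> carrier_vec n \<and> (\<exists>c. \<forall>i<n. v $ i = (\<Sum>j<k. B $$ (i, j) * c j))"
proof -
  have eq: "column_space B = {y \<in> carrier_vec n. \<exists>x\<in>carrier_vec k. B *\<^sub>v x = y}"
    using vec_space.col_space_eq[of B n k] B by simp
  show ?thesis
  proof
    assume "v \<in> column_space B"
    then obtain x where x: "v \<in> carrier_vec n" "x \<in> carrier_vec k" "B *\<^sub>v x = v" using eq by auto
    have "\<forall>i<n. v $ i = (\<Sum>j<k. B $$ (i, j) * x $ j)"
      unfolding x(3)[symmetric] using x(2) B by (simp add: scalar_prod_def lessThan_atLeast0)
    thus "v \<in> carrier_vec n \<and> (\<exists>c. \<forall>i<n. v $ i = (\<Sum>j<k. B $$ (i, j) * c j))"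
      using x(1) by (auto intro!: exI[of _ "\<lambda>j. x $ j"])
  next
    assume "v \<in> carrier_vec n \<and> (\<exists>c. \<forall>i<n. v $ i = (\<Sum>j<k. B $$ (i, j) * c j))"
    then obtain c where c: "v \<in> carrier_vec n" "\<forall>i<n. v $ i = (\<Sum>j<k. B $$ (i, j) * c j)" by blast
    have "B *\<^sub>v vec k c = v"
      using c B by (intro eq_vecI) (auto simp: scalar_prod_def lessThan_atLeast0)
    thus "v \<in> column_space B" unfolding eq using c(1) by auto
  qed
qed

text \<open>The sections of the twists by \<open>m\<close> of the pulled back universal sub-bundle and of the dual of the pulled
  back universal quotient bundle. The latter is the bundle of linear forms that vanish on the
  sub-bundle. Both conditions are imposed on the first chart only: together with the bound on the
  degree they imply the corresponding condition at infinity.\<close>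

definition sub_sections :: "nat \<Rightarrow> ('a::field vec set \<Rightarrow> 'a vec set) \<Rightarrow> nat \<Rightarrow> (nat \<Rightarrow> 'a poly) set" where
  "sub_sections n \<phi> m = {v. (\<forall>i\<ge>n. v i = 0) \<and> (\<forall>i. degree (v i) \<le> m) \<and>
     (\<forall>x. vec n (\<lambda>i. poly (v i) x) \<in> \<phi> (proj_point 1 x))}"

definition conormal_sections :: "nat \<Rightarrow> ('a::field vec set \<Rightarrow> 'a vec set) \<Rightarrow> nat \<Rightarrow> (nat \<Rightarrow> 'a poly) set" where
  "conormal_sections n \<phi> m = {w. (\<forall>i\<ge>n. w i = 0) \<and> (\<forall>i. degree (w i) \<le> m) \<and>
     (\<forall>x. \<forall>u\<in>\<phi> (proj_point 1 x). (\<Sum>i<n. poly (w i) x * u $ i) = 0)}"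

definition first_columns :: "nat \<Rightarrow> 'a mat \<Rightarrow> 'a mat" where
  "first_columns r F = mat (dim_row F) r (\<lambda>(i, j). F $$ (i, j))"

definition last_rows_transposed :: "nat \<Rightarrow> 'a mat \<Rightarrow> 'a mat" where
  "last_rows_transposed r F = mat (dim_col F) (dim_row F - r) (\<lambda>(i, j). F $$ (j + r, i))"

lemma first_columns_as_cols:
  assumes "F \<in> carrier_mat n n" "r \<le> n"
  shows "mat_of_cols n (take r (cols F)) = first_columns r F"
  using assms by (intro eq_matI) (auto simp: first_columns_def mat_of_cols_def)

lemma adapted_frameD:
  fixes F :: "'a::alg_closed_field poly mat"
  assumes F: "adapted_frame r n \<phi> pt F" and r: "r \<le> n"
  obtains Fi where "F \<in> carrier_mat n n" "Fi \<in> carrier_mat n n" "F * Fi = 1\<^sub>m n" "Fi * F = 1\<^sub>m n"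
    "\<And>x. \<phi> (pt x) = column_space (map_mat (\<lambda>p. poly p x) (first_columns r F))"
proof -
  have Fc: "F \<in> carrier_mat n n" using F by (simp add: adapted_frame_def)
  have "det (map_mat (\<lambda>p. poly p x) F) \<noteq> 0" for x
  proof -
    obtain B where "B \<in> carrier_mat n n" "map_mat (\<lambda>p. poly p x) F * B = 1\<^sub>m n"
      using F Fc invertible_matE[of "map_mat (\<lambda>p. poly p x) F" n]
      unfolding adapted_frame_def by (metis map_carrier_mat)
    hence "det (map_mat (\<lambda>p. poly p x) F) * det B = 1"
      using Fc by (simp flip: det_mult[of _ n])
    thus ?thesis by auto
  qed
  then obtain Fi where Fi: "Fi \<in> carrier_mat n n" "F * Fi = 1\<^sub>m n" "Fi * F = 1\<^sub>m n"
    using poly_mat_invertible[OF Fc] by metis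
  have "\<phi> (pt x) = column_space (map_mat (\<lambda>p. poly p x) (first_columns r F))" for x
  proof -
    have eq: "mat_of_cols n (take r (cols (map_mat (\<lambda>p. poly p x) F))) = map_mat (\<lambda>p. poly p x) (first_columns r F)"
      using Fc r by (subst first_columns_as_cols) (auto simp: first_columns_def intro!: eq_matI)
    have "vec_space.col_space n (mat_of_cols n (take r (cols (map_mat (\<lambda>p. poly p x) F)))) = \<phi> (pt x)"
      using F by (simp add: adapted_frame_def)
    moreover have "dim_row (first_columns r F) = n" using Fc by (simp add: first_columns_def)
    ultimately show ?thesis unfolding eq by simp
  qed
  thus ?thesis using that Fc Fi by blast
qed

lemma poly_eq_0_of_all: "(\<And>x. poly p x = 0) \<Longrightarrow> p = (0 :: 'a::{field_char_0} poly)"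
  using poly_all_0_iff_0[of p] by blast

text \<open>In the coordinates given by the adapted frame, a vector lies in the sub-bundle at every point if and
  only if its last \<open>n - r\<close> coordinates, which are polynomials, vanish at every point.\<close>

lemma sub_sections_eq:
  fixes F :: "'a::{alg_closed_field, field_char_0} poly mat"
  assumes F: "F \<in> carrier_mat n n" "Fi \<in> carrier_mat n n" "F * Fi = 1\<^sub>m n" "Fi * F = 1\<^sub>m n"
    and r: "r \<le> n"
    and \<phi>: "\<And>x. \<phi> (proj_point 1 x) = column_space (map_mat (\<lambda>p. poly p x) (first_columns r F))"
  shows "sub_sections n \<phi> m = bounded_sections n m (first_columns r F)"
proof -
  define U where "U = first_columns r F"
  have U: "U \<in> carrier_mat n r" "\<And>i j. i < n \<Longrightarrow> j < r \<Longrightarrow> U $$ (i, j) = F $$ (i, j)"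
    using F by (auto simp: U_def first_columns_def)
  have mem: "vec n (\<lambda>i. poly (v i) x) \<in> \<phi> (proj_point 1 x) \<longleftrightarrow>
      (\<exists>c. \<forall>i<n. poly (v i) x = (\<Sum>j<r. poly (U $$ (i, j)) x * c j))" for v x
  proof -
    have Ux: "map_mat (\<lambda>p. poly p x) U \<in> carrier_mat n r" using U by simp
    have "(\<Sum>j<r. map_mat (\<lambda>p. poly p x) U $$ (i, j) * c j) = (\<Sum>j<r. poly (U $$ (i, j)) x * c j)"
      if "i < n" for i c using U(1) that by (intro sum.cong) auto
    thus ?thesis unfolding \<phi> U_def[symmetric] in_column_space_iff[OF Ux] by simp
  qed
  have "(\<forall>x. vec n (\<lambda>i. poly (v i) x) \<in> \<phi> (proj_point 1 x)) \<longleftrightarrow>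
      (\<exists>f. \<forall>i<n. v i = (\<Sum>j<r. U $$ (i, j) * f j))" for v
  proof
    assume "\<exists>f. \<forall>i<n. v i = (\<Sum>j<r. U $$ (i, j) * f j)"
    then obtain f where "\<forall>i<n. v i = (\<Sum>j<r. U $$ (i, j) * f j)" by blast
    thus "\<forall>x. vec n (\<lambda>i. poly (v i) x) \<in> \<phi> (proj_point 1 x)"
      unfolding mem by (intro allI) (rule_tac x = "\<lambda>j. poly (f j) x" in exI, simp add: poly_sum)
  next
    assume v: "\<forall>x. vec n (\<lambda>i. poly (v i) x) \<in> \<phi> (proj_point 1 x)"
    define f where "f l = (\<Sum>a<n. Fi $$ (l, a) * v a)" for l
    have zero: "f (j + r) = 0" if j: "j < n - r" for j
    proof (rule poly_eq_0_of_all)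
      fix x
      obtain c where c: "\<forall>i<n. poly (v i) x = (\<Sum>j<r. poly (U $$ (i, j)) x * c j)"
        using v mem by blast
      have "poly (f (j + r)) x = (\<Sum>a<n. \<Sum>l<r. poly (Fi $$ (j + r, a) * F $$ (a, l)) x * c l)"
        using U(2) c by (simp add: f_def poly_sum sum_distrib_left mult.assoc)
      also have "\<dots> = (\<Sum>l<r. poly (\<Sum>a<n. Fi $$ (j + r, a) * F $$ (a, l)) x * c l)"
        by (subst sum.swap) (simp add: poly_sum sum_distrib_right)
      also have "\<dots> = 0"
        using mat_mult_entry[OF F(4,2,1)] j r by (intro sum.neutral) auto
      finally show "poly (f (j + r)) x = 0" .
    qed
    have "v i = (\<Sum>j<r. U $$ (i, j) * f j)" if i: "i < n" for i
    proof -
      have "(\<Sum>l<n. F $$ (i, l) * f l) = (\<Sum>a<n. (\<Sum>l<n. F $$ (i, l) * Fi $$ (l, a)) * v a)"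
        unfolding f_def sum_distrib_left sum_distrib_right mult.assoc by (rule sum.swap)
      also have "\<dots> = (\<Sum>a<n. if a = i then v a else 0)"
        using mat_mult_entry[OF F(3,1,2)] i by (intro sum.cong) auto
      also have "\<dots> = v i" using i by simp
      finally have "v i = (\<Sum>l<n. F $$ (i, l) * f l)" ..
      thus ?thesis
        unfolding sum_lessThan_split[OF r] using zero U(2) i by simp
    qed
    thus "\<exists>f. \<forall>i<n. v i = (\<Sum>j<r. U $$ (i, j) * f j)" by blast
  qed
  thus ?thesis using U(1) by (simp add: sub_sections_def bounded_sections_def U_def[symmetric])
qed

text \<open>The coordinates of a linear form in the dual frame are its values on the columns of the adapted frame,
  and the first \<open>r\<close> of them vanish for the forms in question.\<close>

lemma conormal_sections_eq:
  fixes F :: "'a::{alg_closed_field, field_char_0} poly mat"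
  assumes F: "F \<in> carrier_mat n n" "Fi \<in> carrier_mat n n" "F * Fi = 1\<^sub>m n" "Fi * F = 1\<^sub>m n"
    and r: "r \<le> n"
    and \<phi>: "\<And>x. \<phi> (proj_point 1 x) = column_space (map_mat (\<lambda>p. poly p x) (first_columns r F))"
  shows "conormal_sections n \<phi> m = bounded_sections n m (last_rows_transposed r Fi)"
proof -
  define W where "W = last_rows_transposed r Fi"
  have W: "W \<in> carrier_mat n (n - r)" "\<And>i j. i < n \<Longrightarrow> j < n - r \<Longrightarrow> W $$ (i, j) = Fi $$ (j + r, i)"
    using F by (auto simp: W_def last_rows_transposed_def)
  define U where "U = first_columns r F"
  have U: "U \<in> carrier_mat n r" "\<And>i j. i < n \<Longrightarrow> j < r \<Longrightarrow> U $$ (i, j) = F $$ (i, j)"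
    using F by (auto simp: U_def first_columns_def)
  have mem: "(\<forall>u\<in>\<phi> (proj_point 1 x). (\<Sum>i<n. poly (w i) x * u $ i) = 0) \<longleftrightarrow>
      (\<forall>l<r. poly (\<Sum>i<n. w i * F $$ (i, l)) x = 0)" for w x
  proof -
    have Ux: "map_mat (\<lambda>p. poly p x) U \<in> carrier_mat n r" using U by simp
    have iff: "u \<in> \<phi> (proj_point 1 x) \<longleftrightarrow> u \<in> carrier_vec n \<and>
        (\<exists>c. \<forall>i<n. u $ i = (\<Sum>j<r. poly (F $$ (i, j)) x * c j))" for u
    proof -
      have "(\<Sum>j<r. map_mat (\<lambda>p. poly p x) U $$ (i, j) * c j) = (\<Sum>j<r. poly (F $$ (i, j)) x * c j)"
        if "i < n" for i c using U that by (intro sum.cong) auto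
      thus ?thesis unfolding \<phi> U_def[symmetric] in_column_space_iff[OF Ux] by simp
    qed
    show ?thesis
    proof (intro iffI allI impI ballI)
      fix l assume *: "\<forall>u\<in>\<phi> (proj_point 1 x). (\<Sum>i<n. poly (w i) x * u $ i) = 0" and l: "l < r"
      have "vec n (\<lambda>i. poly (F $$ (i, l)) x) \<in> \<phi> (proj_point 1 x)"
        unfolding iff using l by (auto intro!: exI[of _ "\<lambda>j. if j = l then 1 else 0"] simp: if_distrib cong: if_cong)
      with * have "(\<Sum>i<n. poly (w i) x * vec n (\<lambda>i. poly (F $$ (i, l)) x) $ i) = 0" by blast
      thus "poly (\<Sum>i<n. w i * F $$ (i, l)) x = 0" by (simp add: poly_sum)
    next
      fix u assume *: "\<forall>l<r. poly (\<Sum>i<n. w i * F $$ (i, l)) x = 0" and "u \<in> \<phi> (proj_point 1 x)"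
      then obtain c where "\<forall>i<n. u $ i = (\<Sum>j<r. poly (F $$ (i, j)) x * c j)" using iff by blast
      hence "(\<Sum>i<n. poly (w i) x * u $ i) = (\<Sum>i<n. \<Sum>j<r. poly (w i * F $$ (i, j)) x * c j)"
        by (simp add: sum_distrib_left mult.assoc)
      also have "\<dots> = (\<Sum>j<r. poly (\<Sum>i<n. w i * F $$ (i, j)) x * c j)"
        by (subst sum.swap) (simp add: poly_sum sum_distrib_right)
      finally show "(\<Sum>i<n. poly (w i) x * u $ i) = 0" using * by simp
    qed
  qed
  have "(\<forall>x. \<forall>u\<in>\<phi> (proj_point 1 x). (\<Sum>i<n. poly (w i) x * u $ i) = 0) \<longleftrightarrow>
      (\<exists>f. \<forall>i<n. w i = (\<Sum>j<n - r. W $$ (i, j) * f j))" for w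
  proof
    assume "\<exists>f. \<forall>i<n. w i = (\<Sum>j<n - r. W $$ (i, j) * f j)"
    then obtain f where f: "\<forall>i<n. w i = (\<Sum>j<n - r. W $$ (i, j) * f j)" by blast
    have "(\<Sum>i<n. w i * F $$ (i, l)) = 0" if "l < r" for l
    proof -
      have "(\<Sum>i<n. w i * F $$ (i, l)) = (\<Sum>i<n. \<Sum>j<n - r. Fi $$ (j + r, i) * F $$ (i, l) * f j)"
        using f W(2) by (simp add: sum_distrib_left sum_distrib_right mult_ac)
      also have "\<dots> = (\<Sum>j<n - r. (\<Sum>i<n. Fi $$ (j + r, i) * F $$ (i, l)) * f j)"
        by (subst sum.swap) (simp add: sum_distrib_right)
      also have "\<dots> = 0" using mat_mult_entry[OF F(4,2,1)] that r by (intro sum.neutral) auto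
      finally show ?thesis .
    qed
    thus "\<forall>x. \<forall>u\<in>\<phi> (proj_point 1 x). (\<Sum>i<n. poly (w i) x * u $ i) = 0"
      unfolding mem by simp
  next
    assume w: "\<forall>x. \<forall>u\<in>\<phi> (proj_point 1 x). (\<Sum>i<n. poly (w i) x * u $ i) = 0"
    define f where "f l = (\<Sum>a<n. w a * F $$ (a, l))" for l
    have zero: "f l = 0" if "l < r" for l
      using w that unfolding mem f_def by (intro poly_eq_0_of_all) auto
    have "w i = (\<Sum>j<n - r. W $$ (i, j) * f (j + r))" if i: "i < n" for i
    proof -
      have "(\<Sum>l<n. f l * Fi $$ (l, i)) = (\<Sum>a<n. w a * (\<Sum>l<n. F $$ (a, l) * Fi $$ (l, i)))"
        unfolding f_def sum_distrib_left sum_distrib_right mult.assoc by (rule sum.swap)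
      also have "\<dots> = (\<Sum>a<n. if a = i then w a else 0)"
        using mat_mult_entry[OF F(3,1,2)] i by (intro sum.cong) auto
      also have "\<dots> = w i" using i by simp
      finally have "w i = (\<Sum>l<n. f l * Fi $$ (l, i))" ..
      thus ?thesis
        unfolding sum_lessThan_split[OF r] using zero W(2) i by (simp add: mult.commute)
    qed
    thus "\<exists>f. \<forall>i<n. w i = (\<Sum>j<n - r. W $$ (i, j) * f j)"
      by (intro exI[of _ "\<lambda>j. f (j + r)"]) simp
  qed
  thus ?thesis using W(1) by (simp add: conormal_sections_def bounded_sections_def W_def[symmetric])
qed

section \<open>Splitting types of the universal bundles\<close>

text \<open>A transition function of a line bundle of degree \<open>j\<close>: up to units of the coordinate rings of the two
  charts it is \<open>z ^ j\<close>. Applied to determinants, this compares the degrees of the universal bundles.\<close>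

definition monomial_unit :: "'a::field poly fract \<Rightarrow> int \<Rightarrow> bool" where
  "monomial_unit x j \<longleftrightarrow> (\<exists>p p' q q'. p * p' = 1 \<and> q * q' = 1 \<and>
     to_fract p * x * at_inverse_coord q = coord powi j)"

lemma monomial_unit_mult:
  assumes "monomial_unit x i" "monomial_unit y j"
  shows "monomial_unit (x * y) (i + j)"
proof -
  obtain p p' q q' where x: "p * p' = 1" "q * q' = 1" "to_fract p * x * at_inverse_coord q = coord powi i"
    using assms(1) unfolding monomial_unit_def by blast
  obtain s s' t t' where y: "s * s' = 1" "t * t' = 1" "to_fract s * y * at_inverse_coord t = coord powi j"
    using assms(2) unfolding monomial_unit_def by blast
  have "p * s * (p' * s') = 1" "q * t * (q' * t') = 1"
    using x(1,2) y(1,2) by (metis mult.assoc mult.left_commute mult.right_neutral)+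
  moreover have "to_fract (p * s) * (x * y) * at_inverse_coord (q * t) = coord powi (i + j)"
    by (simp add: power_int_add at_inverse_hom.hom_mult mult_ac flip: x(3) y(3))
  ultimately show ?thesis unfolding monomial_unit_def by blast
qed

text \<open>Dividing the two presentations, \<open>z ^ i\<close> is a product of a polynomial in \<open>z\<close> and a polynomial in \<open>1/z\<close>
  that are units, which bounds the degree of the former by \<open>i\<close>.\<close>

lemma monomial_unit_exponent_nonneg:
  assumes "monomial_unit x i" "monomial_unit x 0"
  shows "0 \<le> i"
proof -
  obtain p p' q q' where x: "p * p' = 1" "q * q' = 1" "to_fract p * x * at_inverse_coord q = coord powi i"
    using assms(1) unfolding monomial_unit_def by blast
  obtain s s' t t' where y: "s * s' = 1" "t * t' = 1" "to_fract s * x * at_inverse_coord t = 1"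
    using assms(2) unfolding monomial_unit_def by auto
  have unit: "to_fract a * to_fract b = 1" "at_inverse_coord a * at_inverse_coord b = 1"
    if "a * b = 1" for a b :: "'a poly"
    using that by (simp_all flip: to_fract_mult at_inverse_hom.hom_mult add: at_inverse_hom.hom_one)
  have "to_fract (p * s') * coord powi (- i) = at_inverse_coord (q' * t)"
  proof -
    have "x = to_fract s' * at_inverse_coord t'"
      using unit(1)[OF y(1)] unit(2)[OF y(2)] y(3)
      by (metis (no_types, lifting) mult.assoc mult.commute mult.right_neutral)
    hence "coord powi i = to_fract (p * s') * at_inverse_coord (t' * q)"
      using x(3) by (simp add: at_inverse_hom.hom_mult mult_ac)
    moreover have "at_inverse_coord (t' * q) * at_inverse_coord (q' * t) = 1"
      using x(2) y(2) by (intro unit(2)) (metis mult.assoc mult.commute mult.right_neutral)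
    ultimately have "coord powi i * at_inverse_coord (q' * t) = to_fract (p * s')"
      by (simp add: mult.assoc)
    thus ?thesis by (simp add: power_int_minus field_simps)
  qed
  moreover have "p * s' \<noteq> 0" using x(1) y(1) by auto
  ultimately show ?thesis using degree_le_of_at_inverse_coord by fastforce
qed

lemma monomial_unit_inverse:
  assumes "monomial_unit x i" "x * y = 1"
  shows "monomial_unit y (- i)"
proof -
  obtain p p' q q' where x: "p * p' = 1" "q * q' = 1" "to_fract p * x * at_inverse_coord q = coord powi i"
    using assms(1) unfolding monomial_unit_def by blast
  have "to_fract p * to_fract p' = 1" "at_inverse_coord q * at_inverse_coord q' = 1"
    using x by (simp_all flip: to_fract_mult at_inverse_hom.hom_mult add: at_inverse_hom.hom_one)
  hence "coord powi i * (to_fract p' * y * at_inverse_coord q') = 1"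
    using assms(2) unfolding x(3)[symmetric]
    by (metis (no_types, lifting) mult.assoc mult.commute mult.right_neutral)
  hence "to_fract p' * y * at_inverse_coord q' = coord powi (- i)"
    by (simp add: power_int_minus field_simps)
  thus ?thesis unfolding monomial_unit_def using x by (metis mult.commute)
qed

lemma monomial_unit_unique:
  assumes "monomial_unit x i" "monomial_unit x 0"
  shows "i = 0"
proof -
  obtain p p' q q' where x: "p * p' = 1" "q * q' = 1" "to_fract p * x * at_inverse_coord q = coord powi i"
    using assms(1) unfolding monomial_unit_def by blast
  have "x \<noteq> 0" using x(3) by auto
  hence "x * inverse x = 1" by simp
  hence "0 \<le> - i" using monomial_unit_exponent_nonneg monomial_unit_inverse assms by (metis minus_zero)
  moreover have "0 \<le> i" using monomial_unit_exponent_nonneg assms by blast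
  ultimately show ?thesis by simp
qed

lemma det_mat_diag: "det (mat_diag m f) = (\<Prod>i<m. f i)"
proof -
  have "det (mat_diag m f) = prod_list (diag_mat (mat_diag m f))"
    by (rule det_upper_triangular[of _ m]) (auto simp: upper_triangular_def mat_diag_def)
  also have "\<dots> = (\<Prod>i<m. f i)"
    by (simp add: prod_list_diag_prod mat_diag_def lessThan_atLeast0)
  finally show ?thesis .
qed

lemma splits_as_det:
  assumes "splits_as g \<alpha>"
  shows "monomial_unit (det g) (sum_list \<alpha>)"
proof -
  define m where "m = length \<alpha>"
  obtain P P' Q Q' where car: "g \<in> carrier_mat m m" "P \<in> carrier_mat m m" "P' \<in> carrier_mat m m"
      "Q \<in> carrier_mat m m" "Q' \<in> carrier_mat m m"
    and PP: "P * P' = 1\<^sub>m m" and QQ: "Q * Q' = 1\<^sub>m m"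
    and eq: "map_mat to_fract P * g * map_mat at_inverse_coord Q = power_diag \<alpha>"
    using assms unfolding splits_as_def m_def by blast
  have "det P * det P' = 1" "det Q * det Q' = 1"
    using PP QQ car by (simp_all flip: det_mult[of _ m])
  moreover have "det (map_mat to_fract P * g * map_mat at_inverse_coord Q) =
      to_fract (det P) * det g * at_inverse_coord (det Q)"
    using car by (simp add: det_mult[of _ m] mult_carrier_mat[of _ m m _ m] frac_hom.hom_det at_inverse_hom.hom_det)
  moreover have "det (power_diag \<alpha>) = (coord :: 'a poly fract) powi (sum_list \<alpha>)"
  proof -
    have "(\<Prod>i<k. (coord :: 'a poly fract) powi (\<alpha> ! i)) = coord powi (\<Sum>i<k. \<alpha> ! i)" for k
      by (induction k) (simp_all add: power_int_add)
    thus ?thesis by (simp add: det_mat_diag sum_list_sum_nth lessThan_atLeast0)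
  qed
  ultimately show ?thesis unfolding eq monomial_unit_def by metis
qed

lemma dual_transition_sym: 
  assumes "dual_transition g g'"
  shows "dual_transition g' g"
proof -
  have 1: "g * transpose_mat g' = 1\<^sub>m (dim_row g)" and 2: "transpose_mat g' * g = 1\<^sub>m (dim_col g')"
    using assms by (auto simp: dual_transition_def inverts_mat_def)
  have d: "dim_row g' = dim_row g" "dim_col g = dim_col g'"
    using arg_cong[OF 1, of dim_col] arg_cong[OF 2, of dim_col] by simp_all
  have "transpose_mat (g * transpose_mat g') = g' * transpose_mat g"
    by (subst transpose_mult[of _ "dim_row g" "dim_col g" _ "dim_row g"]) (auto simp: d)
  moreover have "transpose_mat (transpose_mat g' * g) = transpose_mat g * g'"
    by (subst transpose_mult[of _ "dim_col g'" "dim_row g" _ "dim_col g"]) (auto simp: d)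
  ultimately show ?thesis
    unfolding dual_transition_def inverts_mat_def using 1 2 d by simp
qed

text \<open>The dual of the quotient bundle is the sub-bundle of the dual trivial bundle whose frames are the
  last rows of the inverses of adapted frames.\<close>

lemma universal_chart_pairs:
  fixes \<phi> :: "'a::{alg_closed_field, field_char_0} vec set \<Rightarrow> 'a vec set"
  assumes ut: "universal_transitions r n \<phi> g h" and r: "r \<le> n"
  obtains U U' W W' h' where "chart_pair n r U U' g" "chart_pair n (n - r) W W' h'"
    "dual_transition h h'"
    "\<And>m. sub_sections n \<phi> m = bounded_sections n m U"
    "\<And>m. conormal_sections n \<phi> m = bounded_sections n m W"
    "monomial_unit (det g * det h) 0"
    "\<And>x. \<phi> (proj_point 1 x) = column_space (map_mat (\<lambda>p. poly p x) U)"
proof -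
  obtain F F' k where gh: "g \<in> carrier_mat r r" "h \<in> carrier_mat (n - r) (n - r)" "k \<in> carrier_mat r (n - r)"
    and AF: "adapted_frame r n \<phi> (\<lambda>x. proj_point 1 x) F" and AF': "adapted_frame r n \<phi> (\<lambda>x. proj_point x 1) F'"
    and eq: "map_mat at_inverse_coord F' = map_mat to_fract F * four_block_mat g k (0\<^sub>m (n - r) r) h"
    using ut unfolding universal_transitions_def by blast
  obtain Fi where F: "F \<in> carrier_mat n n" "Fi \<in> carrier_mat n n" "F * Fi = 1\<^sub>m n" "Fi * F = 1\<^sub>m n"
    and \<phi>: "\<And>x. \<phi> (proj_point 1 x) = column_space (map_mat (\<lambda>p. poly p x) (first_columns r F))"
    using adapted_frameD[OF AF r] by metis
  obtain Fi' where F': "F' \<in> carrier_mat n n" "Fi' \<in> carrier_mat n n" "F' * Fi' = 1\<^sub>m n" "Fi' * F' = 1\<^sub>m n"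
    using adapted_frameD[OF AF' r] by metis
  let ?f = "map_mat (to_fract :: 'a poly \<Rightarrow> _)" and ?a = "map_mat (at_inverse_coord :: 'a poly \<Rightarrow> _)"
  define G where "G = four_block_mat g k (0\<^sub>m (n - r) r) h"
  have Gc: "G \<in> carrier_mat n n" using four_block_carrier_mat[OF gh(1,2)] r by (simp add: G_def)
  note eq = eq[folded G_def]
  have Gentry: "G $$ (i, j) = (if i < r then if j < r then g $$ (i, j) else k $$ (i, j - r)
      else if j < r then 0 else h $$ (i - r, j - r))" if "i < n" "j < n" for i j
    unfolding G_def using that gh r by (subst index_mat_four_block) auto
  have c: "?f F \<in> carrier_mat n n" "?f Fi \<in> carrier_mat n n" "?a F' \<in> carrier_mat n n" "?a Fi' \<in> carrier_mat n n"
    using F F' by auto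
  have FFi: "?f Fi * ?f F = 1\<^sub>m n" "?f F * ?f Fi = 1\<^sub>m n"
    using hom_mult_eq_one(1) F by blast+
  have FFi': "?a Fi' * ?a F' = 1\<^sub>m n" "?a F' * ?a Fi' = 1\<^sub>m n"
    using hom_mult_eq_one(2) F' by blast+
  have G: "G = ?f Fi * ?a F'"
    unfolding eq using mult_mat_cancel_left[OF FFi(1) c(2,1) Gc] by simp
  define Gi where "Gi = ?a Fi' * ?f F"
  have Gic: "Gi \<in> carrier_mat n n" using c by (simp add: Gi_def)
  have GGi: "G * Gi = 1\<^sub>m n"
    unfolding G Gi_def using c FFi mult_mat_cancel_left[OF FFi'(2) c(3,4), of "?f F" n]
    by (simp add: assoc_mult_mat[of _ n n _ n _ n] mult_carrier_mat[of _ n n _ n])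
  have GFi': "?f Fi = G * ?a Fi'"
    unfolding G using c FFi' by (simp add: assoc_mult_mat[of _ n n _ n _ n])
  define U where "U = first_columns r F"
  define U' where "U' = first_columns r F'"
  define W where "W = last_rows_transposed r Fi"
  define W' where "W' = last_rows_transposed r Fi'"
  have U: "U \<in> carrier_mat n r" "\<And>i j. i < n \<Longrightarrow> j < r \<Longrightarrow> U $$ (i, j) = F $$ (i, j)"
    using F by (auto simp: U_def first_columns_def)
  have U': "U' \<in> carrier_mat n r" "\<And>i j. i < n \<Longrightarrow> j < r \<Longrightarrow> U' $$ (i, j) = F' $$ (i, j)"
    using F' by (auto simp: U'_def first_columns_def)
  have W: "W \<in> carrier_mat n (n - r)" "\<And>i j. i < n \<Longrightarrow> j < n - r \<Longrightarrow> W $$ (i, j) = Fi $$ (j + r, i)"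
    using F by (auto simp: W_def last_rows_transposed_def)
  have W': "W' \<in> carrier_mat n (n - r)" "\<And>i j. i < n \<Longrightarrow> j < n - r \<Longrightarrow> W' $$ (i, j) = Fi' $$ (j + r, i)"
    using F' by (auto simp: W'_def last_rows_transposed_def)
  have linv_U: "\<exists>Y\<in>carrier_mat r n. Y * first_columns r A = 1\<^sub>m r"
    if A: "A \<in> carrier_mat n n" "B \<in> carrier_mat n n" "B * A = 1\<^sub>m n" for A B :: "'a poly mat"
  proof (rule bexI[of _ "mat r n (\<lambda>(i, j). B $$ (i, j))"])
    show "mat r n (\<lambda>(i, j). B $$ (i, j)) * first_columns r A = 1\<^sub>m r"
    proof (rule eq_matI)
      fix i j assume "i < dim_row (1\<^sub>m r :: 'a poly mat)" "j < dim_col (1\<^sub>m r :: 'a poly mat)"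
      thus "(mat r n (\<lambda>(i, j). B $$ (i, j)) * first_columns r A) $$ (i, j) = 1\<^sub>m r $$ (i, j)"
        using mat_mult_entry[OF A(3,2,1), of i j] A r
        by (simp add: first_columns_def scalar_prod_def lessThan_atLeast0)
    qed (use A in \<open>auto simp: first_columns_def\<close>)
  qed simp
  have linv_W: "\<exists>Y\<in>carrier_mat (n - r) n. Y * last_rows_transposed r B = 1\<^sub>m (n - r)"
    if A: "A \<in> carrier_mat n n" "B \<in> carrier_mat n n" "B * A = 1\<^sub>m n" for A B :: "'a poly mat"
  proof (rule bexI[of _ "mat (n - r) n (\<lambda>(i, j). A $$ (j, i + r))"])
    show "mat (n - r) n (\<lambda>(i, j). A $$ (j, i + r)) * last_rows_transposed r B = 1\<^sub>m (n - r)"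
    proof (rule eq_matI)
      fix i j assume "i < dim_row (1\<^sub>m (n - r) :: 'a poly mat)" "j < dim_col (1\<^sub>m (n - r) :: 'a poly mat)"
      thus "(mat (n - r) n (\<lambda>(i, j). A $$ (j, i + r)) * last_rows_transposed r B) $$ (i, j) = 1\<^sub>m (n - r) $$ (i, j)"
        using mat_mult_entry[OF A(3,2,1), of "j + r" "i + r"] A r
        by (auto simp: last_rows_transposed_def scalar_prod_def lessThan_atLeast0 mult.commute)
    qed (use A in \<open>auto simp: last_rows_transposed_def\<close>)
  qed simp
  have "chart_pair n r U U' g"
  proof -
    have "?a U' = ?f U * g"
    proof (rule eq_matI)
      fix i j assume "i < dim_row (?f U * g)" "j < dim_col (?f U * g)"
      hence ij: "i < n" "j < r" using U gh by auto
      have "at_inverse_coord (F' $$ (i, j)) = (\<Sum>l<n. ?f F $$ (i, l) * G $$ (l, j))"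
        using mat_mult_entry[OF eq[symmetric] c(1) Gc, of i j] ij r F' by simp
      also have "\<dots> = (\<Sum>l<r. to_fract (U $$ (i, l)) * g $$ (l, j))"
        unfolding sum_lessThan_split[OF r] using ij r F U by (simp add: Gentry)
      finally show "?a U' $$ (i, j) = (?f U * g) $$ (i, j)"
        using ij U U' gh by (simp add: scalar_prod_def lessThan_atLeast0)
    qed (use U U' gh in auto)
    thus ?thesis unfolding chart_pair_def using U U' gh linv_U[OF F(1,2,4)] linv_U[OF F'(1,2,4)]
      by (simp add: U_def U'_def)
  qed
  moreover define hi where "hi = mat (n - r) (n - r) (\<lambda>(i, j). Gi $$ (i + r, j + r))"
  have hic: "hi \<in> carrier_mat (n - r) (n - r)" by (simp add: hi_def)
  have hhi: "h * hi = 1\<^sub>m (n - r)"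
  proof (rule eq_matI)
    fix i j assume "i < dim_row (1\<^sub>m (n - r) :: 'a poly fract mat)" "j < dim_col (1\<^sub>m (n - r) :: 'a poly fract mat)"
    hence ij: "i < n - r" "j < n - r" by auto
    have "(\<Sum>l<n. G $$ (i + r, l) * Gi $$ (l, j + r)) = (1\<^sub>m n) $$ (i + r, j + r)"
      using mat_mult_entry[OF GGi Gc Gic, of "i + r" "j + r"] ij by simp
    hence "(\<Sum>l<n - r. h $$ (i, l) * Gi $$ (l + r, j + r)) = (if i = j then 1 else 0)"
      unfolding sum_lessThan_split[OF r] using ij by (simp add: Gentry)
    thus "(h * hi) $$ (i, j) = 1\<^sub>m (n - r) $$ (i, j)"
      using ij gh by (simp add: hi_def scalar_prod_def lessThan_atLeast0)
  qed (use gh hic in auto)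
  have hih: "hi * h = 1\<^sub>m (n - r)" by (rule mat_mult_left_right_inverse[OF gh(2) hic hhi])
  define h' where "h' = transpose_mat hi"
  have h'c: "h' \<in> carrier_mat (n - r) (n - r)" using hic by (simp add: h'_def)
  have "dual_transition h h'"
    unfolding dual_transition_def inverts_mat_def h'_def using hhi hih gh hic by auto
  moreover have "chart_pair n (n - r) W W' h'"
  proof -
    have fW: "?f W = ?a W' * transpose_mat h"
    proof (rule eq_matI)
      fix i j assume "i < dim_row (?a W' * transpose_mat h)" "j < dim_col (?a W' * transpose_mat h)"
      hence ij: "i < n" "j < n - r" using W' gh by auto
      have "to_fract (Fi $$ (j + r, i)) = (\<Sum>l<n. G $$ (j + r, l) * ?a Fi' $$ (l, i))"
        using mat_mult_entry[OF GFi'[symmetric] Gc c(4), of "j + r" i] ij F by simp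
      also have "\<dots> = (\<Sum>l<n - r. h $$ (j, l) * at_inverse_coord (W' $$ (i, l)))"
        unfolding sum_lessThan_split[OF r] using ij r F' W' by (simp add: Gentry)
      finally show "?f W $$ (i, j) = (?a W' * transpose_mat h) $$ (i, j)"
        using ij W W' gh by (simp add: scalar_prod_def lessThan_atLeast0 mult.commute)
    qed (use W W' gh in auto)
    have "transpose_mat h * h' = 1\<^sub>m (n - r)"
      unfolding h'_def using transpose_mult_eq_one[OF hih hic gh(2)] .
    hence "?f W * h' = ?a W'"
      unfolding fW using W' gh h'c by (simp add: assoc_mult_mat[of _ n "n - r" _ "n - r" _ "n - r"])
    thus ?thesis unfolding chart_pair_def using W W' h'c linv_W[OF F(1,2,4)] linv_W[OF F'(1,2,4)]
      by (simp add: W_def W'_def)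
  qed
  moreover have "monomial_unit (det g * det h) 0"
  proof -
    have "det G = det g * det h"
      unfolding G_def by (rule det_four_block_mat_lower_left_zero) (use gh in auto)
    moreover have "det G = to_fract (det Fi) * at_inverse_coord (det F')"
      unfolding G using c by (simp add: det_mult[of _ n] frac_hom.hom_det at_inverse_hom.hom_det)
    moreover have u: "det F * det Fi = 1" "det Fi' * det F' = 1"
      using F F' by (simp_all flip: det_mult[of _ n])
    have "to_fract (det F) * to_fract (det Fi) = 1" "at_inverse_coord (det F') * at_inverse_coord (det Fi') = 1"
      using u by (simp_all flip: to_fract_mult at_inverse_hom.hom_mult add: at_inverse_hom.hom_one mult.commute)
    ultimately have "to_fract (det F) * (det g * det h) * at_inverse_coord (det Fi') = coord powi 0"
      by (metis (no_types, lifting) mult.assoc mult.right_neutral power_int_0_right)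
    thus ?thesis unfolding monomial_unit_def using u by metis
  qed
  ultimately show ?thesis
    using that[of U U' W W' h'] sub_sections_eq[OF F r \<phi>] conormal_sections_eq[OF F r \<phi>] \<phi>
    by (simp add: U_def W_def)
qed

text \<open>The two universal bundles have opposite degrees because the determinant of the trivial bundle has
  degree \<open>0\<close>.\<close>

lemma universal_sections:
  fixes \<phi> :: "'a::{alg_closed_field, field_char_0} vec set \<Rightarrow> 'a vec set"
  assumes ut: "universal_transitions r n \<phi> g h" and r: "r \<le> n"
    and g: "splits_as g (map uminus \<alpha>)" and h: "splits_as h \<beta>"
  shows "\<forall>x\<in>set \<alpha>. 0 \<le> x" "\<forall>x\<in>set \<beta>. 0 \<le> x" "sum_list \<alpha> = sum_list \<beta>"
    "pv.dim (sub_sections n \<phi> m) = (\<Sum>x\<leftarrow>\<alpha>. nat (int m + 1 - x))"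
    "pv.dim (conormal_sections n \<phi> m) = (\<Sum>x\<leftarrow>\<beta>. nat (int m + 1 - x))"
proof -
  obtain U U' W W' h' where cp: "chart_pair n r U U' g" "chart_pair n (n - r) W W' h'"
    and dual: "dual_transition h h'"
    and sec: "\<And>m. sub_sections n \<phi> m = bounded_sections n m U"
      "\<And>m. conormal_sections n \<phi> m = bounded_sections n m W"
    and det: "monomial_unit (det g * det h) 0"
    using universal_chart_pairs[OF ut r] by metis
  show "\<forall>x\<in>set \<alpha>. 0 \<le> x" "pv.dim (sub_sections n \<phi> m) = (\<Sum>x\<leftarrow>\<alpha>. nat (int m + 1 - x))"
    using dim_bounded_sections[OF cp(1) g] sec by simp_all
  show "\<forall>x\<in>set \<beta>. 0 \<le> x" "pv.dim (conormal_sections n \<phi> m) = (\<Sum>x\<leftarrow>\<beta>. nat (int m + 1 - x))"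
    using dim_bounded_sections[OF cp(2) splits_as_dual[OF h dual]] sec by simp_all
  have "monomial_unit (det g * det h) (sum_list (map uminus \<alpha>) + sum_list \<beta>)"
    by (intro monomial_unit_mult splits_as_det g h)
  hence "sum_list (map uminus \<alpha>) + sum_list \<beta> = 0" using det monomial_unit_unique by blast
  moreover have "sum_list (map uminus \<alpha>) = - sum_list \<alpha>" by (induction \<alpha>) simp_all
  ultimately show "sum_list \<alpha> = sum_list \<beta>" by simp
qed

text \<open>Both universal bundles split, so the tangent bundle splits with the sums of their exponents, and the
  splitting type is unique.\<close>

lemma tangent_splitting_typeE:
  fixes \<phi> :: "'a::{alg_closed_field, field_char_0} vec set \<Rightarrow> 'a vec set"
  assumes "tangent_splitting_type r n \<phi> M" and r: "r \<le> n"
  obtains \<alpha> \<beta> where "length \<alpha> = r" "length \<beta> = n - r" "M = mset (tensor_exponents \<alpha> \<beta>)"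
    "\<forall>x\<in>set \<alpha>. 0 \<le> x" "\<forall>x\<in>set \<beta>. 0 \<le> x" "sum_list \<alpha> = sum_list \<beta>"
    "\<And>m. pv.dim (sub_sections n \<phi> m) = (\<Sum>x\<leftarrow>\<alpha>. nat (int m + 1 - x))"
    "\<And>m. pv.dim (conormal_sections n \<phi> m) = (\<Sum>x\<leftarrow>\<beta>. nat (int m + 1 - x))"
proof -
  obtain g g' h where ut: "universal_transitions r n \<phi> g h" and gg': "dual_transition g g'"
    and M: "has_splitting_type (tensor_mat g' h) M"
    using assms(1) unfolding tangent_splitting_type_def by blast
  obtain U U' W W' h' where cp: "chart_pair n r U U' g" "chart_pair n (n - r) W W' h'"
    and dual: "dual_transition h h'"
    using universal_chart_pairs[OF ut r] by metis
  obtain \<alpha> where \<alpha>: "length \<alpha> = r" "splits_as g (map uminus \<alpha>)"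
    using birkhoff_grothendieck[OF cp(1)] by metis
  obtain \<beta> where \<beta>: "length \<beta> = n - r" "splits_as h' (map uminus \<beta>)"
    using birkhoff_grothendieck[OF cp(2)] by metis
  have h: "splits_as h \<beta>"
    using splits_as_dual[OF \<beta>(2) dual_transition_sym[OF dual]] by (simp add: o_def)
  have g': "splits_as g' \<alpha>"
    using splits_as_dual[OF \<alpha>(2) gg'] by (simp add: o_def)
  have "has_splitting_type (tensor_mat g' h) (mset (tensor_exponents \<alpha> \<beta>))"
    using splits_as_tensor[OF g' h] has_splitting_type_iff by blast
  hence "M = mset (tensor_exponents \<alpha> \<beta>)" using M splitting_type_unique by blast
  thus ?thesis using that[of \<alpha> \<beta>] \<alpha>(1) \<beta>(1) universal_sections[OF ut r \<alpha>(2) h] by blast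
qed

lemma tangent_splitting_typeI:
  assumes "universal_transitions r n \<phi> g h" "splits_as g (map uminus \<alpha>)" "splits_as h \<beta>"
  shows "tangent_splitting_type r n \<phi> (mset (tensor_exponents \<alpha> \<beta>))"
proof -
  obtain gi where gi: "gi \<in> carrier_mat (length \<alpha>) (length \<alpha>)" "g * gi = 1\<^sub>m (length \<alpha>)" "gi * g = 1\<^sub>m (length \<alpha>)"
    using splits_as_invertible[OF assms(2)] by auto
  have "g \<in> carrier_mat (length \<alpha>) (length \<alpha>)" using assms(2) by (auto simp: splits_as_def)
  hence dual: "dual_transition g (transpose_mat gi)"
    unfolding dual_transition_def inverts_mat_def using gi by auto
  have "splits_as (transpose_mat gi) \<alpha>"
    using splits_as_dual[OF assms(2) dual] by (simp add: o_def)
  from splits_as_tensor[OF this assms(3)]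
  show ?thesis unfolding tangent_splitting_type_def has_splitting_type_iff using assms(1) dual by blast
qed

section \<open>Homogeneous polynomial functions\<close>

definition monomial_degree :: "('v \<Rightarrow>\<^sub>0 nat) \<Rightarrow> nat" where
  "monomial_degree m = (\<Sum>v\<in>Poly_Mapping.keys m. Poly_Mapping.lookup m v)"

definition monomial_eval :: "('v \<Rightarrow> 'a::comm_ring_1) \<Rightarrow> ('v \<Rightarrow>\<^sub>0 nat) \<Rightarrow> 'a" where
  "monomial_eval x m = (\<Prod>v\<in>Poly_Mapping.keys m. x v ^ Poly_Mapping.lookup m v)"

text \<open>Functions that are given by a homogeneous polynomial of degree \<open>d\<close>. Minors of matrices of linear forms
  are easier to handle as functions than as polynomials.\<close>

definition is_form :: "nat \<Rightarrow> (('v \<Rightarrow> 'a::comm_ring_1) \<Rightarrow> 'a) \<Rightarrow> bool" where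
  "is_form d f \<longleftrightarrow> (\<exists>F. (\<forall>m\<in>Poly_Mapping.keys F. monomial_degree m = d) \<and> (\<forall>x. mpoly_eval x F = f x))"

lemma mpoly_eval_alt: "mpoly_eval x F = (\<Sum>m\<in>Poly_Mapping.keys F. Poly_Mapping.lookup F m * monomial_eval x m)"
  by (simp add: mpoly_eval_def monomial_eval_def)

lemma monomial_degree_superset:
  "finite S \<Longrightarrow> Poly_Mapping.keys m \<subseteq> S \<Longrightarrow> monomial_degree m = (\<Sum>v\<in>S. Poly_Mapping.lookup m v)"
  unfolding monomial_degree_def by (rule sum.mono_neutral_left) (auto simp: in_keys_iff)

lemma monomial_eval_superset:
  "finite S \<Longrightarrow> Poly_Mapping.keys m \<subseteq> S \<Longrightarrow> monomial_eval x m = (\<Prod>v\<in>S. x v ^ Poly_Mapping.lookup m v)"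
  unfolding monomial_eval_def by (rule prod.mono_neutral_left) (auto simp: in_keys_iff)

lemma mpoly_eval_superset:
  "finite S \<Longrightarrow> Poly_Mapping.keys F \<subseteq> S \<Longrightarrow>
    mpoly_eval x F = (\<Sum>m\<in>S. Poly_Mapping.lookup F m * monomial_eval x m)"
  unfolding mpoly_eval_alt by (rule sum.mono_neutral_left) (auto simp: in_keys_iff)

lemma monomial_degree_add: "monomial_degree (m + m') = monomial_degree m + monomial_degree m'"
proof -
  let ?S = "Poly_Mapping.keys m \<union> Poly_Mapping.keys m'"
  have "Poly_Mapping.keys (m + m') \<subseteq> ?S" by (rule Poly_Mapping.keys_add)
  thus ?thesis by (simp add: monomial_degree_superset[of ?S] lookup_add sum.distrib)
qed

lemma monomial_eval_add: "monomial_eval x (m + m') = monomial_eval x m * monomial_eval x m'"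
proof -
  let ?S = "Poly_Mapping.keys m \<union> Poly_Mapping.keys m'"
  have "Poly_Mapping.keys (m + m') \<subseteq> ?S" by (rule Poly_Mapping.keys_add)
  thus ?thesis by (simp add: monomial_eval_superset[of ?S] lookup_add power_add prod.distrib)
qed

lemma mpoly_eval_add: "mpoly_eval x (F + G) = mpoly_eval x F + mpoly_eval x G"
proof -
  let ?S = "Poly_Mapping.keys F \<union> Poly_Mapping.keys G"
  have "Poly_Mapping.keys (F + G) \<subseteq> ?S" by (rule Poly_Mapping.keys_add)
  thus ?thesis by (simp add: mpoly_eval_superset[of ?S] lookup_add distrib_right sum.distrib)
qed

lemma mpoly_eval_sum: "mpoly_eval x (sum F A) = (\<Sum>a\<in>A. mpoly_eval x (F a))"
  by (induction A rule: infinite_finite_induct) (simp_all add: mpoly_eval_add, simp_all add: mpoly_eval_def)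

lemma mpoly_eval_single: "mpoly_eval x (Poly_Mapping.single m a) = a * monomial_eval x m"
  by (cases "a = 0") (simp_all add: mpoly_eval_alt)

lemma poly_mapping_sum_single:
  "F = (\<Sum>m\<in>Poly_Mapping.keys F. Poly_Mapping.single m (Poly_Mapping.lookup F m))"
  by (rule poly_mapping_eqI) (auto simp: lookup_sum lookup_single when_def in_keys_iff sum.delta)

lemma mpoly_eval_mult: "mpoly_eval x (F * G) = mpoly_eval x F * mpoly_eval x G"
proof -
  have "F * G = (\<Sum>m\<in>Poly_Mapping.keys F. \<Sum>m'\<in>Poly_Mapping.keys G.
      Poly_Mapping.single (m + m') (Poly_Mapping.lookup F m * Poly_Mapping.lookup G m'))"
    by (simp flip: mult_single sum_product poly_mapping_sum_single)
  hence "mpoly_eval x (F * G) = (\<Sum>m\<in>Poly_Mapping.keys F. \<Sum>m'\<in>Poly_Mapping.keys G.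
      (Poly_Mapping.lookup F m * monomial_eval x m) * (Poly_Mapping.lookup G m' * monomial_eval x m'))"
    by (simp add: mpoly_eval_sum mpoly_eval_single monomial_eval_add mult_ac)
  thus ?thesis by (simp add: mpoly_eval_alt sum_product)
qed

lemma is_form_zero: "is_form d (\<lambda>x. 0)"
  unfolding is_form_def by (intro exI[of _ 0]) (simp add: mpoly_eval_def)

lemma is_form_const: "is_form 0 (\<lambda>x. a)"
  unfolding is_form_def
  by (intro exI[of _ "Poly_Mapping.single 0 a"])
    (auto simp: mpoly_eval_single monomial_eval_def monomial_degree_def split: if_splits)

lemma is_form_var: "is_form 1 (\<lambda>x. x v)"
  unfolding is_form_def
  by (intro exI[of _ "Poly_Mapping.single (Poly_Mapping.single v 1) 1"])
    (auto simp: mpoly_eval_single monomial_eval_def monomial_degree_def split: if_splits)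

lemma is_form_add:
  assumes "is_form d f" "is_form d g"
  shows "is_form d (\<lambda>x. f x + g x)"
proof -
  obtain F G where "\<forall>m\<in>Poly_Mapping.keys F. monomial_degree m = d" "\<forall>x. mpoly_eval x F = f x"
    "\<forall>m\<in>Poly_Mapping.keys G. monomial_degree m = d" "\<forall>x. mpoly_eval x G = g x"
    using assms unfolding is_form_def by blast
  thus ?thesis unfolding is_form_def
    using Poly_Mapping.keys_add[of F G] by (intro exI[of _ "F + G"]) (auto simp: mpoly_eval_add)
qed

lemma is_form_mult:
  assumes "is_form d f" "is_form d' g"
  shows "is_form (d + d') (\<lambda>x. f x * g x)"
proof -
  obtain F G where "\<forall>m\<in>Poly_Mapping.keys F. monomial_degree m = d" "\<forall>x. mpoly_eval x F = f x"
    "\<forall>m\<in>Poly_Mapping.keys G. monomial_degree m = d'" "\<forall>x. mpoly_eval x G = g x"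
    using assms unfolding is_form_def by blast
  thus ?thesis unfolding is_form_def
    using keys_mult[of F G] by (intro exI[of _ "F * G"]) (auto simp: mpoly_eval_mult monomial_degree_add)
qed

lemma is_form_cmult: "is_form d f \<Longrightarrow> is_form d (\<lambda>x. a * f x)"
  using is_form_mult[OF is_form_const] by simp

lemma is_form_sum: "(\<And>i. i \<in> A \<Longrightarrow> is_form d (f i)) \<Longrightarrow> is_form d (\<lambda>x. \<Sum>i\<in>A. f i x)"
  by (induction A rule: infinite_finite_induct) (simp_all add: is_form_zero is_form_add)

lemma is_form_prod: "finite A \<Longrightarrow> (\<And>i. i \<in> A \<Longrightarrow> is_form 1 (f i)) \<Longrightarrow> is_form (card A) (\<lambda>x. \<Prod>i\<in>A. f i x)"
proof (induction A rule: finite_induct)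
  case empty
  thus ?case using is_form_const[of 1] by simp
next
  case (insert a A)
  thus ?case using is_form_mult[of 1 "f a" "card A"] by simp
qed

lemma permutes_less: "p permutes {0..<k::nat} \<Longrightarrow> i < k \<Longrightarrow> p i < k"
  using permutes_in_image[of p "{0..<k}" i] by simp

lemma is_form_det:
  assumes "\<And>i j. i < k \<Longrightarrow> j < k \<Longrightarrow> is_form 1 (A i j)"
  shows "is_form k (\<lambda>x. det (mat k k (\<lambda>(i, j). A i j x)))"
proof -
  have "det (mat k k (\<lambda>(i, j). A i j x)) =
      (\<Sum>p | p permutes {0..<k}. signof p * (\<Prod>i = 0..<k. A i (p i) x))" for x
    by (subst det_def'[of _ k]) (auto intro!: sum.cong prod.cong simp: permutes_less)
  moreover have "is_form k (\<lambda>x. \<Sum>p | p permutes {0..<k}. signof p * (\<Prod>i = 0..<k. A i (p i) x))"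
  proof (intro is_form_sum is_form_cmult)
    fix p assume "p \<in> {p. p permutes {0..<k}}"
    thus "is_form k (\<lambda>x. \<Prod>i = 0..<k. A i (p i) x)"
      using is_form_prod[of "{0..<k}" "\<lambda>i. A i (p i)"] assms by (auto simp: permutes_less)
  qed
  ultimately show ?thesis by simp
qed

lemma is_form_homogeneous:
  assumes "is_form d f"
  shows "\<exists>F. homogeneous F \<and> (\<forall>x. mpoly_eval x F = f x)"
  using assms unfolding is_form_def homogeneous_def monomial_degree_def by metis

section \<open>Semicontinuity of the dimension of a solution space\<close>

lemma det_nonzero_imp_zero:
  fixes f :: "nat \<Rightarrow> nat \<Rightarrow> 'a::field"
  assumes det: "det (mat k k (\<lambda>(i, q). f q i)) \<noteq> 0" and rel: "\<And>i. i < k \<Longrightarrow> (\<Sum>q<k. c q * f q i) = 0"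
    and q: "q < k"
  shows "c q = 0"
proof (rule ccontr)
  assume "c q \<noteq> 0"
  hence "vec k c \<noteq> 0\<^sub>v k" using q by (metis index_vec index_zero_vec(1))
  moreover have "mat k k (\<lambda>(i, q). f q i) *\<^sub>v vec k c = 0\<^sub>v k"
    using rel by (intro eq_vecI) (auto simp: scalar_prod_def lessThan_atLeast0 mult.commute)
  moreover have "mat k k (\<lambda>(i, q). f q i) \<in> carrier_mat k k" by simp
  ultimately show False
    using det det_0_iff_vec_prod_zero_field[of "mat k k (\<lambda>(i, q). f q i)" k] vec_carrier by blast
qed

text \<open>By induction on the number of functions: expanding the determinant along the row of the last point
  gives a combination of the functions with a nonzero coefficient, so it does not vanish for every
  choice of that point.\<close>

lemma independent_functions_nonzero_det:
  fixes f :: "nat \<Rightarrow> 'j \<Rightarrow> 'a::field"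
  assumes "\<And>c q. \<forall>j\<in>J. (\<Sum>q<k. c q * f q j) = 0 \<Longrightarrow> q < k \<Longrightarrow> c q = 0"
  shows "\<exists>p. (\<forall>i<k. p i \<in> J) \<and> det (mat k k (\<lambda>(i, q). f q (p i))) \<noteq> 0"
  using assms
proof (induction k)
  case 0
  show ?case by simp
next
  case (Suc k)
  have "\<exists>p. (\<forall>i<k. p i \<in> J) \<and> det (mat k k (\<lambda>(i, q). f q (p i))) \<noteq> 0"
  proof (rule Suc.IH)
    fix c q assume c: "\<forall>j\<in>J. (\<Sum>q<k. c q * f q j) = 0" and q: "q < k"
    have "(c(k := 0)) q = 0"
    proof (rule Suc.prems)
      have "(\<Sum>q<Suc k. (c(k := 0)) q * f q j) = (\<Sum>q<k. c q * f q j)" for j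
        by simp
      thus "\<forall>j\<in>J. (\<Sum>q<Suc k. (c(k := 0)) q * f q j) = 0" using c by simp
    qed (use q in simp)
    thus "c q = 0" using q by simp
  qed
  then obtain p where p: "\<forall>i<k. p i \<in> J" "det (mat k k (\<lambda>(i, q). f q (p i))) \<noteq> 0" by blast
  define M where "M j = mat (Suc k) (Suc k) (\<lambda>(i, q). f q ((p(k := j)) i))" for j
  define c where "c q = cofactor (M undefined) k q" for q
  \<comment> \<open>The cofactors along the last row do not depend on the point chosen for that row.\<close>
  have det: "det (M j) = (\<Sum>q<Suc k. c q * f q j)" for j
  proof -
    have "mat_delete (M j) k q = mat_delete (M undefined) k q" for q
      by (rule eq_matI) (auto simp: mat_delete_def M_def)
    hence "cofactor (M j) k q = c q" for q by (simp add: cofactor_def c_def)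
    thus ?thesis
      using laplace_expansion_row[of "M j" "Suc k" k] by (simp add: M_def mult.commute)
  qed
  have "mat_delete (M undefined) k k = mat k k (\<lambda>(i, q). f q (p i))"
    by (rule eq_matI) (auto simp: mat_delete_def M_def)
  hence "c k \<noteq> 0" using p(2) by (simp add: c_def cofactor_def)
  then obtain j where j: "j \<in> J" "det (M j) \<noteq> 0"
    using Suc.prems[of c k] det by auto
  show ?case
    using p(1) j by (intro exI[of _ "p(k := j)"]) (auto simp: M_def less_Suc_eq)
qed

text \<open>Vectors \<open>z q\<close> that extend a basis of the solution space of a linear system \<open>L0\<close> to a basis of \<open>E\<close>
  stay independent modulo the solutions of every system \<open>L\<close> at which a certain minor does not
  vanish; so the dimension cannot jump up there.\<close>

lemma solution_space_dim_le:
  fixes L0 :: "'j \<Rightarrow> (nat \<Rightarrow> 'a::field poly) \<Rightarrow> 'a"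
  assumes E: "pv.subspace E" "E \<subseteq> pv.span S" "finite S"
    and L0: "\<And>j v w. L0 j (v + w) = L0 j v + L0 j w" "\<And>j a v. L0 j (pscale a v) = a * L0 j v"
  obtains k z p where "\<And>i. i < k \<Longrightarrow> p i \<in> J" "det (mat k k (\<lambda>(i, q). L0 (p i) (z q))) \<noteq> 0"
    "\<And>L. (\<And>j v w. L j (v + w) = L j v + L j w) \<Longrightarrow> (\<And>j a v. L j (pscale a v) = a * L j v) \<Longrightarrow>
      det (mat k k (\<lambda>(i, q). L (p i) (z q))) \<noteq> 0 \<Longrightarrow>
      pv.dim {v\<in>E. \<forall>j\<in>J. L j v = 0} \<le> pv.dim {v\<in>E. \<forall>j\<in>J. L0 j v = 0}"
proof -
  have sums: "L j (\<Sum>x\<in>A. pscale (u x) (y x)) = (\<Sum>x\<in>A. u x * L j (y x))"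
    if "\<And>j v w. L j (v + w) = L j v + L j w" "\<And>j a v. L j (pscale a v) = a * L j v"
    for L :: "'j \<Rightarrow> (nat \<Rightarrow> 'a poly) \<Rightarrow> 'a" and j u y and A :: "'b set"
  proof -
    have "L j 0 = 0" using that(2)[of j 0 0] by simp
    thus ?thesis by (induction A rule: infinite_finite_induct) (simp_all add: that)
  qed
  have fin: "finite X \<and> card X \<le> card S" if "pv.independent X" "X \<subseteq> E" for X
    using pv.independent_span_bound[OF E(3) that(1)] that(2) E(2) by blast
  define K0 where "K0 = {v\<in>E. \<forall>j\<in>J. L0 j v = 0}"
  obtain B where B: "B \<subseteq> K0" "pv.independent B" "K0 \<subseteq> pv.span B" "card B = pv.dim K0"
    using pv.basis_exists[of K0] by metis
  have BE: "B \<subseteq> E" using B(1) by (auto simp: K0_def)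
  obtain B' where B': "B \<subseteq> B'" "B' \<subseteq> E" "pv.independent B'" "E \<subseteq> pv.span B'"
    using pv.maximal_independent_subset_extend[OF BE B(2)] by metis
  have finB': "finite B'" using fin B' by blast
  have finB: "finite B" using finB' B'(1) finite_subset by blast
  define Z where "Z = B' - B"
  define k where "k = card Z"
  have finZ: "finite Z" using finB' by (simp add: Z_def)
  obtain z where z: "bij_betw z {..<k} Z"
    using ex_bij_betw_nat_finite[OF finZ] by (auto simp: k_def lessThan_atLeast0)
  have zE: "z q \<in> E" if "q < k" for q
    using that z B'(2) by (auto simp: bij_betw_def Z_def)
  have reindex: "(\<Sum>x\<in>Z. g x) = (\<Sum>q<k. g (z q))" for g :: "(nat \<Rightarrow> 'a poly) \<Rightarrow> 'b::comm_monoid_add"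
    using sum.reindex_bij_betw[OF z, of g] by simp
  have indep: "c q = 0" if c: "\<forall>j\<in>J. (\<Sum>q<k. c q * L0 j (z q)) = 0" and q: "q < k" for c q
  proof -
    define w where "w = (\<Sum>q<k. pscale (c q) (z q))"
    have "w \<in> E"
      unfolding w_def using zE by (intro pv.subspace_sum[OF E(1)] pv.subspace_scale[OF E(1)]) auto
    moreover have "\<forall>j\<in>J. L0 j w = 0" using c by (simp add: w_def sums[of L0, OF L0])
    ultimately have "w \<in> K0" by (simp add: K0_def)
    hence "w \<in> pv.span B" using B(3) by blast
    then obtain u where u: "w = (\<Sum>x\<in>B. pscale (u x) x)"
      unfolding pv.span_finite[OF finB] by blast
    define d where "d = inv_into {..<k} z"
    have d: "d (z q) = q" if "q < k" for q
      unfolding d_def by (rule bij_betw_inv_into_left[OF z]) (use that in simp)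
    define g where "g x = (if x \<in> Z then c (d x) else - u x)" for x
    have "(\<Sum>x\<in>B'. pscale (g x) x) = (\<Sum>x\<in>Z. pscale (g x) x) + (\<Sum>x\<in>B. pscale (g x) x)"
      using B'(1) finB' sum.subset_diff[of B B' "\<lambda>x. pscale (g x) x"] by (simp add: Z_def)
    also have "(\<Sum>x\<in>Z. pscale (g x) x) = w"
      unfolding reindex w_def using z by (intro sum.cong) (auto simp: g_def d bij_betw_def)
    also have "(\<Sum>x\<in>B. pscale (g x) x) = - w"
      unfolding u by (simp add: g_def Z_def pv.scale_minus_left sum_negf)
    finally have "(\<Sum>x\<in>B'. pscale (g x) x) = 0" by (simp only: add.right_inverse)
    hence "g (z q) = 0"
      using pv.independentD[OF B'(3) finB' subset_refl] q z by (auto simp: bij_betw_def Z_def)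
    thus ?thesis using q z d by (auto simp: g_def bij_betw_def)
  qed
  obtain p where p: "\<forall>i<k. p i \<in> J" "det (mat k k (\<lambda>(i, q). L0 (p i) (z q))) \<noteq> 0"
    using independent_functions_nonzero_det[where J = J and k = k and f = "\<lambda>q j. L0 j (z q)"] indep
    by blast
  have "pv.dim {v\<in>E. \<forall>j\<in>J. L j v = 0} \<le> pv.dim K0"
    if L: "\<And>j v w. L j (v + w) = L j v + L j w" "\<And>j a v. L j (pscale a v) = a * L j v"
      and det: "det (mat k k (\<lambda>(i, q). L (p i) (z q))) \<noteq> 0" for L
  proof -
    define K where "K = {v\<in>E. \<forall>j\<in>J. L j v = 0}"
    obtain C where C: "C \<subseteq> K" "pv.independent C" "card C = pv.dim K"
      using pv.basis_exists[of K] by metis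
    have CE: "C \<subseteq> E" using C(1) by (auto simp: K_def)
    have finC: "finite C" using fin[OF C(2) CE] by simp
    have zero: "c q = 0" if "(\<Sum>q<k. pscale (c q) (z q)) \<in> K" "q < k" for c q
    proof (rule det_nonzero_imp_zero[OF det])
      fix i assume "i < k"
      thus "(\<Sum>q<k. c q * L (p i) (z q)) = 0"
        using that(1) p(1) by (simp add: K_def sums[of L, OF L])
    qed (use that in simp)
    have disj: "C \<inter> Z = {}"
    proof (rule ccontr)
      assume "C \<inter> Z \<noteq> {}"
      then obtain q where q: "q < k" "z q \<in> C" using z by (auto simp: bij_betw_def)
      have "(\<Sum>i<k. pscale (if i = q then 1 else 0) (z i)) = (\<Sum>i<k. if i = q then z i else 0)"
        by (intro sum.cong) auto
      also have "\<dots> = z q" using q by simp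
      finally have "(\<Sum>i<k. pscale (if i = q then 1 else 0) (z i)) \<in> K" using q C(1) by auto
      from zero[OF this q(1)] show False by simp
    qed
    have "pv.independent (C \<union> Z)"
    proof (rule pv.independent_if_scalars_zero)
      fix g x assume g: "(\<Sum>x\<in>C \<union> Z. pscale (g x) x) = 0" and x: "x \<in> C \<union> Z"
      have split: "(\<Sum>x\<in>C. pscale (g x) x) + (\<Sum>q<k. pscale (g (z q)) (z q)) = 0"
        using g by (simp add: sum.union_disjoint[OF finC finZ disj] reindex)
      have "(\<Sum>q<k. pscale (g (z q)) (z q)) = (\<Sum>x\<in>C. pscale (- g x) x)"
        using split by (simp add: pv.scale_minus_left sum_negf add_eq_0_iff2)
      moreover have "(\<Sum>x\<in>C. pscale (- g x) x) \<in> E"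
        using CE by (intro pv.subspace_sum[OF E(1)] pv.subspace_scale[OF E(1)]) auto
      moreover have "L j (\<Sum>x\<in>C. pscale (- g x) x) = 0" if "j \<in> J" for j
        unfolding sums[of L, OF L] using C(1) that by (intro sum.neutral) (auto simp: K_def)
      ultimately have "(\<Sum>q<k. pscale (g (z q)) (z q)) \<in> K" by (simp add: K_def)
      note z0 = zero[OF this]
      have "(\<Sum>x\<in>C. pscale (g x) x) = 0" using split z0 by simp
      hence "\<forall>x\<in>C. g x = 0" using pv.independentD[OF C(2) finC subset_refl] by blast
      thus "g x = 0" using x z0 z by (auto simp: bij_betw_def)
    qed (use finC finZ in simp)
    moreover have "C \<union> Z \<subseteq> pv.span B'"
      using CE B'(2,4) pv.span_superset[of B'] by (auto simp: Z_def)
    ultimately have "card (C \<union> Z) \<le> card B'"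
      using pv.independent_span_bound[OF finB'] by blast
    moreover have "card (C \<union> Z) = card C + card Z" by (rule card_Un_disjoint[OF finC finZ disj])
    moreover have "card B' = card B + card Z"
      using B'(1) finB' card_Diff_subset[OF finB B'(1)] card_mono[OF finB' B'(1)] by (simp add: Z_def)
    ultimately show ?thesis using C(3) B(4) by (simp add: K_def)
  qed
  thus ?thesis using that[of k p z] p by (simp add: K0_def)
qed

lemma bounded_vectors_subspace:
  "pv.subspace {v. (\<forall>i\<ge>n. v i = 0) \<and> (\<forall>i. degree (v i) \<le> m)}"
  by (rule pv.subspaceI) (auto simp: pscale_def degree_add_le intro: order_trans[OF degree_smult_le])

lemma bounded_vectors_finite_span:
  obtains S :: "(nat \<Rightarrow> 'a::field poly) set" where "finite S"
    "{v. (\<forall>i\<ge>n. v i = 0) \<and> (\<forall>i. degree (v i) \<le> m)} \<subseteq> pv.span S"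
proof
  define e :: "nat \<times> nat \<Rightarrow> nat \<Rightarrow> 'a poly" where "e = (\<lambda>(i, t) r. if r = i then monom 1 t else 0)"
  show "finite (e ` ({..<n} \<times> {..m}))" by simp
  show "{v. (\<forall>i\<ge>n. v i = 0) \<and> (\<forall>i. degree (v i) \<le> m)} \<subseteq> pv.span (e ` ({..<n} \<times> {..m}))"
  proof
    fix v :: "nat \<Rightarrow> 'a poly"
    assume "v \<in> {v. (\<forall>i\<ge>n. v i = 0) \<and> (\<forall>i. degree (v i) \<le> m)}"
    hence v: "\<And>i. i \<ge> n \<Longrightarrow> v i = 0" "\<And>i. degree (v i) \<le> m" by auto
    have "v = (\<Sum>i<n. \<Sum>t\<le>m. pscale (coeff (v i) t) (e (i, t)))"
    proof
      fix r
      have "(\<Sum>i<n. \<Sum>t\<le>m. pscale (coeff (v i) t) (e (i, t))) r =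
          (\<Sum>i<n. if i = r then (\<Sum>t\<le>m. monom (coeff (v i) t) t) else 0)"
        unfolding sum_fun_apply by (intro sum.cong) (auto simp: pscale_def e_def smult_monom)
      also have "\<dots> = (if r < n then v r else 0)"
        using poly_as_monom_sum[OF v(2)[of r]] by simp
      finally show "v r = (\<Sum>i<n. \<Sum>t\<le>m. pscale (coeff (v i) t) (e (i, t))) r"
        using v(1)[of r] by simp
    qed
    also have "\<dots> \<in> pv.span (e ` ({..<n} \<times> {..m}))"
      by (intro pv.span_sum pv.span_scale pv.span_base) auto
    finally show "v \<in> pv.span (e ` ({..<n} \<times> {..m}))" .
  qed
qed

section \<open>Pluecker coordinates and incidence\<close>

text \<open>The rows are listed by a function, in any order and possibly with repetitions, so that an expansion
  along a column or a row requires no sorting.\<close>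

definition row_minor :: "nat \<Rightarrow> 'a::comm_ring_1 mat \<Rightarrow> (nat \<Rightarrow> nat) \<Rightarrow> 'a" where
  "row_minor r B L = det (mat r r (\<lambda>(p, q). B $$ (L p, q)))"

text \<open>Sorting the rows only changes the sign, and a minor with a repeated row is zero; in that case the
  index set is an arbitrary one.\<close>

lemma row_minor_plucker:
  assumes r: "r \<le> n" and L: "\<And>p. p < r \<Longrightarrow> L p < n"
  shows "\<exists>\<epsilon> I. I \<subseteq> {..<n} \<and> card I = r \<and>
    (\<forall>B\<in>carrier_mat n r. row_minor r B L = \<epsilon> * plucker (B :: 'a::field mat) I)"
proof (cases "inj_on L {..<r}")
  case False
  then obtain p q where pq: "p < r" "q < r" "p \<noteq> q" "L p = L q" by (auto simp: inj_on_def)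
  have "row_minor r B L = 0" for B :: "'a mat"
    unfolding row_minor_def
    by (rule det_identical_rows[of _ r p q]) (use pq in \<open>auto intro!: eq_vecI\<close>)
  thus ?thesis using r by (intro exI[of _ 0] exI[of _ "{..<r}"]) auto
next
  case True
  define I where "I = L ` {..<r}"
  have I: "finite I" "I \<subseteq> {..<n}" "card I = r"
    using L True by (auto simp: I_def card_image)
  define \<pi> where "\<pi> p = (if p < r then card {a\<in>I. a < L p} else p)" for p
  have pick: "pick I (\<pi> p) = L p" if "p < r" for p
    using that by (simp add: \<pi>_def I_def pick_card_in_set)
  have \<pi>_lt: "\<pi> p < r" if "p < r" for p
  proof -
    have "{a\<in>I. a < L p} \<subset> I" using that by (auto simp: I_def)
    hence "card {a\<in>I. a < L p} < card I" by (rule psubset_card_mono[OF I(1)])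
    thus ?thesis using that I by (simp add: \<pi>_def)
  qed
  have "inj_on \<pi> {0..<r}"
    using pick True by (intro inj_onI) (metis atLeastLessThan_iff inj_onD lessThan_iff)
  moreover have "\<pi> ` {0..<r} \<subseteq> {0..<r}" using \<pi>_lt by auto
  ultimately have "bij_betw \<pi> {0..<r} {0..<r}"
    by (simp add: bij_betw_def endo_inj_surj)
  hence perm: "\<pi> permutes {0..<r}" by (rule bij_imp_permutes) (auto simp: \<pi>_def)
  have "row_minor r B L = signof \<pi> * plucker B I" if B: "B \<in> carrier_mat n r" for B :: "'a mat"
  proof -
    have "{i. i < n \<and> i \<in> I} = I" using I by auto
    hence sub: "submatrix B I UNIV = mat r r (\<lambda>(p, q). B $$ (pick I p, q))"
      using B I by (simp add: submatrix_def pick_UNIV)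
    have "mat r r (\<lambda>(p, q). B $$ (L p, q)) = mat r r (\<lambda>(p, q). submatrix B I UNIV $$ (\<pi> p, q))"
      using pick \<pi>_lt by (intro eq_matI) (auto simp: sub)
    thus ?thesis
      using det_permute_rows[of "submatrix B I UNIV" r \<pi>] perm
      by (simp add: row_minor_def plucker_def sub)
  qed
  thus ?thesis using I by blast
qed

text \<open>Independent columns are independent functions of the row index.\<close>

lemma independent_columns_minor:
  fixes B :: "'a::field mat"
  assumes B: "B \<in> carrier_mat n r" and Y: "Y \<in> carrier_mat r n" "Y * B = 1\<^sub>m r"
  obtains L where "\<And>p. p < r \<Longrightarrow> L p < n" "row_minor r B L \<noteq> 0"
proof -
  have "c q = 0" if "\<forall>j\<in>{..<n}. (\<Sum>q<r. c q * B $$ (j, q)) = 0" "q < r" for c q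
  proof -
    have "(\<Sum>j<n. Y $$ (q, j) * (\<Sum>i<r. B $$ (j, i) * c i)) = c q"
      by (rule left_inverse_sum_combination[OF Y(2,1) B that(2)])
    thus ?thesis using that(1) by (simp add: mult.commute)
  qed
  hence "\<exists>p. (\<forall>i<r. p i \<in> {..<n}) \<and> det (mat r r (\<lambda>(i, q). B $$ (p i, q))) \<noteq> 0"
    by (intro independent_functions_nonzero_det[where f = "\<lambda>q j. B $$ (j, q)"]) blast
  thus ?thesis using that unfolding row_minor_def by auto
qed

abbreviation skip :: "nat \<Rightarrow> nat \<Rightarrow> nat" where
  "skip s p \<equiv> (if p < s then p else Suc p)"

text \<open>The sum is the expansion, along the adjoined column, of a maximal minor of the matrix that
  arises from \<open>B\<close> by adjoining \<open>v\<close>.\<close>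

lemma column_space_imp_minors:
  fixes B :: "'a::field mat"
  assumes B: "B \<in> carrier_mat n r" and "v \<in> column_space B" and L: "\<forall>p\<le>r. L p < n"
  shows "(\<Sum>s\<le>r. (-1) ^ s * v $ L s * row_minor r B (\<lambda>p. L (skip s p))) = 0"
proof -
  obtain c where c: "\<forall>i<n. v $ i = (\<Sum>j<r. B $$ (i, j) * c j)"
    using in_column_space_iff[OF B] assms(2) by blast
  define M where "M = mat (Suc r) (Suc r) (\<lambda>(p, q). if q = 0 then v $ L p else B $$ (L p, q - 1))"
  define y where "y = vec (Suc r) (\<lambda>q. if q = 0 then - 1 else c (q - 1))"
  have M: "M \<in> carrier_mat (Suc r) (Suc r)" by (simp add: M_def)
  have "M *\<^sub>v y = 0\<^sub>v (Suc r)"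
  proof (rule eq_vecI)
    fix p assume "p < dim_vec (0\<^sub>v (Suc r) :: 'a vec)"
    hence p: "p \<le> r" by simp
    have "(M *\<^sub>v y) $ p = (\<Sum>q<Suc r. (if q = 0 then v $ L p else B $$ (L p, q - 1)) * (if q = 0 then - 1 else c (q - 1)))"
      using p by (simp add: M_def y_def scalar_prod_def lessThan_atLeast0)
    also have "\<dots> = - v $ L p + (\<Sum>q<r. B $$ (L p, q) * c q)"
      by (simp add: sum.lessThan_Suc_shift del: sum.lessThan_Suc)
    also have "\<dots> = 0" using c L p by simp
    finally show "(M *\<^sub>v y) $ p = 0\<^sub>v (Suc r) $ p" using p by simp
  qed (simp add: M_def)
  moreover have "y \<in> carrier_vec (Suc r)" by (simp add: y_def)
  moreover have "y $ 0 \<noteq> 0\<^sub>v (Suc r) $ 0" by (simp add: y_def)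
  hence "y \<noteq> 0\<^sub>v (Suc r)" by metis
  ultimately have "det M = 0" using det_0_iff_vec_prod_zero_field[OF M] by blast
  moreover have "det M = (\<Sum>s\<le>r. (-1) ^ s * v $ L s * row_minor r B (\<lambda>p. L (skip s p)))"
  proof -
    have "cofactor M s 0 = (-1) ^ s * row_minor r B (\<lambda>p. L (skip s p))" if "s \<le> r" for s
    proof -
      have "mat_delete M s 0 = mat r r (\<lambda>(p, q). B $$ (L (skip s p), q))"
        using that by (intro eq_matI) (auto simp: mat_delete_def M_def)
      thus ?thesis by (simp add: cofactor_def row_minor_def)
    qed
    thus ?thesis
      using laplace_expansion_column[OF M, of 0] by (simp add: M_def lessThan_Suc_atMost mult_ac)
  qed
  ultimately show ?thesis by simp
qed

text \<open>If the rows \<open>I\<close> have a nonzero minor, the minors for \<open>I\<close> and one more row express that entry of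
  \<open>v\<close> through the entries of \<open>v\<close> in \<open>I\<close>; and the combination of the columns that agrees with
  \<open>v\<close> in \<open>I\<close> satisfies the same relations.\<close>

lemma minors_imp_column_space:
  fixes B :: "'a::field mat"
  assumes B: "B \<in> carrier_mat n r" and Y: "Y \<in> carrier_mat r n" "Y * B = 1\<^sub>m r"
    and v: "v \<in> carrier_vec n"
    and minors: "\<And>L. \<forall>p\<le>r. L p < n \<Longrightarrow>
      (\<Sum>s\<le>r. (-1) ^ s * v $ L s * row_minor r B (\<lambda>p. L (skip s p))) = 0"
  shows "v \<in> column_space B"
proof -
  obtain I where I: "\<And>p. p < r \<Longrightarrow> I p < n" "row_minor r B I \<noteq> 0"
    using independent_columns_minor[OF B Y] by blast
  define BI where "BI = mat r r (\<lambda>(p, q). B $$ (I p, q))"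
  have BI: "BI \<in> carrier_mat r r" "det BI \<noteq> 0" using I(2) by (simp_all add: BI_def row_minor_def)
  define c where "c = (\<lambda>q. inverse (det BI) * (\<Sum>p<r. adj_mat BI $$ (q, p) * v $ I p))"
  have solve: "(\<Sum>q<r. B $$ (I p, q) * c q) = v $ I p" if p: "p < r" for p
  proof -
    have "(\<Sum>q<r. BI $$ (p, q) * adj_mat BI $$ (q, p')) = (if p = p' then det BI else 0)" if "p' < r" for p'
      using mat_mult_entry[OF adj_mat(2)[OF BI(1)] BI(1) adj_mat(1)[OF BI(1)] p that] p that by simp
    hence *: "(\<Sum>p'<r. (\<Sum>q<r. BI $$ (p, q) * adj_mat BI $$ (q, p')) * v $ I p') = det BI * v $ I p"
      using p by (simp add: if_distrib[of "\<lambda>x. x * _"] cong: if_cong)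
    have "(\<Sum>q<r. B $$ (I p, q) * c q) = inverse (det BI) * (\<Sum>q<r. BI $$ (p, q) * (\<Sum>p'<r. adj_mat BI $$ (q, p') * v $ I p'))"
      using p by (simp add: c_def BI_def sum_distrib_left mult_ac)
    also have "(\<Sum>q<r. BI $$ (p, q) * (\<Sum>p'<r. adj_mat BI $$ (q, p') * v $ I p')) =
        (\<Sum>p'<r. (\<Sum>q<r. BI $$ (p, q) * adj_mat BI $$ (q, p')) * v $ I p')"
      unfolding sum_distrib_left sum_distrib_right mult.assoc by (rule sum.swap)
    finally show ?thesis using * BI(2) by simp
  qed
  have "v $ i = (\<Sum>j<r. B $$ (i, j) * c j)" if i: "i < n" for i
  proof -
    define L where "L p = (if p = 0 then i else I (p - 1))" for p
    have L: "\<forall>p\<le>r. L p < n" using I(1) i by (auto simp: L_def)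
    define u where "u = vec n (\<lambda>i. \<Sum>j<r. B $$ (i, j) * c j)"
    have det: "(\<Sum>s\<le>r. (-1) ^ s * x $ L s * row_minor r B (\<lambda>p. L (skip s p))) =
      x $ i * row_minor r B I + (\<Sum>s<r. (-1) ^ Suc s * x $ I s * row_minor r B (\<lambda>p. L (skip (Suc s) p)))" for x
    proof -
      have "(\<Sum>s<Suc r. (-1) ^ s * x $ L s * row_minor r B (\<lambda>p. L (skip s p))) =
        x $ i * row_minor r B I + (\<Sum>s<r. (-1) ^ Suc s * x $ I s * row_minor r B (\<lambda>p. L (skip (Suc s) p)))"
        by (subst sum.lessThan_Suc_shift) (simp add: L_def del: sum.lessThan_Suc)
      thus ?thesis by (simp only: lessThan_Suc_atMost)
    qed
    have "u \<in> column_space B" unfolding in_column_space_iff[OF B] by (auto simp: u_def)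
    hence u0: "(\<Sum>s\<le>r. (-1) ^ s * u $ L s * row_minor r B (\<lambda>p. L (skip s p))) = 0"
      by (rule column_space_imp_minors[OF B _ L])
    have "(\<Sum>s<r. (-1) ^ Suc s * u $ I s * row_minor r B (\<lambda>p. L (skip (Suc s) p))) =
        (\<Sum>s<r. (-1) ^ Suc s * v $ I s * row_minor r B (\<lambda>p. L (skip (Suc s) p)))"
      using I(1) solve by (intro sum.cong) (auto simp: u_def)
    with trans[OF u0 minors[OF L, symmetric]] have "u $ i * row_minor r B I = v $ i * row_minor r B I"
      unfolding det by (simp only: add_right_cancel)
    thus ?thesis using I(2) i by (simp add: u_def)
  qed
  thus "v \<in> column_space B" unfolding in_column_space_iff[OF B] using v by blast
qed

lemma row_minor_expand_first:
  "row_minor (Suc r) B (\<lambda>p. if p = 0 then i else L (p - 1)) =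
    (\<Sum>q<Suc r. B $$ (i, q) * ((-1) ^ q * det (mat r r (\<lambda>(s, t). B $$ (L s, skip q t)))))"
proof -
  define M where "M = mat (Suc r) (Suc r) (\<lambda>(p, q). B $$ (if p = 0 then i else L (p - 1), q))"
  have "mat_delete M 0 q = mat r r (\<lambda>(s, t). B $$ (L s, skip q t))" for q
    by (intro eq_matI) (auto simp: mat_delete_def M_def)
  hence "cofactor M 0 q = (-1) ^ q * det (mat r r (\<lambda>(s, t). B $$ (L s, skip q t)))" for q
    by (simp add: cofactor_def)
  moreover have "det M = (\<Sum>q<Suc r. M $$ (0, q) * cofactor M 0 q)"
    by (rule laplace_expansion_row) (auto simp: M_def)
  ultimately show ?thesis
    by (simp add: row_minor_def M_def[symmetric]) (simp add: M_def)
qed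

text \<open>By linearity in the first row, the sum is the minor whose first row is the product of \<open>w\<close> and \<open>B\<close>. If the
  other rows are those of a nonzero minor with one row omitted, these minors are, up to signs, the
  entries of the product of that first row and an invertible adjugate matrix.\<close>

lemma conormal_iff_minors:
  fixes B :: "'a::field mat"
  assumes B: "B \<in> carrier_mat n (Suc r)" and Y: "Y \<in> carrier_mat (Suc r) n" "Y * B = 1\<^sub>m (Suc r)"
  shows "(\<forall>q<Suc r. (\<Sum>i<n. w i * B $$ (i, q)) = 0) \<longleftrightarrow>
    (\<forall>L. (\<forall>p<r. L p < n) \<longrightarrow>
      (\<Sum>i<n. w i * row_minor (Suc r) B (\<lambda>p. if p = 0 then i else L (p - 1))) = 0)"
proof -
  define \<gamma> where "\<gamma> q = (\<Sum>i<n. w i * B $$ (i, q))" for q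
  define D where "D L q = (-1) ^ q * det (mat r r (\<lambda>(s, t). B $$ (L s, skip q t)))" for L q
  have expand: "(\<Sum>i<n. w i * row_minor (Suc r) B (\<lambda>p. if p = 0 then i else L (p - 1))) =
      (\<Sum>q<Suc r. \<gamma> q * D L q)" for L
    unfolding row_minor_expand_first D_def[symmetric] \<gamma>_def sum_distrib_left sum_distrib_right mult.assoc
    by (rule sum.swap)
  have zero: "\<gamma> q = 0" if minors: "\<forall>L. (\<forall>p<r. L p < n) \<longrightarrow> (\<Sum>q<Suc r. \<gamma> q * D L q) = 0" and q: "q < Suc r" for q
  proof -
    obtain I where I: "\<And>p. p < Suc r \<Longrightarrow> I p < n" "row_minor (Suc r) B I \<noteq> 0"
      using independent_columns_minor[OF B Y] by blast
    define BI where "BI = mat (Suc r) (Suc r) (\<lambda>(p, q). B $$ (I p, q))"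
    have BI: "BI \<in> carrier_mat (Suc r) (Suc r)" "det BI \<noteq> 0"
      using I(2) by (simp_all add: BI_def row_minor_def)
    have zero: "(\<Sum>q<Suc r. \<gamma> q * adj_mat BI $$ (q, p)) = 0" if p: "p < Suc r" for p
    proof -
      define L where "L s = I (skip p s)" for s
      have "adj_mat BI $$ (q, p) = (-1) ^ p * D L q" if "q < Suc r" for q
      proof -
        have "mat_delete BI p q = mat r r (\<lambda>(s, t). B $$ (L s, skip q t))"
          by (intro eq_matI) (auto simp: mat_delete_def BI_def L_def)
        thus ?thesis
          using that p BI(1) by (simp add: adj_mat_def cofactor_def D_def power_add)
      qed
      hence "(\<Sum>q<Suc r. \<gamma> q * adj_mat BI $$ (q, p)) = (-1) ^ p * (\<Sum>q<Suc r. \<gamma> q * D L q)"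
        unfolding sum_distrib_left by (intro sum.cong) auto
      moreover have "\<forall>s<r. L s < n" using I(1) p by (auto simp: L_def)
      ultimately show ?thesis using minors by simp
    qed
    have "det BI * \<gamma> q = (\<Sum>q'<Suc r. \<gamma> q' * (\<Sum>p<Suc r. adj_mat BI $$ (q', p) * BI $$ (p, q)))"
    proof -
      have "(\<Sum>p<Suc r. adj_mat BI $$ (q', p) * BI $$ (p, q)) = (if q' = q then det BI else 0)" if "q' < Suc r" for q'
        using mat_mult_entry[OF adj_mat(3)[OF BI(1)] adj_mat(1)[OF BI(1)] BI(1) that q] that q by simp
      hence "(\<Sum>q'<Suc r. \<gamma> q' * (\<Sum>p<Suc r. adj_mat BI $$ (q', p) * BI $$ (p, q))) =
          (\<Sum>q'<Suc r. if q' = q then \<gamma> q' * det BI else 0)"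
        by (intro sum.cong) auto
      thus ?thesis using q by (simp add: mult.commute del: sum.lessThan_Suc)
    qed
    also have "\<dots> = (\<Sum>p<Suc r. (\<Sum>q'<Suc r. \<gamma> q' * adj_mat BI $$ (q', p)) * BI $$ (p, q))"
      unfolding sum_distrib_left sum_distrib_right mult.assoc by (rule sum.swap)
    also have "\<dots> = 0" using zero by (intro sum.neutral) auto
    finally show ?thesis using BI(2) by simp
  qed
  show ?thesis
    unfolding expand \<gamma>_def[symmetric]
  proof (intro iffI allI impI)
    fix L assume "\<forall>q<Suc r. \<gamma> q = 0"
    thus "(\<Sum>q<Suc r. \<gamma> q * D L q) = 0" by (intro sum.neutral) auto
  next
    fix q assume "\<forall>L. (\<forall>p<r. L p < n) \<longrightarrow> (\<Sum>q<Suc r. \<gamma> q * D L q) = 0" "q < Suc r"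
    thus "\<gamma> q = 0" by (rule zero)
  qed
qed

section \<open>Semicontinuity of the spaces of sections\<close>

text \<open>The values on the first chart are \<open>r\<close>-dimensional, expressed by left inverses, which is how the frames
  of the sub-bundle provide it and how the criteria with minors use it.\<close>

definition framed :: "nat \<Rightarrow> nat \<Rightarrow> ('a::field vec set \<Rightarrow> 'a vec set) \<Rightarrow> bool" where
  "framed r n \<phi> \<longleftrightarrow> (\<forall>x. \<exists>A\<in>carrier_mat n r. (\<exists>Y\<in>carrier_mat r n. Y * A = 1\<^sub>m r) \<and>
     \<phi> (proj_point 1 x) = column_space A)"

lemma left_inverse_of_column_space_eq:
  fixes A B :: "'a::field mat"
  assumes A: "A \<in> carrier_mat n r" and B: "B \<in> carrier_mat n r"
    and Y: "Y \<in> carrier_mat r n" "Y * A = 1\<^sub>m r" and eq: "column_space A = column_space B"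
  obtains Z where "Z \<in> carrier_mat r n" "Z * B = 1\<^sub>m r"
proof -
  have "\<exists>c. \<forall>i<n. A $$ (i, j) = (\<Sum>q<r. B $$ (i, q) * c q)" if j: "j < r" for j
  proof -
    have "col A j \<in> column_space A"
      unfolding in_column_space_iff[OF A] using A j
      by (auto intro!: exI[of _ "\<lambda>i. if i = j then 1 else 0"] simp: if_distrib cong: if_cong)
    hence "\<exists>c. \<forall>i<n. col A j $ i = (\<Sum>q<r. B $$ (i, q) * c q)"
      unfolding eq in_column_space_iff[OF B] by blast
    thus ?thesis using A j by simp
  qed
  then obtain c where c: "\<And>j i. j < r \<Longrightarrow> i < n \<Longrightarrow> A $$ (i, j) = (\<Sum>q<r. B $$ (i, q) * c j q)"
    by metis
  define C where "C = mat r r (\<lambda>(q, j). c j q)"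
  have C: "C \<in> carrier_mat r r" by (simp add: C_def)
  have "A = B * C"
    using A B by (intro eq_matI) (auto simp: C_def scalar_prod_def lessThan_atLeast0 c)
  hence "Y * B * C = 1\<^sub>m r" using Y B C by (simp add: assoc_mult_mat[of _ r n _ r _ r])
  hence "C * (Y * B) = 1\<^sub>m r" by (rule mat_mult_left_right_inverse[rotated 2]) (use Y B C in auto)
  hence "C * Y * B = 1\<^sub>m r" using Y B C by (simp add: assoc_mult_mat[of _ r r _ n _ r])
  thus ?thesis using that[of "C * Y"] C Y by auto
qed

lemma framed_plucker_basis:
  assumes "framed r n \<phi>" "plucker_forms r n e \<phi> c"
  shows "\<exists>B Z. B \<in> carrier_mat n r \<and> Z \<in> carrier_mat r n \<and> Z * B = 1\<^sub>m r \<and>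
    \<phi> (proj_point 1 x) = column_space B \<and>
    (\<forall>I. I \<subseteq> {..<n} \<and> card I = r \<longrightarrow> plucker B I = (\<Sum>k\<le>e. c (I, k) * x ^ k))"
proof -
  obtain A Y where A: "A \<in> carrier_mat n r" "Y \<in> carrier_mat r n" "Y * A = 1\<^sub>m r"
    "\<phi> (proj_point 1 x) = column_space A"
    using assms(1) unfolding framed_def by blast
  have "(1 :: 'a, x) \<noteq> (0, 0)" by simp
  then obtain B where B: "B \<in> carrier_mat n r" "column_space B = \<phi> (proj_point 1 x)"
    and "\<forall>I. I \<subseteq> {..<n} \<and> card I = r \<longrightarrow> plucker B I = (\<Sum>k\<le>e. c (I, k) * 1 ^ (e - k) * x ^ k)"
    using conjunct2[OF assms(2)[unfolded plucker_forms_def]] by blast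
  hence pl: "\<forall>I. I \<subseteq> {..<n} \<and> card I = r \<longrightarrow> plucker B I = (\<Sum>k\<le>e. c (I, k) * x ^ k)"
    by simp
  obtain Z where "Z \<in> carrier_mat r n" "Z * B = 1\<^sub>m r"
    using left_inverse_of_column_space_eq[OF A(1) B(1) A(2,3)] A(4) B(2) by metis
  thus ?thesis using B pl by (intro exI[of _ B] exI[of _ Z]) simp
qed

text \<open>The minor that controls the solution spaces near a given system is a homogeneous polynomial, because
  the coefficients of the system are linear in the coordinates \<open>c\<close>.\<close>

lemma solution_space_semicontinuous:
  fixes \<Lambda> :: "('v \<Rightarrow> 'a::field) \<Rightarrow> 'j \<Rightarrow> (nat \<Rightarrow> 'a poly) \<Rightarrow> 'a" and n m :: nat
  defines "E \<equiv> {v. (\<forall>i\<ge>n. v i = 0) \<and> (\<forall>i. degree (v i) \<le> m)}"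
  assumes lin: "\<And>c j v w. \<Lambda> c j (v + w) = \<Lambda> c j v + \<Lambda> c j w" "\<And>c j a v. \<Lambda> c j (pscale a v) = a * \<Lambda> c j v"
    and form: "\<And>j v. is_form 1 (\<lambda>c. \<Lambda> c j v)"
  obtains F where "homogeneous F" "mpoly_eval c0 F \<noteq> 0"
    "\<And>c. mpoly_eval c F \<noteq> 0 \<Longrightarrow>
      pv.dim {v\<in>E. \<forall>j\<in>J. \<Lambda> c j v = 0} \<le> pv.dim {v\<in>E. \<forall>j\<in>J. \<Lambda> c0 j v = 0}"
proof -
  have "\<exists>S. finite S \<and> E \<subseteq> pv.span S"
    unfolding E_def by (rule bounded_vectors_finite_span[of n m]) blast
  then obtain S where S: "finite S" "E \<subseteq> pv.span S" by blast
  have sub: "pv.subspace E" unfolding E_def by (rule bounded_vectors_subspace)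
  show ?thesis
  proof (rule solution_space_dim_le[OF sub S(2,1), of "\<Lambda> c0" J, OF lin])
    fix k z p
    assume det: "det (mat k k (\<lambda>(i, q). \<Lambda> c0 (p i) (z q))) \<noteq> 0"
      and le: "\<And>L. (\<And>j v w. L j (v + w) = L j v + L j w) \<Longrightarrow> (\<And>j a v. L j (pscale a v) = a * L j v) \<Longrightarrow>
        det (mat k k (\<lambda>(i, q). L (p i) (z q))) \<noteq> 0 \<Longrightarrow>
        pv.dim {v\<in>E. \<forall>j\<in>J. L j v = 0} \<le> pv.dim {v\<in>E. \<forall>j\<in>J. \<Lambda> c0 j v = 0}"
    have "\<exists>F. homogeneous F \<and> (\<forall>c. mpoly_eval c F = det (mat k k (\<lambda>(i, q). \<Lambda> c (p i) (z q))))"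
      by (rule is_form_homogeneous[OF is_form_det[where A = "\<lambda>i q c. \<Lambda> c (p i) (z q)"]]) (rule form)
    then obtain F where F: "homogeneous F" and eval: "\<forall>c. mpoly_eval c F = det (mat k k (\<lambda>(i, q). \<Lambda> c (p i) (z q)))"
      by (elim exE conjE)
    note F = F eval[rule_format]
    show ?thesis
    proof (rule that[of F])
      fix c assume "mpoly_eval c F \<noteq> 0"
      thus "pv.dim {v\<in>E. \<forall>j\<in>J. \<Lambda> c j v = 0} \<le> pv.dim {v\<in>E. \<forall>j\<in>J. \<Lambda> c0 j v = 0}"
        unfolding F by (intro le lin)
    qed (use F det in auto)
  qed
qed

text \<open>The minors of a matrix with given Pluecker coordinates at the point with coordinate \<open>x\<close> are linear in the
  coefficients of the Pluecker forms.\<close>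

lemma plucker_minor_forms:
  assumes "r \<le> n"
  shows "\<exists>\<mu> :: (nat \<Rightarrow> nat) \<Rightarrow> 'a::field \<Rightarrow> (nat set \<times> nat \<Rightarrow> 'a) \<Rightarrow> 'a.
    (\<forall>L x. is_form 1 (\<mu> L x)) \<and>
    (\<forall>B c L x. B \<in> carrier_mat n r \<longrightarrow>
      (\<forall>I. I \<subseteq> {..<n} \<and> card I = r \<longrightarrow> plucker B I = (\<Sum>k\<le>e. c (I, k) * x ^ k)) \<longrightarrow>
      (\<forall>p<r. L p < n) \<longrightarrow> row_minor r B L = \<mu> L x c)"
proof -
  have "\<exists>\<epsilon> I. (\<forall>p<r. L p < n) \<longrightarrow> I \<subseteq> {..<n} \<and> card I = r \<and>
      (\<forall>B\<in>carrier_mat n r. row_minor r B L = \<epsilon> * plucker (B :: 'a mat) I)" for L :: "nat \<Rightarrow> nat"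
    using row_minor_plucker[OF assms, of L] by blast
  then obtain \<epsilon> I where \<epsilon>: "\<And>L. \<forall>p<r. L p < n \<Longrightarrow> I L \<subseteq> {..<n} \<and> card (I L) = r \<and>
      (\<forall>B\<in>carrier_mat n r. row_minor r B L = \<epsilon> L * plucker (B :: 'a mat) (I L))" for L :: "nat \<Rightarrow> nat"
    by metis
  define \<mu> where "\<mu> L x c = \<epsilon> L * (\<Sum>k\<le>e. x ^ k * c (I L, k))" for L x and c :: "nat set \<times> nat \<Rightarrow> 'a"
  show ?thesis
  proof (intro exI[of _ \<mu>] conjI allI impI)
    show "is_form 1 (\<mu> L x)" for L x
      unfolding \<mu>_def by (intro is_form_cmult is_form_sum is_form_var)
    fix B :: "'a mat" and c L x assume "B \<in> carrier_mat n r"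
      "\<forall>I. I \<subseteq> {..<n} \<and> card I = r \<longrightarrow> plucker B I = (\<Sum>k\<le>e. c (I, k) * x ^ k)" "\<forall>p<r. L p < n"
    thus "row_minor r B L = \<mu> L x c"
      using \<epsilon>[of L] by (simp add: \<mu>_def mult.commute)
  qed
qed

text \<open>Membership in the values of the map is a linear system indexed by lists \<open>L\<close> of rows and points \<open>x\<close>, by the
  criterion with bordered minors.\<close>

lemma sub_sections_semicontinuous:
  fixes \<phi>0 :: "'a::field vec set \<Rightarrow> 'a vec set"
  assumes r: "r \<le> n" and \<phi>0: "framed r n \<phi>0" "plucker_forms r n e \<phi>0 c0"
  obtains F where "homogeneous F" "mpoly_eval c0 F \<noteq> 0"
    "\<And>\<phi> c. framed r n \<phi> \<Longrightarrow> plucker_forms r n e \<phi> c \<Longrightarrow> mpoly_eval c F \<noteq> 0 \<Longrightarrow>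
      pv.dim (sub_sections n \<phi> m) \<le> pv.dim (sub_sections n \<phi>0 m)"
proof -
  obtain \<mu> :: "(nat \<Rightarrow> nat) \<Rightarrow> 'a \<Rightarrow> (nat set \<times> nat \<Rightarrow> 'a) \<Rightarrow> 'a" where
    forms: "\<forall>L x. is_form 1 (\<mu> L x)" and
    minors: "\<forall>B c L x. B \<in> carrier_mat n r \<longrightarrow>
      (\<forall>I. I \<subseteq> {..<n} \<and> card I = r \<longrightarrow> plucker B I = (\<Sum>k\<le>e. c (I, k) * x ^ k)) \<longrightarrow>
      (\<forall>p<r. L p < n) \<longrightarrow> row_minor r B L = \<mu> L x c"
    using plucker_minor_forms[OF r, where e = e] by (elim exE conjE)
  note form = forms[rule_format] and \<mu> = minors[rule_format]
  define \<Lambda> where "\<Lambda> c = (\<lambda>(L, x) v. \<Sum>s\<le>r. (-1) ^ s * poly (v (L s)) x * \<mu> (\<lambda>p. L (skip s p)) x c)"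
    for c :: "nat set \<times> nat \<Rightarrow> 'a"
  define J where "J = {(L, x :: 'a). \<forall>p\<le>r. L p < n}"
  have sec: "sub_sections n \<phi> m =
      {v\<in>{v. (\<forall>i\<ge>n. v i = 0) \<and> (\<forall>i. degree (v i) \<le> m)}. \<forall>j\<in>J. \<Lambda> c j v = 0}"
    if fr: "framed r n \<phi>" and pf: "plucker_forms r n e \<phi> c" for \<phi> c
  proof -
    have "vec n (\<lambda>i. poly (v i) x) \<in> \<phi> (proj_point 1 x) \<longleftrightarrow> (\<forall>L. (\<forall>p\<le>r. L p < n) \<longrightarrow> \<Lambda> c (L, x) v = 0)" for v x
    proof -
      obtain B Z where B: "B \<in> carrier_mat n r" and Z: "Z \<in> carrier_mat r n" "Z * B = 1\<^sub>m r"
        and eq: "\<phi> (proj_point 1 x) = column_space B"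
        and pl: "\<forall>I. I \<subseteq> {..<n} \<and> card I = r \<longrightarrow> plucker B I = (\<Sum>k\<le>e. c (I, k) * x ^ k)"
        using framed_plucker_basis[OF fr pf, of x] by (elim exE conjE)
      have \<Lambda>: "\<Lambda> c (L, x) v = (\<Sum>s\<le>r. (-1) ^ s * vec n (\<lambda>i. poly (v i) x) $ L s * row_minor r B (\<lambda>p. L (skip s p)))"
        if L: "\<forall>p\<le>r. L p < n" for L
        unfolding \<Lambda>_def prod.case
      proof (intro sum.cong refl)
        fix s assume s: "s \<in> {..r}"
        have "row_minor r B (\<lambda>p. L (skip s p)) = \<mu> (\<lambda>p. L (skip s p)) x c"
          by (rule \<mu>[OF B]) (use L pl in auto)
        thus "(-1) ^ s * poly (v (L s)) x * \<mu> (\<lambda>p. L (skip s p)) x c =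
          (-1) ^ s * vec n (\<lambda>i. poly (v i) x) $ L s * row_minor r B (\<lambda>p. L (skip s p))"
          using L s by simp
      qed
      show ?thesis
        unfolding eq
      proof (intro iffI allI impI)
        fix L assume mem: "vec n (\<lambda>i. poly (v i) x) \<in> column_space B" and L: "\<forall>p\<le>r. L p < n"
        show "\<Lambda> c (L, x) v = 0"
          unfolding \<Lambda>[OF L] by (rule column_space_imp_minors[OF B mem L])
      next
        assume *: "\<forall>L. (\<forall>p\<le>r. L p < n) \<longrightarrow> \<Lambda> c (L, x) v = 0"
        show "vec n (\<lambda>i. poly (v i) x) \<in> column_space B"
        proof (rule minors_imp_column_space[OF B Z])
          fix L assume L: "\<forall>p\<le>r. L p < n"
          show "(\<Sum>s\<le>r. (-1) ^ s * vec n (\<lambda>i. poly (v i) x) $ L s * row_minor r B (\<lambda>p. L (skip s p))) = 0"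
            unfolding \<Lambda>[OF L, symmetric] using * L by blast
        qed simp
      qed
    qed
    thus ?thesis by (auto simp: sub_sections_def J_def)
  qed
  have lin: "\<Lambda> c j (v + w) = \<Lambda> c j v + \<Lambda> c j w" "\<Lambda> c j (pscale a v) = a * \<Lambda> c j v" for c j v w a
    by (cases j; simp add: \<Lambda>_def pscale_def algebra_simps sum.distrib sum_distrib_left)+
  have "is_form 1 (\<lambda>c. \<Lambda> c j v)" for j v
    by (cases j) (auto simp: \<Lambda>_def intro!: is_form_sum is_form_cmult form[simplified])
  then obtain F where F: "homogeneous F" "mpoly_eval c0 F \<noteq> 0"
    "\<And>c. mpoly_eval c F \<noteq> 0 \<Longrightarrow>
      pv.dim {v\<in>{v. (\<forall>i\<ge>n. v i = 0) \<and> (\<forall>i. degree (v i) \<le> m)}. \<forall>j\<in>J. \<Lambda> c j v = 0} \<le>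
      pv.dim {v\<in>{v. (\<forall>i\<ge>n. v i = 0) \<and> (\<forall>i. degree (v i) \<le> m)}. \<forall>j\<in>J. \<Lambda> c0 j v = 0}"
    using solution_space_semicontinuous[where \<Lambda> = \<Lambda> and n = n and m = m and J = J and ?c0.0 = c0, OF lin] by blast
  show ?thesis
    by (rule that[of F]) (use F sec \<phi>0 in auto)
qed

text \<open>Here the linear system comes from the criterion with minors in which a row is exchanged.\<close>

lemma conormal_sections_semicontinuous:
  fixes \<phi>0 :: "'a::field vec set \<Rightarrow> 'a vec set"
  assumes r: "0 < r" "r \<le> n" and \<phi>0: "framed r n \<phi>0" "plucker_forms r n e \<phi>0 c0"
  obtains F where "homogeneous F" "mpoly_eval c0 F \<noteq> 0"
    "\<And>\<phi> c. framed r n \<phi> \<Longrightarrow> plucker_forms r n e \<phi> c \<Longrightarrow> mpoly_eval c F \<noteq> 0 \<Longrightarrow>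
      pv.dim (conormal_sections n \<phi> m) \<le> pv.dim (conormal_sections n \<phi>0 m)"
proof -
  obtain r' where r': "r = Suc r'" using r(1) by (cases r) auto
  obtain \<mu> :: "(nat \<Rightarrow> nat) \<Rightarrow> 'a \<Rightarrow> (nat set \<times> nat \<Rightarrow> 'a) \<Rightarrow> 'a" where
    forms: "\<forall>L x. is_form 1 (\<mu> L x)" and
    minors: "\<forall>B c L x. B \<in> carrier_mat n r \<longrightarrow>
      (\<forall>I. I \<subseteq> {..<n} \<and> card I = r \<longrightarrow> plucker B I = (\<Sum>k\<le>e. c (I, k) * x ^ k)) \<longrightarrow>
      (\<forall>p<r. L p < n) \<longrightarrow> row_minor r B L = \<mu> L x c"
    using plucker_minor_forms[OF r(2), where e = e] by (elim exE conjE)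
  note form = forms[rule_format] and \<mu> = minors[rule_format]
  define \<Lambda> where "\<Lambda> c = (\<lambda>(L, x) w. \<Sum>i<n. poly (w i) x * \<mu> (\<lambda>p. if p = 0 then i else L (p - 1)) x c)"
    for c :: "nat set \<times> nat \<Rightarrow> 'a"
  define J where "J = {(L, x :: 'a). \<forall>p<r'. L p < n}"
  have sec: "conormal_sections n \<phi> m =
      {v\<in>{v. (\<forall>i\<ge>n. v i = 0) \<and> (\<forall>i. degree (v i) \<le> m)}. \<forall>j\<in>J. \<Lambda> c j v = 0}"
    if fr: "framed r n \<phi>" and pf: "plucker_forms r n e \<phi> c" for \<phi> c
  proof -
    have "(\<forall>u\<in>\<phi> (proj_point 1 x). (\<Sum>i<n. poly (w i) x * u $ i) = 0) \<longleftrightarrow>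
        (\<forall>L. (\<forall>p<r'. L p < n) \<longrightarrow> \<Lambda> c (L, x) w = 0)" for w x
    proof -
      obtain B Z where B: "B \<in> carrier_mat n r" and Z: "Z \<in> carrier_mat r n" "Z * B = 1\<^sub>m r"
        and eq: "\<phi> (proj_point 1 x) = column_space B"
        and pl: "\<forall>I. I \<subseteq> {..<n} \<and> card I = r \<longrightarrow> plucker B I = (\<Sum>k\<le>e. c (I, k) * x ^ k)"
        using framed_plucker_basis[OF fr pf, of x] by (elim exE conjE)
      have \<Lambda>: "\<Lambda> c (L, x) w = (\<Sum>i<n. poly (w i) x * row_minor r B (\<lambda>p. if p = 0 then i else L (p - 1)))"
        if L: "\<forall>p<r'. L p < n" for L
        unfolding \<Lambda>_def prod.case
      proof (intro sum.cong refl)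
        fix i assume i: "i \<in> {..<n}"
        have "row_minor r B (\<lambda>p. if p = 0 then i else L (p - 1)) = \<mu> (\<lambda>p. if p = 0 then i else L (p - 1)) x c"
          by (rule \<mu>[OF B]) (use L pl i r' in auto)
        thus "poly (w i) x * \<mu> (\<lambda>p. if p = 0 then i else L (p - 1)) x c =
          poly (w i) x * row_minor r B (\<lambda>p. if p = 0 then i else L (p - 1))" by simp
      qed
      have cols: "(\<forall>u\<in>\<phi> (proj_point 1 x). (\<Sum>i<n. poly (w i) x * u $ i) = 0) \<longleftrightarrow>
          (\<forall>q<r. (\<Sum>i<n. poly (w i) x * B $$ (i, q)) = 0)"
      proof (intro iffI allI impI ballI)
        fix q assume *: "\<forall>u\<in>\<phi> (proj_point 1 x). (\<Sum>i<n. poly (w i) x * u $ i) = 0" and q: "q < r"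
        have "col B q \<in> \<phi> (proj_point 1 x)"
          unfolding eq in_column_space_iff[OF B] using B q
          by (auto intro!: exI[of _ "\<lambda>i. if i = q then 1 else 0"] simp: if_distrib cong: if_cong)
        with * have "(\<Sum>i<n. poly (w i) x * col B q $ i) = 0" by blast
        thus "(\<Sum>i<n. poly (w i) x * B $$ (i, q)) = 0" using B q by simp
      next
        fix u assume *: "\<forall>q<r. (\<Sum>i<n. poly (w i) x * B $$ (i, q)) = 0" and "u \<in> \<phi> (proj_point 1 x)"
        then obtain d where "\<forall>i<n. u $ i = (\<Sum>q<r. B $$ (i, q) * d q)"
          unfolding eq in_column_space_iff[OF B] by blast
        hence "(\<Sum>i<n. poly (w i) x * u $ i) = (\<Sum>i<n. \<Sum>q<r. poly (w i) x * B $$ (i, q) * d q)"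
          by (simp add: sum_distrib_left mult.assoc)
        also have "\<dots> = (\<Sum>q<r. (\<Sum>i<n. poly (w i) x * B $$ (i, q)) * d q)"
          by (subst sum.swap) (simp add: sum_distrib_right)
        finally show "(\<Sum>i<n. poly (w i) x * u $ i) = 0" using * by simp
      qed
      show ?thesis
        unfolding cols
      proof (intro iffI allI impI)
        fix L assume *: "\<forall>q<r. (\<Sum>i<n. poly (w i) x * B $$ (i, q)) = 0" and L: "\<forall>p<r'. L p < n"
        have "\<forall>L. (\<forall>p<r'. L p < n) \<longrightarrow>
            (\<Sum>i<n. poly (w i) x * row_minor r B (\<lambda>p. if p = 0 then i else L (p - 1))) = 0"
          using conormal_iff_minors[of B n r' Z "\<lambda>i. poly (w i) x"] B Z * unfolding r' by blast
        thus "\<Lambda> c (L, x) w = 0" unfolding \<Lambda>[OF L] using L by blast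
      next
        fix q assume *: "\<forall>L. (\<forall>p<r'. L p < n) \<longrightarrow> \<Lambda> c (L, x) w = 0" and q: "q < r"
        have "\<forall>L. (\<forall>p<r'. L p < n) \<longrightarrow>
            (\<Sum>i<n. poly (w i) x * row_minor r B (\<lambda>p. if p = 0 then i else L (p - 1))) = 0"
        proof (intro allI impI)
          fix L assume L: "\<forall>p<r'. L p < n"
          show "(\<Sum>i<n. poly (w i) x * row_minor r B (\<lambda>p. if p = 0 then i else L (p - 1))) = 0"
            unfolding \<Lambda>[OF L, symmetric] using * L by blast
        qed
        hence "\<forall>q<Suc r'. (\<Sum>i<n. poly (w i) x * B $$ (i, q)) = 0"
          using conormal_iff_minors[of B n r' Z "\<lambda>i. poly (w i) x"] B Z unfolding r' by blast
        thus "(\<Sum>i<n. poly (w i) x * B $$ (i, q)) = 0" using q r' by blast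
      qed
    qed
    thus ?thesis by (auto simp: conormal_sections_def J_def)
  qed
  have lin: "\<Lambda> c j (v + w) = \<Lambda> c j v + \<Lambda> c j w" "\<Lambda> c j (pscale a v) = a * \<Lambda> c j v" for c j v w a
    by (cases j; simp add: \<Lambda>_def pscale_def algebra_simps sum.distrib sum_distrib_left)+
  have "is_form 1 (\<lambda>c. \<Lambda> c j v)" for j v
    by (cases j) (auto simp: \<Lambda>_def intro!: is_form_sum is_form_cmult form[simplified])
  then obtain F where F: "homogeneous F" "mpoly_eval c0 F \<noteq> 0"
    "\<And>c. mpoly_eval c F \<noteq> 0 \<Longrightarrow>
      pv.dim {v\<in>{v. (\<forall>i\<ge>n. v i = 0) \<and> (\<forall>i. degree (v i) \<le> m)}. \<forall>j\<in>J. \<Lambda> c j v = 0} \<le>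
      pv.dim {v\<in>{v. (\<forall>i\<ge>n. v i = 0) \<and> (\<forall>i. degree (v i) \<le> m)}. \<forall>j\<in>J. \<Lambda> c0 j v = 0}"
    using solution_space_semicontinuous[where \<Lambda> = \<Lambda> and n = n and m = m and J = J and ?c0.0 = c0, OF lin] by blast
  show ?thesis
    by (rule that[of F]) (use F sec \<phi>0 in auto)
qed

section \<open>Maps with prescribed splitting types\<close>

lemma reversal_monom_mult:
  assumes "degree p \<le> N"
  shows "reversal (N + a) (monom 1 a * p) = reversal N p"
proof (rule poly_eqI)
  fix i
  show "coeff (reversal (N + a) (monom 1 a * p)) i = coeff (reversal N p) i"
    using assms by (auto simp: coeff_reversal coeff_monom_mult coeff_eq_0)
qed

lemma reversal_minus: "reversal N (- p) = - reversal N p"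
  by (rule poly_eqI) (simp add: coeff_reversal)

lemma reversal_0 [simp]: "reversal N 0 = 0"
  by (rule poly_eqI) (simp add: coeff_reversal)

lemma reversal_monom: "k \<le> N \<Longrightarrow> reversal N (monom c k) = monom c (N - k)"
  by (rule poly_eqI) (auto simp: coeff_reversal)

text \<open>Frames \<open>U\<close> and \<open>U'\<close> over the two charts of a bundle with exponents \<open>a\<close>, and left inverses \<open>X\<close> and \<open>X'\<close>. The two
  frames are the values of the same homogeneous vectors of degrees \<open>a ! i\<close> at \<open>(1, z)\<close> and \<open>(z, 1)\<close>. The conditions on
  the coordinate \<open>0\<close> make an induction possible that adds one coordinate in front; in particular
  \<open>X'\<close> shows that \<open>U'\<close> has full rank even without its first row.\<close>

definition half_frame ::
  "nat \<Rightarrow> nat list \<Rightarrow> (nat \<Rightarrow> nat \<Rightarrow> 'a::field poly) \<Rightarrow> (nat \<Rightarrow> nat \<Rightarrow> 'a poly) \<Rightarrow>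
    (nat \<Rightarrow> nat \<Rightarrow> 'a poly) \<Rightarrow> (nat \<Rightarrow> nat \<Rightarrow> 'a poly) \<Rightarrow> bool" where
  "half_frame n a U U' X X' \<longleftrightarrow>
     (\<forall>i<length a. U 0 i = (if i = 0 then 1 else 0)) \<and>
     (\<forall>i<length a. U' 0 i = (if i = 0 then monom 1 (a ! 0) else 0)) \<and>
     (\<forall>i<length a. \<forall>j<length a. (\<Sum>k<n. X i k * U k j) = (if i = j then 1 else 0)) \<and>
     (\<forall>i<length a. \<forall>j<length a. (\<Sum>k<n. X' i k * U' k j) = (if i = j then 1 else 0)) \<and>
     (\<forall>i<length a. X' i 0 = 0) \<and>
     (\<forall>k<n. \<forall>i<length a. degree (U k i) \<le> a ! i \<and> U' k i = reversal (a ! i) (U k i))"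

text \<open>The sub-bundle with frames \<open>U\<close> and \<open>U'\<close> and the bundle of linear forms that annihilate it, with frames \<open>W\<close>
  and \<open>W'\<close>. For the latter the roles of the two charts are exchanged: \<open>W'\<close> has the shape that \<open>U\<close> has. So
  the condition is symmetric in the two bundles.\<close>

definition staircase :: "'a::field itself \<Rightarrow> nat list \<Rightarrow> nat list \<Rightarrow> bool" where
  "staircase T a b \<longleftrightarrow> (\<exists>(U :: nat \<Rightarrow> nat \<Rightarrow> 'a poly) U' X X' W W' V V'.
     half_frame (length a + length b) a U U' X X' \<and> half_frame (length a + length b) b W' W V' V \<and>
     (\<forall>i<length a. \<forall>j<length b. (\<Sum>k<length a + length b. U k i * W k j) = 0) \<and>
     (\<forall>i<length a. \<forall>j<length b. (\<Sum>k<length a + length b. U' k i * W' k j) = 0))"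

lemma staircase_swap:
  assumes "staircase TYPE('a::field) a b"
  shows "staircase TYPE('a) b a"
proof -
  obtain U U' X X' W W' V V' :: "nat \<Rightarrow> nat \<Rightarrow> 'a poly" where
    h: "half_frame (length a + length b) a U U' X X'" "half_frame (length a + length b) b W' W V' V"
    and o: "\<forall>i<length a. \<forall>j<length b. (\<Sum>k<length a + length b. U k i * W k j) = 0"
    "\<forall>i<length a. \<forall>j<length b. (\<Sum>k<length a + length b. U' k i * W' k j) = 0"
    using assms unfolding staircase_def by (elim exE conjE)
  have "(\<Sum>k<n. f k * g k) = (\<Sum>k<n. g k * f k)" for f g :: "nat \<Rightarrow> 'a poly" and n
    by (rule sum.cong) (auto simp: mult.commute)
  note o' = o[unfolded this[of "\<lambda>k. U k _"] this[of "\<lambda>k. U' k _"]]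
  have "\<forall>i<length b. \<forall>j<length a. (\<Sum>k<length a + length b. W' k i * U' k j) = 0"
    "\<forall>i<length b. \<forall>j<length a. (\<Sum>k<length a + length b. W k i * U k j) = 0"
    using o' by auto
  with h show ?thesis
    unfolding staircase_def add.commute[of "length b" "length a"]
    by - (rule exI[of _ W'], rule exI[of _ W], rule exI[of _ V'], rule exI[of _ V],
        rule exI[of _ U'], rule exI[of _ U], rule exI[of _ X'], rule exI[of _ X], intro conjI)
qed

lemma staircase_single: "staircase TYPE('a::field) [e] [e]"
proof -
  define U :: "nat \<Rightarrow> nat \<Rightarrow> 'a poly" where "U k i = (if k = 0 then 1 else monom 1 e)" for k i
  define U' :: "nat \<Rightarrow> nat \<Rightarrow> 'a poly" where "U' k i = (if k = 0 then monom 1 e else 1)" for k i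
  define X :: "nat \<Rightarrow> nat \<Rightarrow> 'a poly" where "X i k = (if k = 0 then 1 else 0)" for i k
  define X' :: "nat \<Rightarrow> nat \<Rightarrow> 'a poly" where "X' i k = (if k = 0 then 0 else 1)" for i k
  define W :: "nat \<Rightarrow> nat \<Rightarrow> 'a poly" where "W k j = (if k = 0 then monom 1 e else - 1)" for k j
  define W' :: "nat \<Rightarrow> nat \<Rightarrow> 'a poly" where "W' k j = (if k = 0 then 1 else - monom 1 e)" for k j
  define V :: "nat \<Rightarrow> nat \<Rightarrow> 'a poly" where "V j k = (if k = 0 then 0 else - 1)" for j k
  have two: "(\<Sum>k<Suc (Suc 0). f k) = f 0 + f 1" for f :: "nat \<Rightarrow> 'a poly" by simp
  have rev: "reversal e (1 :: 'a poly) = monom 1 e" "reversal e (monom 1 e :: 'a poly) = 1"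
    using reversal_monom[of 0 e "1::'a"] reversal_monom[of e e "1::'a"] by (simp_all add: monom_0 one_pCons)
  have "half_frame 2 [e] U U' X X'" "half_frame 2 [e] W' W X V"
    by (auto simp: half_frame_def two numeral_2_eq_2 U_def U'_def X_def X'_def W_def W'_def V_def
        rev reversal_minus degree_monom_eq)
  moreover have "(\<Sum>k<2. U k 0 * W k 0) = 0" "(\<Sum>k<2. U' k 0 * W' k 0) = 0"
    by (simp_all add: two numeral_2_eq_2 U_def U'_def W_def W'_def)
  ultimately show ?thesis
    unfolding staircase_def
    by - (rule exI[of _ U], rule exI[of _ U'], rule exI[of _ X], rule exI[of _ X'], rule exI[of _ W],
        rule exI[of _ W'], rule exI[of _ V], rule exI[of _ X], simp add: numeral_2_eq_2)
qed

lemma sum_Suc_shift: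
  fixes f :: "nat \<Rightarrow> 'a::comm_monoid_add"
  shows "(\<Sum>k<Suc n. f k) = f 0 + (\<Sum>k<n. f (Suc k))"
  by (rule sum.lessThan_Suc_shift)

text \<open>Put a coordinate in front. The new vector is \<open>(s ^ a0, t ^ a0, 0, \<dots>)\<close>, and the linear form with exponent \<open>b0 - a0\<close>
  is multiplied by \<open>- s ^ a0\<close> and gets the new coordinate \<open>t ^ b0\<close>: its next coordinate is \<open>- s ^ a0 * t ^ (b0 - a0)\<close>,
  so the two are orthogonal. All other vectors and forms get the new coordinate \<open>0\<close>.\<close>

lemma staircase_step:
  assumes st: "staircase TYPE('a::field) as ((b0 - a0) # bs)" and le: "a0 \<le> b0" and ne: "as \<noteq> []"
  shows "staircase TYPE('a) (a0 # as) (b0 # bs)"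
proof -
  define n where "n = length as + Suc (length bs)"
  obtain U U' X X' W W' V V' :: "nat \<Rightarrow> nat \<Rightarrow> 'a poly" where
    hu: "half_frame n as U U' X X'" and hw: "half_frame n ((b0 - a0) # bs) W' W V' V" and
    orth: "\<forall>i<length as. \<forall>j<Suc (length bs). (\<Sum>k<n. U k i * W k j) = 0"
    "\<forall>i<length as. \<forall>j<Suc (length bs). (\<Sum>k<n. U' k i * W' k j) = 0"
    using st unfolding staircase_def n_def by auto
  have n0: "0 < n" by (simp add: n_def)
  obtain n' where n': "n = Suc n'" using n0 by (cases n) auto
  define r where "r = length as"
  define q where "q = length bs"
  have r0: "0 < r" using ne by (simp add: r_def)
  have row: "U 0 i = (if i = 0 then 1 else 0)" "U' 0 i = (if i = 0 then monom 1 (as ! 0) else 0)" "X' i 0 = 0"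
    if "i < r" for i using hu that by (auto simp: half_frame_def r_def)
  have inv: "(\<Sum>k<n. X i k * U k j) = (if i = j then 1 else 0)" "(\<Sum>k<n. X' i k * U' k j) = (if i = j then 1 else 0)"
    if "i < r" "j < r" for i j using hu that by (auto simp: half_frame_def r_def)
  have deg: "degree (U k i) \<le> as ! i" "U' k i = reversal (as ! i) (U k i)" if "k < n" "i < r" for k i
    using hu that by (auto simp: half_frame_def r_def)
  have rowW: "W' 0 j = (if j = 0 then 1 else 0)" "W 0 j = (if j = 0 then monom 1 (b0 - a0) else 0)" "V j 0 = 0"
    if "j < Suc q" for j using hw that by (auto simp: half_frame_def q_def)
  have invW: "(\<Sum>k<n. V' i k * W' k j) = (if i = j then 1 else 0)" "(\<Sum>k<n. V i k * W k j) = (if i = j then 1 else 0)"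
    if "i < Suc q" "j < Suc q" for i j using hw that by (auto simp: half_frame_def q_def)
  have degW: "degree (W' k j) \<le> ((b0 - a0) # bs) ! j" "W k j = reversal (((b0 - a0) # bs) ! j) (W' k j)"
    if "k < n" "j < Suc q" for k j using hw that by (auto simp: half_frame_def q_def)
  have orth: "(\<Sum>k<n. U k i * W k j) = 0" "(\<Sum>k<n. U' k i * W' k j) = 0" if "i < r" "j < Suc q" for i j
    using orth that by (auto simp: r_def q_def)

  \<comment> \<open>The row \<open>0\<close> of \<open>x\<close> reads off the new coordinate. The row \<open>0\<close> of \<open>x'\<close> reads off the next one
    and corrects for the first of the old vectors, the only one with a nonzero entry there.\<close>
  define u where "u k i = (if i = 0 then if k = 0 then 1 else if k = 1 then monom 1 a0 else 0
      else if k = 0 then 0 else U (k - 1) (i - 1))" for k i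
  define u' where "u' k i = (if i = 0 then if k = 0 then monom 1 a0 else if k = 1 then 1 else 0
      else if k = 0 then 0 else U' (k - 1) (i - 1))" for k i
  define x where "x i k = (if i = 0 then if k = 0 then 1 else 0
      else if k = 0 then - monom 1 a0 * X (i - 1) 0 else X (i - 1) (k - 1))" for i k
  define x' where "x' i k = (if k = 0 then 0 else if i = 0 then (if k = 1 then 1 else 0) - monom 1 (as ! 0) * X' 0 (k - 1)
      else X' (i - 1) (k - 1))" for i k
  define w where "w k j = (if j = 0 then if k = 0 then monom 1 b0 else - W (k - 1) 0
      else if k = 0 then 0 else W (k - 1) j)" for k j
  define w' where "w' k j = (if j = 0 then if k = 0 then 1 else - monom 1 a0 * W' (k - 1) 0
      else if k = 0 then 0 else W' (k - 1) j)" for k j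
  define v where "v j k = (if k = 0 then 0 else if j = 0 then - V 0 (k - 1) else V j (k - 1))" for j k
  define v' where "v' j k = (if j = 0 then if k = 0 then 1 else 0 else if k = 0 then 0 else V' j (k - 1))" for j k

  have first: "(\<Sum>k<n. f k * (if k = 0 then c else 0)) = f 0 * c"
    "(\<Sum>k<n. (if k = 0 then c else 0) * f k) = c * f 0" for f and c :: "'a poly"
    unfolding n' sum_Suc_shift by simp_all
  have hfu: "half_frame (Suc n) (a0 # as) u u' x x'"
    unfolding half_frame_def
  proof (intro conjI allI impI)
    fix i j assume i: "i < length (a0 # as)" and j: "j < length (a0 # as)"
    show "(\<Sum>k<Suc n. x i k * u k j) = (if i = j then 1 else 0)"
      unfolding sum_Suc_shift using i j first(1)[of "X (i - 1)" "monom 1 a0"] inv(1)[of "i - 1" "j - 1"]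
      by (cases i; cases j) (auto simp: x_def u_def r_def if_distrib[of "\<lambda>y. _ * y"] cong: if_cong)
    show "(\<Sum>k<Suc n. x' i k * u' k j) = (if i = j then 1 else 0)"
    proof (cases "i = 0")
      case True
      show ?thesis
      proof (cases "j = 0")
        case True
        have "(\<Sum>k<n. x' 0 (Suc k) * u' (Suc k) 0) = (\<Sum>k<n. x' 0 (Suc k) * (if k = 0 then 1 else 0))"
          by (intro sum.cong) (auto simp: u'_def)
        also have "\<dots> = 1" unfolding first(1)[of "\<lambda>k. x' 0 (Suc k)"] using row(3)[OF r0] by (simp add: x'_def)
        finally show ?thesis unfolding sum_Suc_shift using \<open>i = 0\<close> True by (simp add: x'_def)
      next
        case False
        hence j1: "j - 1 < r" using j by (auto simp: r_def)
        have "(\<Sum>k<n. x' 0 (Suc k) * u' (Suc k) j) =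
            (\<Sum>k<n. (if k = 0 then 1 else 0) * U' k (j - 1)) - monom 1 (as ! 0) * (\<Sum>k<n. X' 0 k * U' k (j - 1))"
          unfolding sum_distrib_left sum_subtractf[symmetric] using False
          by (intro sum.cong) (auto simp: x'_def u'_def algebra_simps)
        also have "\<dots> = 0" unfolding first(2)[of 1] inv(2)[OF r0 j1] using row(2)[OF j1] by auto
        finally show ?thesis unfolding sum_Suc_shift using \<open>i = 0\<close> False by (simp add: x'_def)
      qed
    next
      case False
      hence i1: "i - 1 < r" using i by (auto simp: r_def)
      show ?thesis
      proof (cases "j = 0")
        case True
        have "(\<Sum>k<n. x' i (Suc k) * u' (Suc k) 0) = (\<Sum>k<n. X' (i - 1) k * (if k = 0 then 1 else 0))"
          using False by (intro sum.cong) (auto simp: u'_def x'_def)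
        thus ?thesis unfolding sum_Suc_shift using False True row(3)[OF i1] first(1)[of "X' (i - 1)" 1]
          by (simp add: x'_def)
      next
        case j0: False
        hence j1: "j - 1 < r" using j by (auto simp: r_def)
        have "(\<Sum>k<n. x' i (Suc k) * u' (Suc k) j) = (\<Sum>k<n. X' (i - 1) k * U' k (j - 1))"
          using False j0 by (intro sum.cong) (auto simp: u'_def x'_def)
        thus ?thesis unfolding sum_Suc_shift using False j0 inv(2)[OF i1 j1] by (auto simp: x'_def)
      qed
    qed
  next
    fix k i assume k: "k < Suc n" and i: "i < length (a0 # as)"
    have rev: "reversal a0 (1 :: 'a poly) = monom 1 a0" "reversal a0 (monom 1 a0 :: 'a poly) = 1"
      using reversal_monom[of 0 a0 "1::'a"] reversal_monom[of a0 a0 "1::'a"] by (simp_all add: monom_0 one_pCons)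
    show "degree (u k i) \<le> (a0 # as) ! i" "u' k i = reversal ((a0 # as) ! i) (u k i)"
      using k i deg[of "k - 1" "i - 1"] by (cases i; auto simp: u_def u'_def rev r_def degree_monom_eq)+
  qed (auto simp: u_def u'_def x'_def)
  have hfw: "half_frame (Suc n) (b0 # bs) w' w v' v"
    unfolding half_frame_def
  proof (intro conjI allI impI)
    fix i j assume i: "i < length (b0 # bs)" and j: "j < length (b0 # bs)"
    hence ij: "i < Suc q" "j < Suc q" by (auto simp: q_def)
    show "(\<Sum>k<Suc n. v' i k * w' k j) = (if i = j then 1 else 0)"
    proof (cases "i = 0")
      case True
      thus ?thesis unfolding sum_Suc_shift by (auto simp: v'_def w'_def)
    next
      case False
      show ?thesis
      proof (cases "j = 0")
        case True
        have "(\<Sum>k<n. v' i (Suc k) * w' (Suc k) 0) = - monom 1 a0 * (\<Sum>k<n. V' i k * W' k 0)"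
          unfolding sum_distrib_left using False by (intro sum.cong) (auto simp: v'_def w'_def)
        thus ?thesis unfolding sum_Suc_shift using False True invW(1)[OF ij] by (simp add: v'_def)
      next
        case j0: False
        thus ?thesis unfolding sum_Suc_shift using False invW(1)[OF ij] by (simp add: v'_def w'_def)
      qed
    qed
    have "(\<Sum>k<n. v i (Suc k) * w (Suc k) j) =
        (if i = 0 then - 1 else 1) * (if j = 0 then - 1 else 1) * (\<Sum>k<n. V i k * W k j)"
      unfolding sum_distrib_left by (intro sum.cong) (auto simp: v_def w_def)
    thus "(\<Sum>k<Suc n. v i k * w k j) = (if i = j then 1 else 0)"
      unfolding sum_Suc_shift invW(2)[OF ij] by (auto simp: v_def)
  next
    fix k j assume k: "k < Suc n" and "j < length (b0 # bs)"
    hence j: "j < Suc q" by (simp add: q_def)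
    have rev: "reversal b0 (1 :: 'a poly) = monom 1 b0"
      using reversal_monom[of 0 b0 "1::'a"] by (simp add: monom_0 one_pCons)
    show "degree (w' k j) \<le> (b0 # bs) ! j"
    proof (cases "j = 0")
      case True
      have "degree (monom 1 a0 * W' (k - 1) 0) \<le> a0 + (b0 - a0)" if "k \<noteq> 0"
      proof (rule order_trans[OF degree_mult_le add_mono])
        show "degree (monom (1::'a) a0) \<le> a0" by (rule degree_monom_le)
        show "degree (W' (k - 1) 0) \<le> b0 - a0" using degW(1)[of "k - 1" 0] k that by simp
      qed
      thus ?thesis using True le by (auto simp: w'_def)
    next
      case False
      thus ?thesis using degW(1)[of "k - 1" j] k j by (cases j) (auto simp: w'_def)
    qed
    show "w k j = reversal ((b0 # bs) ! j) (w' k j)"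
    proof (cases "j = 0")
      case True
      have "reversal b0 (- (monom 1 a0 * W' (k - 1) 0)) = - W (k - 1) 0" if "k \<noteq> 0"
        using reversal_monom_mult[of "W' (k - 1) 0" "b0 - a0" a0] degW[of "k - 1" 0] k that le
        by (simp add: reversal_minus)
      thus ?thesis using True rev by (auto simp: w_def w'_def)
    next
      case False
      thus ?thesis using degW(2)[of "k - 1" j] k j by (cases j) (auto simp: w_def w'_def)
    qed
  qed (auto simp: w'_def w_def v_def)
  have ortho: "(\<Sum>k<Suc n. u k i * w k j) = 0" "(\<Sum>k<Suc n. u' k i * w' k j) = 0"
    if "i < length (a0 # as)" "j < length (b0 # bs)" for i j
  proof -
    have j: "j < Suc q" using that by (simp add: q_def)
    show "(\<Sum>k<Suc n. u k i * w k j) = 0"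
    proof (cases "i = 0")
      case True
      have "(\<Sum>k<n. u (Suc k) i * w (Suc k) j) = (\<Sum>k<n. (if k = 0 then monom 1 a0 else 0) * w (Suc k) j)"
        using True by (intro sum.cong) (auto simp: u_def)
      also have "\<dots> = monom 1 a0 * w 1 j" unfolding first(2) by simp
      finally show ?thesis
        unfolding sum_Suc_shift using True rowW(2)[OF j] le by (auto simp: u_def w_def mult_monom)
    next
      case False
      hence i1: "i - 1 < r" using that by (auto simp: r_def)
      have "(\<Sum>k<n. u (Suc k) i * w (Suc k) j) = (if j = 0 then - 1 else 1) * (\<Sum>k<n. U k (i - 1) * W k j)"
        unfolding sum_distrib_left using False by (intro sum.cong) (auto simp: u_def w_def)
      thus ?thesis unfolding sum_Suc_shift orth(1)[OF i1 j] using False by (simp add: u_def)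
    qed
    show "(\<Sum>k<Suc n. u' k i * w' k j) = 0"
    proof (cases "i = 0")
      case True
      have "(\<Sum>k<n. u' (Suc k) i * w' (Suc k) j) = (\<Sum>k<n. (if k = 0 then 1 else 0) * w' (Suc k) j)"
        using True by (intro sum.cong) (auto simp: u'_def)
      also have "\<dots> = w' 1 j" unfolding first(2) by simp
      finally show ?thesis
        unfolding sum_Suc_shift using True rowW(1)[OF j] by (auto simp: u'_def w'_def)
    next
      case False
      hence i1: "i - 1 < r" using that by (auto simp: r_def)
      have "(\<Sum>k<n. u' (Suc k) i * w' (Suc k) j) = (if j = 0 then - monom 1 a0 else 1) * (\<Sum>k<n. U' k (i - 1) * W' k j)"
        unfolding sum_distrib_left using False by (intro sum.cong) (auto simp: u'_def w'_def)
      thus ?thesis unfolding sum_Suc_shift orth(2)[OF i1 j] using False by (simp add: u'_def)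
    qed
  qed
  have len: "length (a0 # as) + length (b0 # bs) = Suc n" by (simp add: n_def)
  show ?thesis
    unfolding staircase_def len
    by (rule exI[of _ u], rule exI[of _ u'], rule exI[of _ x], rule exI[of _ x'], rule exI[of _ w],
        rule exI[of _ w'], rule exI[of _ v], rule exI[of _ v'], use hfu hfw ortho in \<open>intro conjI allI impI\<close>)
qed

text \<open>Subtract the smaller of the two first entries from the other one and drop it, as in the northwest corner
  rule for transportation problems. Since the sums agree, the list that loses an entry
  has another one unless both lists have length one.\<close>

lemma staircase_exists:
  assumes "sum_list a = sum_list b" "a \<noteq> []" "b \<noteq> []"
  shows "staircase TYPE('a::field) a b"
  using assms
proof (induction "length a + length b" arbitrary: a b rule: less_induct)
  case less
  obtain a0 as where a: "a = a0 # as" using less.prems by (cases a) auto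
  obtain b0 bs where b: "b = b0 # bs" using less.prems by (cases b) auto
  consider "as = []" "bs = []" | "as \<noteq> []" "a0 \<le> b0" | "bs \<noteq> []" "b0 \<le> a0"
  proof (cases "a0 \<le> b0")
    case True
    show ?thesis
    proof (cases "as = []")
      case as: True
      hence "b0 \<le> a0" using less.prems(1) by (simp add: a b)
      thus ?thesis using that as by blast
    qed (use True that in blast)
  next
    case False
    hence "bs \<noteq> []" using less.prems(1) by (auto simp: a b)
    thus ?thesis using that False by auto
  qed
  thus ?case
  proof cases
    case 1
    thus ?thesis using less.prems staircase_single by (simp add: a b)
  next
    case 2
    have "staircase TYPE('a) as ((b0 - a0) # bs)"
      by (rule less.hyps) (use less.prems 2 in \<open>auto simp: a b\<close>)
    thus ?thesis unfolding a b using 2 by (intro staircase_step)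
  next
    case 3
    have "staircase TYPE('a) bs ((a0 - b0) # as)"
      by (rule less.hyps) (use less.prems 3 in \<open>auto simp: a b\<close>)
    hence "staircase TYPE('a) (b0 # bs) (a0 # as)" using 3 by (intro staircase_step)
    thus ?thesis unfolding a b by (rule staircase_swap)
  qed
qed

lemma column_space_in_grassmannian:
  fixes B :: "'a::field mat"
  assumes B: "B \<in> carrier_mat n r" and Y: "Y \<in> carrier_mat r n" "Y * B = 1\<^sub>m r"
  shows "column_space B \<in> grassmannian r n"
proof -
  interpret vec_space "TYPE('a)" n .
  have dist: "distinct (cols B)"
    unfolding distinct_conv_nth
  proof (intro allI impI)
    fix i j assume "i < length (cols B)" "j < length (cols B)" and ne: "i \<noteq> j"
    hence ij: "i < r" "j < r" using B by auto
    show "cols B ! i \<noteq> cols B ! j"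
    proof
      assume "cols B ! i = cols B ! j"
      hence "col B i = col B j" using ij B by simp
      hence "B $$ (k, i) = B $$ (k, j)" if "k < n" for k
        using that ij B by (metis carrier_matD index_col)
      hence "(\<Sum>k<n. Y $$ (i, k) * B $$ (k, i)) = (\<Sum>k<n. Y $$ (i, k) * B $$ (k, j))"
        by (intro sum.cong) auto
      thus False
        using left_inverse_sum[OF Y(2,1) B ij(1,1)] left_inverse_sum[OF Y(2,1) B ij] ne by simp
    qed
  qed
  have "lin_indpt (set (cols B))"
  proof
    assume "lin_dep (set (cols B))"
    then obtain v where v: "v \<in> carrier_vec r" "v \<noteq> 0\<^sub>v r" "B *\<^sub>v v = 0\<^sub>v n"
      using lin_depE[OF B _ dist] by blast
    have "v = Y * B *\<^sub>v v" using Y v(1) by simp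
    also have "\<dots> = Y *\<^sub>v (B *\<^sub>v v)" using Y B v(1) by (intro assoc_mult_mat_vec)
    also have "\<dots> = 0\<^sub>v r" using Y(1) v(3) by (intro eq_vecI) auto
    finally show False using v(2) by simp
  qed
  hence "rank B = r" using lin_indpt_full_rank[OF B dist] by simp
  hence "vectorspace.dim class_ring (module_vec TYPE('a) n\<lparr>carrier := span (set (cols B))\<rparr>) = r"
    by (simp add: rank_def)
  moreover have "VectorSpace.subspace class_ring (span (set (cols B))) (module_vec TYPE('a) n)"
    unfolding VectorSpace.subspace_def
    using span_is_submodule[of "set (cols B)"] cols_dim[of B] B vec_vs by auto
  ultimately show ?thesis
    using B by (simp add: grassmannian_def col_space_def)
qed

lemma in_proj_point_iff:
  fixes v :: "'a::field vec"
  shows "v \<in> proj_point s t \<longleftrightarrow> v \<in> carrier_vec 2 \<and> (\<exists>c. v $ 0 = s * c \<and> v $ 1 = t * c)"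
proof -
  let ?M = "mat_of_cols 2 [vec_of_list [s, t]]"
  have M: "?M \<in> carrier_mat 2 1" using mat_of_cols_carrier(1)[of 2 "[vec_of_list [s, t]]"] by simp
  have 2: "(\<forall>i<2::nat. P i) \<longleftrightarrow> P 0 \<and> P 1" for P by (auto simp: less_2_cases_iff)
  have "v \<in> column_space ?M \<longleftrightarrow> v \<in> carrier_vec 2 \<and> (\<exists>c. v $ 0 = s * c 0 \<and> v $ 1 = t * c (0 :: nat))"
    unfolding in_column_space_iff[OF M] 2 by (simp add: mat_of_cols_def)
  moreover have "(\<exists>c :: nat \<Rightarrow> 'a. P (c 0)) \<longleftrightarrow> (\<exists>c. P c)" for P
  proof
    assume "\<exists>c. P c"
    then obtain c where "P c" ..
    thus "\<exists>c :: nat \<Rightarrow> 'a. P (c 0)" by (intro exI[of _ "\<lambda>_. c"])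
  qed auto
  from this[of "\<lambda>c. v $ 0 = s * c \<and> v $ 1 = t * c"]
  have "(\<exists>c :: nat \<Rightarrow> 'a. v $ 0 = s * c 0 \<and> v $ 1 = t * c 0) \<longleftrightarrow> (\<exists>c. v $ 0 = s * c \<and> v $ 1 = t * c)" .
  ultimately show ?thesis unfolding proj_point_def by simp
qed

lemma proj_point_scale:
  assumes "k \<noteq> 0"
  shows "proj_point (k * s) (k * t) = proj_point s t"
proof -
  have "(\<exists>c. x = k * s * c \<and> y = k * t * c) \<longleftrightarrow> (\<exists>c. x = s * c \<and> y = t * c)" for x y
  proof
    assume "\<exists>c. x = k * s * c \<and> y = k * t * c"
    then obtain c where "x = k * s * c" "y = k * t * c" by blast
    thus "\<exists>c. x = s * c \<and> y = t * c" by (intro exI[of _ "k * c"]) simp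
  next
    assume "\<exists>c. x = s * c \<and> y = t * c"
    then obtain c where "x = s * c" "y = t * c" by blast
    thus "\<exists>c. x = k * s * c \<and> y = k * t * c" using assms by (intro exI[of _ "c / k"]) simp
  qed
  thus ?thesis by (simp add: set_eq_iff in_proj_point_iff)
qed

lemma proj_point_eqD: "proj_point 1 x = proj_point 1 y \<Longrightarrow> x = y"
proof -
  assume eq: "proj_point 1 x = proj_point 1 y"
  have "vec 2 (\<lambda>i. if i = 0 then 1 else x) \<in> proj_point 1 x" unfolding in_proj_point_iff by auto
  thus "x = y" unfolding eq in_proj_point_iff by auto
qed

lemma proj_point_0_1_neq: "proj_point 0 1 \<noteq> proj_point 1 (x :: 'a::field)"
proof
  assume eq: "proj_point 0 1 = proj_point 1 x"
  have "vec 2 (\<lambda>i. if i = 0 then 0 else 1) \<in> proj_point (0 :: 'a) 1" unfolding in_proj_point_iff by auto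
  thus False unfolding eq in_proj_point_iff by auto
qed

lemma proj_point_in_grassmannian:
  assumes "(s, t) \<noteq> (0, 0)"
  shows "proj_point s t \<in> grassmannian 1 2"
proof -
  let ?M = "mat_of_cols 2 [vec_of_list [s, t]]"
  define Y where "Y = mat 1 2 (\<lambda>(i, j). if s \<noteq> 0 then (if j = 0 then inverse s else 0) else if j = 0 then 0 else inverse t)"
  have "Y * ?M = 1\<^sub>m 1"
    using assms by (intro eq_matI) (auto simp: Y_def mat_of_cols_def scalar_prod_def numeral_2_eq_2)
  moreover have "?M \<in> carrier_mat 2 1" using mat_of_cols_carrier(1)[of 2 "[vec_of_list [s, t]]"] by simp
  moreover have "Y \<in> carrier_mat 1 2" by (simp add: Y_def)
  ultimately show ?thesis
    unfolding proj_point_def using column_space_in_grassmannian by blast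
qed

lemma column_space_scale:
  fixes d :: "nat \<Rightarrow> 'a::field"
  assumes A: "A \<in> carrier_mat n r" and d: "\<And>i. i < r \<Longrightarrow> d i \<noteq> 0"
  shows "column_space (mat n r (\<lambda>(k, i). A $$ (k, i) * d i)) = column_space A"
proof -
  have B: "mat n r (\<lambda>(k, i). A $$ (k, i) * d i) \<in> carrier_mat n r" by simp
  have "(\<exists>c. \<forall>k<n. v $ k = (\<Sum>i<r. A $$ (k, i) * d i * c i)) \<longleftrightarrow> (\<exists>c. \<forall>k<n. v $ k = (\<Sum>i<r. A $$ (k, i) * c i))" for v
  proof
    assume "\<exists>c. \<forall>k<n. v $ k = (\<Sum>i<r. A $$ (k, i) * d i * c i)"
    then obtain c where "\<forall>k<n. v $ k = (\<Sum>i<r. A $$ (k, i) * d i * c i)" ..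
    thus "\<exists>c. \<forall>k<n. v $ k = (\<Sum>i<r. A $$ (k, i) * c i)"
      by (intro exI[of _ "\<lambda>i. d i * c i"]) (simp add: mult.assoc)
  next
    assume "\<exists>c. \<forall>k<n. v $ k = (\<Sum>i<r. A $$ (k, i) * c i)"
    then obtain c where "\<forall>k<n. v $ k = (\<Sum>i<r. A $$ (k, i) * c i)" ..
    thus "\<exists>c. \<forall>k<n. v $ k = (\<Sum>i<r. A $$ (k, i) * d i * c i)"
      using d by (intro exI[of _ "\<lambda>i. c i / d i"]) simp
  qed
  thus ?thesis
    unfolding set_eq_iff in_column_space_iff[OF A] in_column_space_iff[OF B] by simp
qed

lemma submatrix_rows:
  assumes M: "M \<in> carrier_mat n r" and I: "I \<subseteq> {..<n}" "card I = r"
  shows "submatrix M I UNIV = mat r r (\<lambda>(p, q). M $$ (pick I p, q))"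
    and "\<And>p. p < r \<Longrightarrow> pick I p < n"
proof -
  have "{i. i < n \<and> i \<in> I} = I" using I by auto
  thus "submatrix M I UNIV = mat r r (\<lambda>(p, q). M $$ (pick I p, q))"
    using M I by (simp add: submatrix_def pick_UNIV)
  show "pick I p < n" if "p < r" for p
    using pick_in_set_le[of p I] that I by auto
qed

lemma plucker_scaled_evaluation:
  fixes M :: "'a::field poly mat"
  assumes M: "M \<in> carrier_mat n r" and I: "I \<subseteq> {..<n}" "card I = r"
  shows "plucker (mat n r (\<lambda>(k, i). poly (M $$ (k, i)) x * d i)) I =
    poly (det (submatrix M I UNIV)) x * (\<Prod>i<r. d i)"
proof -
  let ?ev = "\<lambda>p. poly p x"
  note sub = submatrix_rows[OF M I]
  have "mat n r (\<lambda>(k, i). poly (M $$ (k, i)) x * d i) \<in> carrier_mat n r" by simp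
  from submatrix_rows(1)[OF this I]
  have "submatrix (mat n r (\<lambda>(k, i). poly (M $$ (k, i)) x * d i)) I UNIV =
      map_mat ?ev (submatrix M I UNIV) * mat_diag r d"
    using sub by (subst mat_diag_mult_right[of _ r r]) (auto intro!: eq_matI)
  moreover have "submatrix M I UNIV \<in> carrier_mat r r" using sub by simp
  ultimately show ?thesis
    by (simp add: plucker_def det_mult[of _ r] det_mat_diag eval_det)
qed

text \<open>The vectors \<open>V\<close> on which the forms \<open>W\<close> are the dual basis complete the frame \<open>U\<close> of the common kernel of these
  forms to a frame of the trivial bundle.\<close>

lemma frame_completion:
  fixes U V W X :: "nat \<Rightarrow> nat \<Rightarrow> 'a::field poly"
  assumes XU: "\<And>i j. i < r \<Longrightarrow> j < r \<Longrightarrow> (\<Sum>k<n. X i k * U k j) = (if i = j then 1 else 0)"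
    and VW: "\<And>i j. i < q \<Longrightarrow> j < q \<Longrightarrow> (\<Sum>k<n. V i k * W k j) = (if i = j then 1 else 0)"
    and UW: "\<And>i j. i < r \<Longrightarrow> j < q \<Longrightarrow> (\<Sum>k<n. U k i * W k j) = 0"
    and n: "n = r + q"
  defines "F \<equiv> mat n n (\<lambda>(k, i). if i < r then U k i else V (i - r) k)"
    and "Fi \<equiv> mat n n (\<lambda>(i, k). if i < r then X i k - (\<Sum>j<q. (\<Sum>m<n. X i m * V j m) * W k j) else W k (i - r))"
  shows "Fi * F = 1\<^sub>m n" "F * Fi = 1\<^sub>m n"
proof -
  have WU: "(\<Sum>k<n. W k j * U k i) = 0" if "i < r" "j < q" for i j
    using UW[OF that] by (simp add: mult.commute)
  have WV: "(\<Sum>k<n. W k j * V i k) = (if i = j then 1 else 0)" if "i < q" "j < q" for i j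
    using VW[OF that] by (simp add: mult.commute)
  have corr: "(\<Sum>k<n. (X i k - (\<Sum>j<q. c j * W k j)) * y k) =
      (\<Sum>k<n. X i k * y k) - (\<Sum>j<q. c j * (\<Sum>k<n. W k j * y k))" for i c y
  proof -
    have "(\<Sum>k<n. (\<Sum>j<q. c j * W k j) * y k) = (\<Sum>j<q. c j * (\<Sum>k<n. W k j * y k))"
      unfolding sum_distrib_left sum_distrib_right mult.assoc by (rule sum.swap)
    thus ?thesis by (simp add: left_diff_distrib sum_subtractf)
  qed
  show left: "Fi * F = 1\<^sub>m n"
  proof (rule eq_matI)
    fix i l assume "i < dim_row (1\<^sub>m n :: 'a poly mat)" "l < dim_col (1\<^sub>m n :: 'a poly mat)"
    hence il: "i < n" "l < n" by auto
    define y where "y k = (if l < r then U k l else V (l - r) k)" for k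
    have entry: "(Fi * F) $$ (i, l) = (\<Sum>k<n. (if i < r then X i k - (\<Sum>j<q. (\<Sum>m<n. X i m * V j m) * W k j) else W k (i - r)) * y k)"
      using il by (simp add: F_def Fi_def y_def scalar_prod_def lessThan_atLeast0)
    show "(Fi * F) $$ (i, l) = 1\<^sub>m n $$ (i, l)"
    proof (cases "i < r")
      case True
      have *: "(Fi * F) $$ (i, l) = (\<Sum>k<n. X i k * y k) - (\<Sum>j<q. (\<Sum>m<n. X i m * V j m) * (\<Sum>k<n. W k j * y k))"
        unfolding entry using True by (simp only: if_True corr)
      show ?thesis
      proof (cases "l < r")
        case l: True
        thus ?thesis using * True il XU WU by (simp add: y_def)
      next
        case False
        hence l: "l - r < q" using il n by simp
        have "(\<Sum>j<q. (\<Sum>m<n. X i m * V j m) * (\<Sum>k<n. W k j * y k)) =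
            (\<Sum>j<q. if l - r = j then (\<Sum>m<n. X i m * V j m) else 0)"
          using False WV[OF l] by (intro sum.cong) (auto simp: y_def)
        also have "\<dots> = (\<Sum>m<n. X i m * V (l - r) m)" using l by simp
        finally show ?thesis using * False True il by (simp add: y_def)
      qed
    next
      case False
      hence i: "i - r < q" using il n by simp
      have "(Fi * F) $$ (i, l) = (\<Sum>k<n. W k (i - r) * y k)" unfolding entry using False by simp
      thus ?thesis
        using False i il n WU[OF _ i] WV[of "l - r", OF _ i] by (cases "l < r") (auto simp: y_def)
    qed
  qed (auto simp: F_def Fi_def)
  have car: "F \<in> carrier_mat n n" "Fi \<in> carrier_mat n n" by (simp_all add: F_def Fi_def)
  have "map_mat to_fract F * map_mat to_fract Fi = 1\<^sub>m n"
    by (rule mat_mult_left_right_inverse[OF _ _ hom_mult_eq_one(1)[OF left car(2,1)]]) (use car in auto)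
  hence "map_mat to_fract (F * Fi) = map_mat to_fract (1\<^sub>m n)"
    by (simp add: frac_hom.mat_hom_mult[OF car] frac_hom.mat_hom_one)
  thus "F * Fi = 1\<^sub>m n" by (rule frac_hom.mat_hom_inj)
qed

lemma splits_as_power_diag: "splits_as (power_diag \<alpha>) \<alpha>"
  unfolding splits_as_def
  by (intro exI[of _ "1\<^sub>m (length \<alpha>)"]) (simp add: frac_hom.mat_hom_one at_inverse_hom.mat_hom_one
        left_mult_one_mat[OF mat_diag_dim] right_mult_one_mat[OF mat_diag_dim])

lemma adapted_frameI:
  fixes F :: "'a::field poly mat"
  assumes F: "F \<in> carrier_mat n n" "Fi \<in> carrier_mat n n" "F * Fi = 1\<^sub>m n" "Fi * F = 1\<^sub>m n" and r: "r \<le> n"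
    and \<phi>: "\<And>x. \<phi> (pt x) = column_space (map_mat (\<lambda>p. poly p x) (first_columns r F))"
  shows "adapted_frame r n \<phi> pt F"
  unfolding adapted_frame_def
proof (intro conjI allI)
  fix x :: 'a
  let ?ev = "map_mat (\<lambda>p. poly p x)"
  have "?ev F * ?ev Fi = 1\<^sub>m n" "?ev Fi * ?ev F = 1\<^sub>m n"
    using F by (simp_all flip: eval_mat_mult[of _ n n _ n] add: eval_mat_one)
  thus "invertible_mat (?ev F)" by (intro invertible_matI[of _ n "?ev Fi"]) (use F in auto)
  have "mat_of_cols n (take r (cols (?ev F))) = ?ev (first_columns r F)"
    using F r by (subst first_columns_as_cols) (auto simp: first_columns_def intro!: eq_matI)
  moreover have "dim_row (first_columns r F) = n" using F by (simp add: first_columns_def)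
  ultimately show "column_space (mat_of_cols n (take r (cols (?ev F)))) = \<phi> (pt x)"
    using \<phi>[of x] by simp
qed (use F in simp)

text \<open>The map sends a point to the column space of \<open>U\<close> or \<open>U'\<close> there. Its Pluecker forms are the maximal minors of
  \<open>U\<close>, homogenized to degree \<open>sum_list a\<close>. In the adapted frames made from the forms \<open>W\<close> both
  transition matrices are diagonal.\<close>

lemma map_from_staircase:
  assumes st: "staircase TYPE('a::field) a b"
  obtains \<phi> :: "'a::field vec set \<Rightarrow> 'a vec set" where
    "\<phi> \<in> Mor (length a) (length a + length b) (sum_list a)"
    "universal_transitions (length a) (length a + length b) \<phi>
       (power_diag (map uminus (map int a))) (power_diag (map int b))"
proof -
  define r where "r = length a"
  define q where "q = length b"
  define n where "n = r + q"
  define e where "e = sum_list a"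
  obtain U U' X X' W W' V V' :: "nat \<Rightarrow> nat \<Rightarrow> 'a poly" where
    hu: "half_frame n a U U' X X'" and hw: "half_frame n b W' W V' V" and
    o: "\<forall>i<r. \<forall>j<q. (\<Sum>k<n. U k i * W k j) = 0" "\<forall>i<r. \<forall>j<q. (\<Sum>k<n. U' k i * W' k j) = 0"
    using st unfolding staircase_def n_def r_def q_def by (elim exE conjE)
  have XU: "(\<Sum>k<n. X i k * U k j) = (if i = j then 1 else 0)" "(\<Sum>k<n. X' i k * U' k j) = (if i = j then 1 else 0)"
    if "i < r" "j < r" for i j using hu that by (auto simp: half_frame_def r_def)
  have VW: "(\<Sum>k<n. V i k * W k j) = (if i = j then 1 else 0)" "(\<Sum>k<n. V' i k * W' k j) = (if i = j then 1 else 0)"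
    if "i < q" "j < q" for i j using hw that by (auto simp: half_frame_def q_def)
  have UW: "(\<Sum>k<n. U k i * W k j) = 0" "(\<Sum>k<n. U' k i * W' k j) = 0" if "i < r" "j < q" for i j
    using o that by auto
  have degU: "degree (U k i) \<le> a ! i" and U': "U' k i = reversal (a ! i) (U k i)" if "k < n" "i < r" for k i
    using hu that by (auto simp: half_frame_def r_def)
  have degW': "degree (W' k j) \<le> b ! j" and W: "W k j = reversal (b ! j) (W' k j)" if "k < n" "j < q" for k j
    using hw that by (auto simp: half_frame_def q_def)
  define F where "F = mat n n (\<lambda>(k, i). if i < r then U k i else V (i - r) k)"
  define F' where "F' = mat n n (\<lambda>(k, i). if i < r then U' k i else V' (i - r) k)"
  define Fi where "Fi = mat n n (\<lambda>(i, k). if i < r then X i k - (\<Sum>j<q. (\<Sum>m<n. X i m * V j m) * W k j) else W k (i - r))"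
  define Fi' where "Fi' = mat n n (\<lambda>(i, k). if i < r then X' i k - (\<Sum>j<q. (\<Sum>m<n. X' i m * V' j m) * W' k j) else W' k (i - r))"
  have F: "F \<in> carrier_mat n n" "Fi \<in> carrier_mat n n" "F * Fi = 1\<^sub>m n" "Fi * F = 1\<^sub>m n"
    using frame_completion[where r = r and n = n and q = q and X = X and U = U and V = V and W = W] XU(1) VW(1) UW(1) by (simp_all add: F_def Fi_def n_def)
  have F': "F' \<in> carrier_mat n n" "Fi' \<in> carrier_mat n n" "F' * Fi' = 1\<^sub>m n" "Fi' * F' = 1\<^sub>m n"
    using frame_completion[where r = r and n = n and q = q and X = X' and U = U' and V = V' and W = W'] XU(2) VW(2) UW(2) by (simp_all add: F'_def Fi'_def n_def)
  have r: "r \<le> n" by (simp add: n_def)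
  define Um where "Um = first_columns r F"
  define Um' where "Um' = first_columns r F'"
  have Um: "Um \<in> carrier_mat n r" "\<And>k i. k < n \<Longrightarrow> i < r \<Longrightarrow> Um $$ (k, i) = U k i"
    using r by (auto simp: Um_def first_columns_def F_def)
  have Um': "Um' \<in> carrier_mat n r" "\<And>k i. k < n \<Longrightarrow> i < r \<Longrightarrow> Um' $$ (k, i) = U' k i"
    using r by (auto simp: Um'_def first_columns_def F'_def)
  define \<phi> :: "'a vec set \<Rightarrow> 'a vec set" where "\<phi> = (\<lambda>Z\<in>grassmannian 1 2.
    if \<exists>x. Z = proj_point 1 x then column_space (map_mat (\<lambda>p. poly p (THE x. Z = proj_point 1 x)) Um)
    else column_space (map_mat (\<lambda>p. poly p 0) Um'))"
  have \<phi>1: "\<phi> (proj_point 1 x) = column_space (map_mat (\<lambda>p. poly p x) Um)" for x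
  proof -
    have "(THE y. proj_point 1 x = proj_point 1 y) = x"
      by (rule the_equality) (auto dest: proj_point_eqD)
    moreover have "\<exists>y. proj_point 1 x = proj_point 1 y" by blast
    moreover have "proj_point 1 x \<in> grassmannian 1 2" by (rule proj_point_in_grassmannian) simp
    ultimately show ?thesis unfolding \<phi>_def by simp
  qed
  have \<phi>0: "\<phi> (proj_point 0 1) = column_space (map_mat (\<lambda>p. poly p 0) Um')"
  proof -
    have "\<not> (\<exists>y. proj_point (0 :: 'a) 1 = proj_point 1 y)" using proj_point_0_1_neq by blast
    moreover have "proj_point (0 :: 'a) 1 \<in> grassmannian 1 2" by (rule proj_point_in_grassmannian) simp
    ultimately show ?thesis unfolding \<phi>_def by simp
  qed
  have \<phi>inf: "\<phi> (proj_point x 1) = column_space (map_mat (\<lambda>p. poly p x) Um')" for x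
  proof (cases "x = 0")
    case True
    thus ?thesis using \<phi>0 by simp
  next
    case False
    have "map_mat (\<lambda>p. poly p x) Um' = mat n r (\<lambda>(k, i). map_mat (\<lambda>p. poly p (inverse x)) Um $$ (k, i) * x ^ (a ! i))"
      using Um Um' U' degU False by (intro eq_matI) (auto simp: poly_reversal mult.commute)
    hence "column_space (map_mat (\<lambda>p. poly p x) Um') = column_space (map_mat (\<lambda>p. poly p (inverse x)) Um)"
      using column_space_scale[of "map_mat (\<lambda>p. poly p (inverse x)) Um" n r "\<lambda>i. x ^ (a ! i)"] Um False by simp
    moreover have "proj_point x 1 = proj_point 1 (inverse x)"
      using proj_point_scale[OF False, of 1 "inverse x"] False by simp
    ultimately show ?thesis using \<phi>1 by simp
  qed
  have linv: "\<exists>Y\<in>carrier_mat r n. Y * map_mat (\<lambda>p. poly p x) M = 1\<^sub>m r"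
    if M: "M \<in> carrier_mat n r" "\<And>i j. i < r \<Longrightarrow> j < r \<Longrightarrow> (\<Sum>k<n. Z i k * M $$ (k, j)) = (if i = j then 1 else 0)"
    for M :: "'a poly mat" and Z x
  proof (rule bexI[of _ "mat r n (\<lambda>(i, k). poly (Z i k) x)"])
    have "(\<Sum>k<n. poly (Z i k) x * poly (M $$ (k, j)) x) = (if i = j then 1 else 0)" if "i < r" "j < r" for i j
      using arg_cong[OF M(2)[OF that], of "\<lambda>p. poly p x"] by (simp add: poly_sum split: if_splits)
    thus "mat r n (\<lambda>(i, k). poly (Z i k) x) * map_mat (\<lambda>p. poly p x) M = 1\<^sub>m r"
      using M(1) by (intro eq_matI) (auto simp: scalar_prod_def lessThan_atLeast0)
  qed simp
  have gr: "column_space (map_mat (\<lambda>p. poly p x) Um) \<in> grassmannian r n"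
    "column_space (map_mat (\<lambda>p. poly p x) Um') \<in> grassmannian r n" for x
    using linv[OF Um(1), of X x] linv[OF Um'(1), of X' x] XU Um Um' column_space_in_grassmannian[of "map_mat (\<lambda>p. poly p x) Um" n r]
      column_space_in_grassmannian[of "map_mat (\<lambda>p. poly p x) Um'" n r] by auto
  have "\<phi> \<in> grassmannian 1 2 \<rightarrow>\<^sub>E grassmannian r n"
    using gr by (auto simp: \<phi>_def PiE_def)
  moreover have "\<exists>c. plucker_forms r n e \<phi> c"
  proof -
    define P where "P I = det (submatrix Um I UNIV)" for I
    define c where "c = (\<lambda>(I, k). if I \<subseteq> {..<n} \<and> card I = r \<and> k \<le> e then coeff (P I) k else 0)"
    have rP: "degree (P I) \<le> e" "det (submatrix Um' I UNIV) = reversal e (P I)"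
      if I: "I \<subseteq> {..<n}" "card I = r" for I
    proof -
      have "map_mat at_inverse_coord (submatrix Um' I UNIV) =
          map_mat to_fract (submatrix Um I UNIV) * mat_diag r (\<lambda>i. coord powi (- int (a ! i)))"
      proof -
        have "at_inverse_coord (Um' $$ (k, i)) = to_fract (Um $$ (k, i)) * coord powi (- int (a ! i))"
          if "k < n" "i < r" for k i
          using at_inverse_coord_reversal[OF degU[OF that]] Um(2)[OF that] Um'(2)[OF that] U'[OF that] by simp
        thus ?thesis
          using submatrix_rows[OF Um(1) I] submatrix_rows[OF Um'(1) I]
          by (subst mat_diag_mult_right[of _ r r]) (auto intro!: eq_matI)
      qed
      from arg_cong[OF this, of det]
      have "at_inverse_coord (det (submatrix Um' I UNIV)) = to_fract (P I) * (\<Prod>i<r. coord powi (- int (a ! i)))"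
        using submatrix_rows(1)[OF Um(1) I]
        by (simp add: at_inverse_hom.hom_det frac_hom.hom_det det_mult[of _ r] det_mat_diag P_def)
      also have "(\<Prod>i<r. (coord :: 'a poly fract) powi (- int (a ! i))) = coord powi (- int e)"
      proof -
        have "(\<Prod>i<m. (coord :: 'a poly fract) powi (- int (a ! i))) = coord powi (- int (\<Sum>i<m. a ! i))" for m
          by (induction m) (simp_all flip: power_int_add)
        thus ?thesis by (simp add: e_def r_def sum_list_sum_nth lessThan_atLeast0)
      qed
      finally have "to_fract (P I) * coord powi (- int e) = at_inverse_coord (det (submatrix Um' I UNIV))" ..
      thus "degree (P I) \<le> e" "det (submatrix Um' I UNIV) = reversal e (P I)"
        using at_inverse_coord_eqD by blast+
    qed
    have prod: "(\<Prod>i<r. s ^ (a ! i)) = s ^ e" for s :: 'a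
    proof -
      have "(\<Prod>i<m. s ^ (a ! i)) = s ^ (\<Sum>i<m. a ! i)" for m
        by (simp add: power_sum)
      thus ?thesis by (simp add: e_def r_def sum_list_sum_nth lessThan_atLeast0)
    qed
    have "\<exists>B\<in>carrier_mat n r. column_space B = \<phi> (proj_point s t) \<and>
        (\<forall>I. I \<subseteq> {..<n} \<and> card I = r \<longrightarrow> plucker B I = (\<Sum>k\<le>e. c (I, k) * s ^ (e - k) * t ^ k))"
      if st: "(s, t) \<noteq> (0, 0)" for s t
    proof (cases "s = 0")
      case False
      let ?B = "mat n r (\<lambda>(k, i). poly (Um $$ (k, i)) (t / s) * s ^ (a ! i))"
      show ?thesis
      proof (rule bexI[of _ ?B], intro conjI allI impI)
        have "?B = mat n r (\<lambda>(k, i). map_mat (\<lambda>p. poly p (t / s)) Um $$ (k, i) * s ^ (a ! i))"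
          using Um by (intro eq_matI) auto
        hence "column_space ?B = column_space (map_mat (\<lambda>p. poly p (t / s)) Um)"
          using column_space_scale[of "map_mat (\<lambda>p. poly p (t / s)) Um" n r "\<lambda>i. s ^ (a ! i)"] Um False by simp
        moreover have "proj_point s t = proj_point 1 (t / s)"
          using proj_point_scale[OF False, of 1 "t / s"] False by simp
        ultimately show "column_space ?B = \<phi> (proj_point s t)" using \<phi>1 by simp
        fix I assume I: "I \<subseteq> {..<n} \<and> card I = r"
        have "plucker ?B I = poly (P I) (t / s) * s ^ e"
          using plucker_scaled_evaluation[OF Um(1), of I "t / s" "\<lambda>i. s ^ (a ! i)"] I by (simp add: prod P_def)
        also have "poly (P I) (t / s) = (\<Sum>k\<le>e. coeff (P I) k * (t / s) ^ k)"
          using rP(1)[of I] I by (subst poly_as_monom_sum[of "P I" e]) (simp_all add: poly_sum poly_monom)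
        also have "\<dots> * s ^ e = (\<Sum>k\<le>e. c (I, k) * s ^ (e - k) * t ^ k)"
          unfolding sum_distrib_right using I False
          by (intro sum.cong) (auto simp: c_def power_diff power_divide)
        finally show "plucker ?B I = (\<Sum>k\<le>e. c (I, k) * s ^ (e - k) * t ^ k)" .
      qed simp
    next
      case True
      hence t: "t \<noteq> 0" using st by simp
      let ?B = "mat n r (\<lambda>(k, i). poly (Um' $$ (k, i)) 0 * t ^ (a ! i))"
      show ?thesis
      proof (rule bexI[of _ ?B], intro conjI allI impI)
        have "?B = mat n r (\<lambda>(k, i). map_mat (\<lambda>p. poly p 0) Um' $$ (k, i) * t ^ (a ! i))"
          using Um' by (intro eq_matI) auto
        hence "column_space ?B = column_space (map_mat (\<lambda>p. poly p 0) Um')"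
          using column_space_scale[of "map_mat (\<lambda>p. poly p 0) Um'" n r "\<lambda>i. t ^ (a ! i)"] Um' t by simp
        moreover have "proj_point s t = proj_point 0 1"
          using proj_point_scale[OF t, of 0 1] True by simp
        ultimately show "column_space ?B = \<phi> (proj_point s t)" using \<phi>0 by simp
        fix I assume I: "I \<subseteq> {..<n} \<and> card I = r"
        have "plucker ?B I = coeff (P I) e * t ^ e"
          using plucker_scaled_evaluation[OF Um'(1), of I 0 "\<lambda>i. t ^ (a ! i)"] I rP(2)[of I]
          by (simp add: prod poly_reversal_0)
        also have "\<dots> = (\<Sum>k\<le>e. if k = e then c (I, k) * t ^ k else 0)"
          using I by (simp add: c_def)
        also have "\<dots> = (\<Sum>k\<le>e. c (I, k) * s ^ (e - k) * t ^ k)"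
          using True by (intro sum.cong) auto
        finally show "plucker ?B I = (\<Sum>k\<le>e. c (I, k) * s ^ (e - k) * t ^ k)" .
      qed simp
    qed
    hence "plucker_forms r n e \<phi> c"
      unfolding plucker_forms_def by (auto simp: c_def split: if_splits)
    thus ?thesis by blast
  qed
  ultimately have "\<phi> \<in> Mor r n e" by (simp add: Mor_def)
  moreover have "universal_transitions r n \<phi> (power_diag (map uminus (map int a))) (power_diag (map int b))"
  proof -
    let ?f = "map_mat (to_fract :: 'a poly \<Rightarrow> _)" and ?a = "map_mat (at_inverse_coord :: 'a poly \<Rightarrow> _)"
    let ?g = "power_diag (map uminus (map int a)) :: 'a poly fract mat"
    let ?h = "power_diag (map int b) :: 'a poly fract mat"
    define G where "G = ?f Fi * ?a F'"
    have c: "?f F \<in> carrier_mat n n" "?f Fi \<in> carrier_mat n n" "?a F' \<in> carrier_mat n n" using F F' by auto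
    have Gc: "G \<in> carrier_mat n n" using c by (simp add: G_def)
    have FG: "?a F' = ?f F * G"
      unfolding G_def using mult_mat_cancel_left[OF hom_mult_eq_one(1)[OF F(3,1,2)] c(1,2,3)] by simp
    have Gsum: "G $$ (i, l) = (\<Sum>k<n. to_fract (Fi $$ (i, k)) * at_inverse_coord (F' $$ (k, l)))"
      if "i < n" "l < n" for i l
      using that F F' by (simp add: G_def scalar_prod_def lessThan_atLeast0)
    have Gleft: "G $$ (i, l) = (if i = l then coord powi (- int (a ! l)) else 0)" if i: "i < n" and l: "l < r" for i l
    proof -
      have "G $$ (i, l) = (\<Sum>k<n. to_fract (Fi $$ (i, k) * F $$ (k, l)) * coord powi (- int (a ! l)))"
        unfolding Gsum[OF i order_less_le_trans[OF l r]]
      proof (intro sum.cong refl)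
        fix k assume "k \<in> {..<n}"
        hence k: "k < n" by simp
        have "F' $$ (k, l) = reversal (a ! l) (F $$ (k, l))" "degree (F $$ (k, l)) \<le> a ! l"
          using k l r U'[OF k l] degU[OF k l] by (simp_all add: F_def F'_def)
        thus "to_fract (Fi $$ (i, k)) * at_inverse_coord (F' $$ (k, l)) =
          to_fract (Fi $$ (i, k) * F $$ (k, l)) * coord powi (- int (a ! l))"
          by (simp add: at_inverse_coord_reversal mult.assoc)
      qed
      also have "\<dots> = to_fract (\<Sum>k<n. Fi $$ (i, k) * F $$ (k, l)) * coord powi (- int (a ! l))"
        by (simp only: to_fract_sum sum_distrib_right)
      also have "\<dots> = (if i = l then coord powi (- int (a ! l)) else 0)"
        using mat_mult_entry[OF F(4,2,1) i, of l] l r i by simp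
      finally show ?thesis .
    qed
    have Gright: "G $$ (j + r, l + r) = (if j = l then coord powi (int (b ! j)) else 0)" if j: "j < q" and l: "l < q" for j l
    proof -
      have jl: "j + r < n" "l + r < n" using j l by (auto simp: n_def)
      have "G $$ (j + r, l + r) = (\<Sum>k<n. at_inverse_coord (V' l k * W' k j) * coord ^ (b ! j))"
        unfolding Gsum[OF jl]
      proof (intro sum.cong refl)
        fix k assume "k \<in> {..<n}"
        hence k: "k < n" by simp
        have "to_fract (Fi $$ (j + r, k)) = at_inverse_coord (W' k j) * coord ^ (b ! j)"
          using k jl W[OF k j] to_fract_reversal[OF degW'[OF k j]] by (simp add: Fi_def)
        moreover have "F' $$ (k, l + r) = V' l k" using k jl by (simp add: F'_def)
        ultimately show "to_fract (Fi $$ (j + r, k)) * at_inverse_coord (F' $$ (k, l + r)) =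
            at_inverse_coord (V' l k * W' k j) * coord ^ (b ! j)"
          by (simp add: at_inverse_hom.hom_mult mult_ac)
      qed
      also have "\<dots> = at_inverse_coord (\<Sum>k<n. V' l k * W' k j) * coord ^ (b ! j)"
        by (simp only: at_inverse_coord_sum sum_distrib_right)
      also have "\<dots> = (if j = l then coord powi (int (b ! j)) else 0)"
        using VW(2)[OF l j] by (simp add: at_inverse_hom.hom_one)
      finally show ?thesis .
    qed
    define K where "K = mat r q (\<lambda>(i, j). G $$ (i, j + r))"
    have gc: "?g \<in> carrier_mat r r" "?h \<in> carrier_mat q q"
      using mat_diag_dim[of r] mat_diag_dim[of q] by (simp_all add: r_def q_def)
    have "G = four_block_mat ?g K (0\<^sub>m q r) ?h"
    proof (rule eq_matI)
      fix i l assume "i < dim_row (four_block_mat ?g K (0\<^sub>m q r) ?h)" "l < dim_col (four_block_mat ?g K (0\<^sub>m q r) ?h)"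
      hence il: "i < r + q" "l < r + q" using gc by auto
      have right: "G $$ (i, l) = (if i = l then coord powi (int (b ! (i - r))) else 0)" if "\<not> i < r" "\<not> l < r"
        using Gright[of "i - r" "l - r"] il that by (auto simp: n_def)
      show "G $$ (i, l) = four_block_mat ?g K (0\<^sub>m q r) ?h $$ (i, l)"
        using il gc Gleft[of i l] right
        by (subst index_mat_four_block) (auto simp: K_def mat_diag_def r_def q_def n_def)
    qed (use Gc gc in \<open>auto simp: n_def\<close>)
    hence "?a F' = ?f F * four_block_mat ?g K (0\<^sub>m (n - r) r) ?h" using FG by (simp add: n_def)
    moreover have "adapted_frame r n \<phi> (\<lambda>x. proj_point 1 x) F"
      by (rule adapted_frameI[OF F r]) (use \<phi>1 in \<open>simp add: Um_def\<close>)
    moreover have "adapted_frame r n \<phi> (\<lambda>x. proj_point x 1) F'"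
      by (rule adapted_frameI[OF F' r]) (use \<phi>inf in \<open>simp add: Um'_def\<close>)
    moreover have "K \<in> carrier_mat r (n - r)" by (simp add: K_def n_def)
    moreover have "n - r = q" by (simp add: n_def)
    ultimately show ?thesis
      unfolding universal_transitions_def using gc by blast
  qed
  ultimately show ?thesis using that by (simp add: r_def q_def n_def e_def)
qed

section \<open>Irreducible components\<close>

lemma irreducible_subspace_iff:
  assumes Z: "Z \<subseteq> topspace X"
  shows "irreducible_space (subtopology X Z) \<longleftrightarrow> Z \<noteq> {} \<and>
    (\<forall>U V. openin X U \<and> openin X V \<and> U \<inter> Z \<noteq> {} \<and> V \<inter> Z \<noteq> {} \<longrightarrow> U \<inter> V \<inter> Z \<noteq> {})"
proof -
  have top: "topspace (subtopology X Z) = Z" using Z by (simp add: Int_absorb1)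
  show ?thesis
  proof
    assume irr: "irreducible_space (subtopology X Z)"
    have "U \<inter> V \<inter> Z \<noteq> {}" if U: "openin X U" "U \<inter> Z \<noteq> {}" and V: "openin X V" "V \<inter> Z \<noteq> {}" for U V
    proof
      assume empty: "U \<inter> V \<inter> Z = {}"
      have "closedin (subtopology X Z) ((topspace X - U) \<inter> Z)" "closedin (subtopology X Z) ((topspace X - V) \<inter> Z)"
        using U V by (auto simp: closedin_subtopology)
      moreover have "(topspace X - U) \<inter> Z \<union> (topspace X - V) \<inter> Z = Z" using empty Z by blast
      ultimately have "(topspace X - U) \<inter> Z = Z \<or> (topspace X - V) \<inter> Z = Z"
        using irr unfolding irreducible_space_def top by blast
      thus False using U V by blast
    qed
    moreover have "Z \<noteq> {}" using irr unfolding irreducible_space_def top by blast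
    ultimately show "Z \<noteq> {} \<and> (\<forall>U V. openin X U \<and> openin X V \<and> U \<inter> Z \<noteq> {} \<and> V \<inter> Z \<noteq> {} \<longrightarrow> U \<inter> V \<inter> Z \<noteq> {})"
      by blast
  next
    assume *: "Z \<noteq> {} \<and> (\<forall>U V. openin X U \<and> openin X V \<and> U \<inter> Z \<noteq> {} \<and> V \<inter> Z \<noteq> {} \<longrightarrow> U \<inter> V \<inter> Z \<noteq> {})"
    have "C = Z \<or> D = Z" if C: "closedin (subtopology X Z) C" and D: "closedin (subtopology X Z) D"
      and un: "C \<union> D = Z" for C D
    proof (rule ccontr)
      assume ne: "\<not> (C = Z \<or> D = Z)"
      obtain S T where S: "closedin X S" "C = S \<inter> Z" and T: "closedin X T" "D = T \<inter> Z"
        using C D by (auto simp: closedin_subtopology)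
      have "openin X (topspace X - S)" "openin X (topspace X - T)" using S T by auto
      moreover have "(topspace X - S) \<inter> Z \<noteq> {}" "(topspace X - T) \<inter> Z \<noteq> {}" using ne S T Z by blast+
      ultimately have "(topspace X - S) \<inter> (topspace X - T) \<inter> Z \<noteq> {}" using * by blast
      thus False using S T un by blast
    qed
    thus "irreducible_space (subtopology X Z)" unfolding irreducible_space_def top using * by blast
  qed
qed

text \<open>The union of a chain of irreducible sets is irreducible, so Zorn's lemma applies to the irreducible
  sets that contain the point.\<close>

lemma irreducible_component_through_point:
  assumes x: "x \<in> topspace X"
  shows "\<exists>Z\<in>irreducible_components X. x \<in> Z"
proof -
  define \<A> where "\<A> = {Z. Z \<subseteq> topspace X \<and> x \<in> Z \<and> irreducible_space (subtopology X Z)}"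
  have sing: "{x} \<in> \<A>"
    using x by (auto simp: \<A>_def irreducible_subspace_iff)
  have "\<exists>M\<in>\<A>. \<forall>Z\<in>\<A>. M \<subseteq> Z \<longrightarrow> Z = M"
  proof (rule subset_Zorn_nonempty)
    fix \<C> assume ne: "\<C> \<noteq> {}" and chain: "subset.chain \<A> \<C>"
    have C: "\<C> \<subseteq> \<A>" and lin: "\<And>A B. A \<in> \<C> \<Longrightarrow> B \<in> \<C> \<Longrightarrow> A \<subseteq> B \<or> B \<subseteq> A"
      using chain by (auto simp: subset_chain_def)
    have sub: "\<Union>\<C> \<subseteq> topspace X" and xC: "x \<in> \<Union>\<C>" using C ne by (auto simp: \<A>_def)
    have "U \<inter> V \<inter> \<Union>\<C> \<noteq> {}" if U: "openin X U" "U \<inter> \<Union>\<C> \<noteq> {}" and V: "openin X V" "V \<inter> \<Union>\<C> \<noteq> {}" for U V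
    proof -
      obtain A B where AB: "A \<in> \<C>" "U \<inter> A \<noteq> {}" "B \<in> \<C>" "V \<inter> B \<noteq> {}" using U V by blast
      define D where "D = (if A \<subseteq> B then B else A)"
      have D: "D \<in> \<C>" "U \<inter> D \<noteq> {}" "V \<inter> D \<noteq> {}" using AB lin[OF AB(1,3)] by (auto simp: D_def)
      hence "D \<subseteq> topspace X" "irreducible_space (subtopology X D)" using C by (auto simp: \<A>_def)
      hence "U \<inter> V \<inter> D \<noteq> {}" using irreducible_subspace_iff[of D X] D U V by blast
      thus ?thesis using D(1) by blast
    qed
    hence "irreducible_space (subtopology X (\<Union>\<C>))"
      unfolding irreducible_subspace_iff[OF sub] using xC by blast
    thus "\<Union>\<C> \<in> \<A>" using sub xC by (simp add: \<A>_def)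
  qed (use sing in blast)
  then obtain M where M: "M \<in> \<A>" "\<And>Z. Z \<in> \<A> \<Longrightarrow> M \<subseteq> Z \<Longrightarrow> Z = M" by blast
  have "M \<in> irreducible_components X"
    using M by (auto simp: irreducible_components_def \<A>_def)
  thus ?thesis using M(1) by (auto simp: \<A>_def)
qed

section \<open>Splitting types on an irreducible set of maps\<close>

lemma openin_principal:
  "homogeneous F \<Longrightarrow> openin (Mor_topology r n e) {\<phi> \<in> Mor r n e. \<exists>c. plucker_forms r n e \<phi> c \<and> mpoly_eval c F \<noteq> 0}"
  unfolding Mor_topology_def by (rule topology_generated_by_Basis) blast

lemma topspace_Mor_topology: "topspace (Mor_topology r n e) = Mor r n e"
proof -
  define F :: "((nat set \<times> nat \<Rightarrow>\<^sub>0 nat) \<Rightarrow>\<^sub>0 'a)" where "F = Poly_Mapping.single 0 1"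
  have "homogeneous F" by (simp add: homogeneous_def F_def)
  from openin_subset[OF openin_principal[OF this, of r n e]]
  have "{\<phi> \<in> Mor r n e. \<exists>c. plucker_forms r n e \<phi> c \<and> mpoly_eval c F \<noteq> 0} \<subseteq> topspace (Mor_topology r n e)" .
  moreover have "mpoly_eval c F = 1" for c unfolding F_def mpoly_eval_single by (simp add: monomial_eval_def)
  ultimately have "Mor r n e \<subseteq> topspace (Mor_topology r n e :: ('a vec set \<Rightarrow> 'a vec set) topology)"
    by (auto simp: Mor_def)
  thus ?thesis unfolding Mor_topology_def topology_generated_by_topspace by auto
qed

lemma topspace_tangent_locus_topology:
  "topspace (tangent_locus_topology r n e M) = tangent_locus r n e M"
  by (auto simp: tangent_locus_topology_def topspace_Mor_topology tangent_locus_def)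

lemma tangent_locus_framed:
  fixes \<phi> :: "'a::{alg_closed_field, field_char_0} vec set \<Rightarrow> 'a vec set"
  assumes "\<phi> \<in> tangent_locus r n e M" and r: "r \<le> n"
  shows "framed r n \<phi>"
proof -
  obtain g h where ut: "universal_transitions r n \<phi> g h"
    using assms(1) by (auto simp: tangent_locus_def tangent_splitting_type_def)
  obtain U U' where cp: "chart_pair n r U U' g"
    and \<phi>: "\<And>x. \<phi> (proj_point 1 x) = column_space (map_mat (\<lambda>p. poly p x) U)"
    using universal_chart_pairs[OF ut r] by metis
  obtain Y where U: "U \<in> carrier_mat n r" and Y: "Y \<in> carrier_mat r n" "Y * U = 1\<^sub>m r"
    using cp unfolding chart_pair_def by blast
  show ?thesis
    unfolding framed_def
  proof
    fix x :: 'a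
    let ?ev = "map_mat (\<lambda>p. poly p x)"
    have "?ev Y * ?ev U = 1\<^sub>m r" using Y U by (simp flip: eval_mat_mult[of _ r n _ r] add: eval_mat_one)
    thus "\<exists>A\<in>carrier_mat n r. (\<exists>Y\<in>carrier_mat r n. Y * A = 1\<^sub>m r) \<and> \<phi> (proj_point 1 x) = column_space A"
      using \<phi>[of x] U Y by (intro bexI[of _ "?ev U"] conjI bexI[of _ "?ev Y"]) auto
  qed
qed

lemma sections_semicontinuous:
  fixes \<phi>0 :: "'a::{alg_closed_field, field_char_0} vec set \<Rightarrow> 'a vec set"
  assumes r: "0 < r" "r \<le> n" and \<phi>0: "\<phi>0 \<in> tangent_locus r n e M"
  shows "\<exists>U. openin (Mor_topology r n e) U \<and> \<phi>0 \<in> U \<and> (\<forall>\<phi>\<in>U \<inter> tangent_locus r n e M. \<forall>m\<le>N.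
    pv.dim (sub_sections n \<phi> m) \<le> pv.dim (sub_sections n \<phi>0 m) \<and>
    pv.dim (conormal_sections n \<phi> m) \<le> pv.dim (conormal_sections n \<phi>0 m))"
proof -
  have Mor: "\<phi>0 \<in> Mor r n e" using \<phi>0 by (simp add: tangent_locus_def)
  then obtain c0 where c0: "plucker_forms r n e \<phi>0 c0" by (auto simp: Mor_def)
  note fr = tangent_locus_framed[OF \<phi>0 r(2)]
  have one: "\<exists>U. openin (Mor_topology r n e) U \<and> \<phi>0 \<in> U \<and> (\<forall>\<phi>\<in>U \<inter> tangent_locus r n e M.
      pv.dim (sub_sections n \<phi> m) \<le> pv.dim (sub_sections n \<phi>0 m) \<and>
      pv.dim (conormal_sections n \<phi> m) \<le> pv.dim (conormal_sections n \<phi>0 m))" for m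
  proof -
    obtain F where F: "homogeneous F" "mpoly_eval c0 F \<noteq> 0"
      "\<And>\<phi> c. framed r n \<phi> \<Longrightarrow> plucker_forms r n e \<phi> c \<Longrightarrow> mpoly_eval c F \<noteq> 0 \<Longrightarrow>
        pv.dim (sub_sections n \<phi> m) \<le> pv.dim (sub_sections n \<phi>0 m)"
      using sub_sections_semicontinuous[OF r(2) fr c0] by metis
    obtain G where G: "homogeneous G" "mpoly_eval c0 G \<noteq> 0"
      "\<And>\<phi> c. framed r n \<phi> \<Longrightarrow> plucker_forms r n e \<phi> c \<Longrightarrow> mpoly_eval c G \<noteq> 0 \<Longrightarrow>
        pv.dim (conormal_sections n \<phi> m) \<le> pv.dim (conormal_sections n \<phi>0 m)"
      using conormal_sections_semicontinuous[OF r fr c0] by metis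
    define P where "P H = {\<phi> \<in> Mor r n e. \<exists>c. plucker_forms r n e \<phi> c \<and> mpoly_eval c H \<noteq> 0}"
      for H :: "(nat set \<times> nat \<Rightarrow>\<^sub>0 nat) \<Rightarrow>\<^sub>0 'a"
    have "openin (Mor_topology r n e) (P F \<inter> P G)"
      unfolding P_def by (intro openin_Int openin_principal F G)
    moreover have "\<phi>0 \<in> P F \<inter> P G" using Mor c0 F(2) G(2) by (auto simp: P_def)
    moreover have "pv.dim (sub_sections n \<phi> m) \<le> pv.dim (sub_sections n \<phi>0 m) \<and>
      pv.dim (conormal_sections n \<phi> m) \<le> pv.dim (conormal_sections n \<phi>0 m)"
      if "\<phi> \<in> P F \<inter> P G \<inter> tangent_locus r n e M" for \<phi>
      using that tangent_locus_framed[OF _ r(2), of \<phi> e M] F(3) G(3) by (auto simp: P_def)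
    ultimately show ?thesis by (intro exI[of _ "P F \<inter> P G"]) blast
  qed
  show ?thesis
  proof (induction N)
    case 0
    show ?case using one[of 0] by simp
  next
    case (Suc N)
    then obtain U where U: "openin (Mor_topology r n e) U" "\<phi>0 \<in> U" "\<forall>\<phi>\<in>U \<inter> tangent_locus r n e M. \<forall>m\<le>N.
        pv.dim (sub_sections n \<phi> m) \<le> pv.dim (sub_sections n \<phi>0 m) \<and>
        pv.dim (conormal_sections n \<phi> m) \<le> pv.dim (conormal_sections n \<phi>0 m)" by blast
    obtain V where V: "openin (Mor_topology r n e) V" "\<phi>0 \<in> V" "\<forall>\<phi>\<in>V \<inter> tangent_locus r n e M.
        pv.dim (sub_sections n \<phi> (Suc N)) \<le> pv.dim (sub_sections n \<phi>0 (Suc N)) \<and>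
        pv.dim (conormal_sections n \<phi> (Suc N)) \<le> pv.dim (conormal_sections n \<phi>0 (Suc N))"
      using one[of "Suc N"] by blast
    show ?case using U V by (intro exI[of _ "U \<inter> V"]) (auto simp: le_Suc_eq)
  qed
qed

lemma sum_section_dims:
  assumes "0 \<le> x"
  shows "2 * (\<Sum>m\<le>N. int (nat (int m + 1 - x))) =
    (if x \<le> int N + 1 then (int N + 1 - x) * (int N + 2 - x) else 0)"
proof (induction N)
  case 0
  consider "x = 0" | "x = 1" | "x \<ge> 2" using assms by linarith
  thus ?case by cases auto
next
  case (Suc N)
  consider "x \<le> int N + 1" | "x = int N + 2" | "x > int N + 2" by linarith
  thus ?case
  proof cases
    case 1
    thus ?thesis using Suc by (simp add: distrib_left) (simp add: algebra_simps)
  qed (use Suc in auto)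
qed

lemma tensor_exponents_sums:
  fixes \<alpha> \<beta> :: "int list"
  shows "sum_mset (mset (tensor_exponents \<alpha> \<beta>)) = int (length \<beta>) * sum_list \<alpha> + int (length \<alpha>) * sum_list \<beta>"
    and "sum_mset (image_mset (\<lambda>x. x\<^sup>2) (mset (tensor_exponents \<alpha> \<beta>))) =
      int (length \<beta>) * (\<Sum>x\<leftarrow>\<alpha>. x\<^sup>2) + int (length \<alpha>) * (\<Sum>x\<leftarrow>\<beta>. x\<^sup>2) + 2 * sum_list \<alpha> * sum_list \<beta>"
proof -
  have prod: "sum_mset (image_mset f (mset (tensor_exponents \<alpha> \<beta>))) =
      (\<Sum>i<length \<alpha>. \<Sum>j<length \<beta>. f (\<alpha> ! i + \<beta> ! j))" for f :: "int \<Rightarrow> int"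
    unfolding mset_tensor_exponents
    by (simp add: multiset.map_comp o_def case_prod_unfold sum_unfold_sum_mset[symmetric] sum.cartesian_product)
  have sl: "sum_list (map f xs) = (\<Sum>i<length xs. f (xs ! i))" for f :: "int \<Rightarrow> int" and xs
    by (simp add: sum_list_sum_nth lessThan_atLeast0)
  show "sum_mset (mset (tensor_exponents \<alpha> \<beta>)) = int (length \<beta>) * sum_list \<alpha> + int (length \<alpha>) * sum_list \<beta>"
    using prod[of "\<lambda>x. x"] sl[of "\<lambda>x. x" \<alpha>] sl[of "\<lambda>x. x" \<beta>]
    by (simp add: sum.distrib sum_distrib_left)
  have "(\<Sum>i<length \<alpha>. \<Sum>j<length \<beta>. (\<alpha> ! i + \<beta> ! j)\<^sup>2) =
      (\<Sum>i<length \<alpha>. int (length \<beta>) * (\<alpha> ! i)\<^sup>2 + (\<Sum>j<length \<beta>. (\<beta> ! j)\<^sup>2) + 2 * (\<alpha> ! i) * (\<Sum>j<length \<beta>. \<beta> ! j))"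
    by (simp add: power2_sum sum.distrib sum_distrib_left)
  also have "\<dots> = int (length \<beta>) * (\<Sum>i<length \<alpha>. (\<alpha> ! i)\<^sup>2) + int (length \<alpha>) * (\<Sum>j<length \<beta>. (\<beta> ! j)\<^sup>2) +
      2 * (\<Sum>i<length \<alpha>. \<alpha> ! i) * (\<Sum>j<length \<beta>. \<beta> ! j)"
    by (simp add: sum.distrib sum_distrib_left sum_distrib_right) (rule sum.swap)
  finally show "sum_mset (image_mset (\<lambda>x. x\<^sup>2) (mset (tensor_exponents \<alpha> \<beta>))) =
      int (length \<beta>) * (\<Sum>x\<leftarrow>\<alpha>. x\<^sup>2) + int (length \<alpha>) * (\<Sum>x\<leftarrow>\<beta>. x\<^sup>2) + 2 * sum_list \<alpha> * sum_list \<beta>"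
    using prod[of "\<lambda>x. x\<^sup>2"] sl[of "\<lambda>x. x\<^sup>2" \<alpha>] sl[of "\<lambda>x. x\<^sup>2" \<beta>] sl[of "\<lambda>x. x" \<alpha>] sl[of "\<lambda>x. x" \<beta>]
    by simp
qed

text \<open>Summed over all twists up to a large \<open>N\<close>, the dimensions contribute a quadratic polynomial in each exponent.
  With the weights \<open>n - r\<close> and \<open>r\<close> the squares combine to \<open>\<Sum>(\<alpha>\<^sub>i + \<beta>\<^sub>j)\<^sup>2 - 2 (\<Sum>\<alpha>\<^sub>i) (\<Sum>\<beta>\<^sub>j)\<close>, and both sums of
  exponents are \<open>s = sum_mset M / n\<close>. So the result depends on the tangent bundle only.\<close>

lemma weighted_section_dims:
  fixes \<phi> :: "'a::{alg_closed_field, field_char_0} vec set \<Rightarrow> 'a vec set"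
  assumes T: "tangent_splitting_type r n \<phi> M" and r: "0 < r" "r \<le> n" and N: "nat (sum_mset M) \<le> N"
  shows "\<exists>s. int n * s = sum_mset M \<and>
    2 * (\<Sum>m\<le>N. int (n - r) * int (pv.dim (sub_sections n \<phi> m)) + int r * int (pv.dim (conormal_sections n \<phi> m))) =
    sum_mset (image_mset (\<lambda>x. x\<^sup>2) M) - 2 * s\<^sup>2 - (2 * int N + 3) * sum_mset M +
      2 * int r * int (n - r) * (int N + 1) * (int N + 2)"
proof -
  obtain \<alpha> \<beta> where len: "length \<alpha> = r" "length \<beta> = n - r" and M: "M = mset (tensor_exponents \<alpha> \<beta>)"
    and nn: "\<forall>x\<in>set \<alpha>. 0 \<le> x" "\<forall>x\<in>set \<beta>. 0 \<le> x" and s: "sum_list \<alpha> = sum_list \<beta>"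
    and dims: "\<And>m. pv.dim (sub_sections n \<phi> m) = (\<Sum>x\<leftarrow>\<alpha>. nat (int m + 1 - x))"
      "\<And>m. pv.dim (conormal_sections n \<phi> m) = (\<Sum>x\<leftarrow>\<beta>. nat (int m + 1 - x))"
    using tangent_splitting_typeE[OF T r(2)] by metis
  have nr: "int (n - r) + int r = int n" using r by simp
  have S1: "sum_mset M = int n * sum_list \<alpha>"
    unfolding M tensor_exponents_sums len using s nr by (metis distrib_right)
  have "sum_list \<alpha> \<ge> 0" using nn(1) by (induction \<alpha>) auto
  hence "sum_list \<alpha> \<le> int n * sum_list \<alpha>" using r by (simp add: mult_le_cancel_right1)
  hence sN: "sum_list \<alpha> \<le> int N" using N S1 by linarith
  have le: "x \<le> sum_list l" if "x \<in> set l" "\<forall>x\<in>set l. 0 \<le> x" for x and l :: "int list"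
    using that
  proof (induction l)
    case (Cons y l)
    have "0 \<le> sum_list l" using Cons.prems(2) by (induction l) auto
    thus ?case using Cons by auto
  qed simp
  have sumd: "2 * (\<Sum>m\<le>N. int (\<Sum>x\<leftarrow>l. nat (int m + 1 - x))) =
      (\<Sum>x\<leftarrow>l. x\<^sup>2) - (2 * int N + 3) * sum_list l + int (length l) * (int N + 1) * (int N + 2)"
    if "\<forall>x\<in>set l. 0 \<le> x \<and> x \<le> int N" for l
    using that
  proof (induction l)
    case (Cons x l)
    have x: "2 * (\<Sum>m\<le>N. int (nat (int m + 1 - x))) = x\<^sup>2 - (2 * int N + 3) * x + (int N + 1) * (int N + 2)"
      using Cons.prems sum_section_dims[of x N] by (simp add: power2_eq_square algebra_simps)
    have "2 * (\<Sum>m\<le>N. int (\<Sum>y\<leftarrow>x # l. nat (int m + 1 - y))) =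
        2 * (\<Sum>m\<le>N. int (nat (int m + 1 - x))) + 2 * (\<Sum>m\<le>N. int (\<Sum>y\<leftarrow>l. nat (int m + 1 - y)))"
      by (simp add: sum.distrib distrib_left)
    also have "\<dots> = x\<^sup>2 - (2 * int N + 3) * x + (int N + 1) * (int N + 2) +
        ((\<Sum>x\<leftarrow>l. x\<^sup>2) - (2 * int N + 3) * sum_list l + int (length l) * (int N + 1) * (int N + 2))"
      unfolding x using Cons by simp
    finally show ?case by (simp add: algebra_simps)
  qed simp
  have bound: "\<forall>x\<in>set \<alpha>. 0 \<le> x \<and> x \<le> int N" "\<forall>x\<in>set \<beta>. 0 \<le> x \<and> x \<le> int N"
    using le[of _ \<alpha>] le[of _ \<beta>] nn s sN by force+
  have "2 * (\<Sum>m\<le>N. int (n - r) * int (pv.dim (sub_sections n \<phi> m)) + int r * int (pv.dim (conormal_sections n \<phi> m))) =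
      int (n - r) * (2 * (\<Sum>m\<le>N. int (\<Sum>x\<leftarrow>\<alpha>. nat (int m + 1 - x)))) +
      int r * (2 * (\<Sum>m\<le>N. int (\<Sum>x\<leftarrow>\<beta>. nat (int m + 1 - x))))"
    unfolding dims by (simp add: sum.distrib sum_distrib_left distrib_left mult.left_commute)
  also have "\<dots> = sum_mset (image_mset (\<lambda>x. x\<^sup>2) M) - 2 * (sum_list \<alpha>)\<^sup>2 - (2 * int N + 3) * sum_mset M +
      2 * int r * int (n - r) * (int N + 1) * (int N + 2)"
    unfolding sumd[OF bound(1)] sumd[OF bound(2)] M tensor_exponents_sums len s[symmetric]
    by (simp add: algebra_simps power2_eq_square)
  finally show ?thesis using S1 by (intro exI[of _ "sum_list \<alpha>"]) simp
qed

text \<open>Near each point no dimension is larger than at that point, but a positive combination of the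
  dimensions is constant. So at a point near both of two given points all dimensions agree with
  those at either of them.\<close>

lemma section_dims_constant:
  fixes \<phi>1 \<phi>2 :: "'a::{alg_closed_field, field_char_0} vec set \<Rightarrow> 'a vec set"
  assumes r: "0 < r" "r < n" and Z: "Z \<subseteq> tangent_locus r n e M"
    and irr: "irreducible_space (subtopology (tangent_locus_topology r n e M) Z)"
    and \<phi>: "\<phi>1 \<in> Z" "\<phi>2 \<in> Z"
  shows "pv.dim (sub_sections n \<phi>1 m) = pv.dim (sub_sections n \<phi>2 m)"
    "pv.dim (conormal_sections n \<phi>1 m) = pv.dim (conormal_sections n \<phi>2 m)"
proof -
  let ?X = "tangent_locus_topology r n e M :: ('a vec set \<Rightarrow> 'a vec set) topology"
  let ?L = "tangent_locus r n e M :: ('a vec set \<Rightarrow> 'a vec set) set"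
  \<comment> \<open>All exponents are at most \<open>N\<close>, since they are nonnegative and their sum is at most \<open>sum_mset M\<close>.\<close>
  define N where "N = max m (nat (sum_mset M))"
  define S where "S \<psi> k = pv.dim (sub_sections n \<psi> k)" for \<psi> :: "'a vec set \<Rightarrow> 'a vec set" and k
  define Q where "Q \<psi> k = pv.dim (conormal_sections n \<psi> k)" for \<psi> :: "'a vec set \<Rightarrow> 'a vec set" and k
  have ex: "\<exists>U. openin ?X U \<and> \<psi> \<in> U \<and> (\<forall>\<phi>\<in>U. \<forall>k\<le>N. S \<phi> k \<le> S \<psi> k \<and> Q \<phi> k \<le> Q \<psi> k)" if mem: "\<psi> \<in> ?L" for \<psi>
  proof -
    obtain U where U: "openin (Mor_topology r n e) U" "\<psi> \<in> U"
      "\<forall>\<phi>\<in>U \<inter> ?L. \<forall>m\<le>N. S \<phi> m \<le> S \<psi> m \<and> Q \<phi> m \<le> Q \<psi> m"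
      using sections_semicontinuous[OF r(1) less_imp_le[OF r(2)] mem, of N] unfolding S_def Q_def by blast
    have "openin ?X (U \<inter> ?L)" unfolding tangent_locus_topology_def using U(1) by (auto simp: openin_subtopology)
    thus ?thesis using U mem by (intro exI[of _ "U \<inter> ?L"]) auto
  qed
  obtain U1 where U1: "openin ?X U1" "\<phi>1 \<in> U1" "\<forall>\<phi>\<in>U1. \<forall>k\<le>N. S \<phi> k \<le> S \<phi>1 k \<and> Q \<phi> k \<le> Q \<phi>1 k"
    using ex[of \<phi>1] \<phi> Z by blast
  obtain U2 where U2: "openin ?X U2" "\<phi>2 \<in> U2" "\<forall>\<phi>\<in>U2. \<forall>k\<le>N. S \<phi> k \<le> S \<phi>2 k \<and> Q \<phi> k \<le> Q \<phi>2 k"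
    using ex[of \<phi>2] \<phi> Z by blast
  have ZX: "Z \<subseteq> topspace ?X" using Z by (simp add: topspace_tangent_locus_topology)
  have "U1 \<inter> U2 \<inter> Z \<noteq> {}"
    using irr U1 U2 \<phi> unfolding irreducible_subspace_iff[OF ZX] by blast
  then obtain \<psi> where \<psi>: "\<psi> \<in> U1" "\<psi> \<in> U2" "\<psi> \<in> Z" by blast
  define w where "w \<phi> k = int (n - r) * int (S \<phi> k) + int r * int (Q \<phi> k)" for \<phi> k
  have total: "(\<Sum>k\<le>N. w \<phi> k) = (\<Sum>k\<le>N. w \<phi>' k)" if "\<phi> \<in> ?L" "\<phi>' \<in> ?L" for \<phi> \<phi>'
  proof -
    have T: "tangent_splitting_type r n \<phi> M" "tangent_splitting_type r n \<phi>' M"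
      using that by (auto simp: tangent_locus_def)
    obtain s where s: "int n * s = sum_mset M" "2 * (\<Sum>k\<le>N. w \<phi> k) = sum_mset (image_mset (\<lambda>x. x\<^sup>2) M) - 2 * s\<^sup>2 -
        (2 * int N + 3) * sum_mset M + 2 * int r * int (n - r) * (int N + 1) * (int N + 2)"
      using weighted_section_dims[OF T(1) r(1) less_imp_le[OF r(2)], of N] by (auto simp: N_def w_def S_def Q_def)
    obtain s' where s': "int n * s' = sum_mset M" "2 * (\<Sum>k\<le>N. w \<phi>' k) = sum_mset (image_mset (\<lambda>x. x\<^sup>2) M) - 2 * s'\<^sup>2 -
        (2 * int N + 3) * sum_mset M + 2 * int r * int (n - r) * (int N + 1) * (int N + 2)"
      using weighted_section_dims[OF T(2) r(1) less_imp_le[OF r(2)], of N] by (auto simp: N_def w_def S_def Q_def)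
    have "int n * s = int n * s'" using s(1) s'(1) by simp
    hence "s = s'" using r by simp
    thus ?thesis using s(2) s'(2) by simp
  qed
  have agree: "S \<psi> m = S \<phi> m \<and> Q \<psi> m = Q \<phi> m"
    if le: "\<forall>k\<le>N. S \<psi> k \<le> S \<phi> k \<and> Q \<psi> k \<le> Q \<phi> k" and \<phi>: "\<phi> \<in> Z" for \<phi>
  proof -
    have "(\<Sum>k\<le>N. w \<phi> k - w \<psi> k) = 0" using total[of \<phi> \<psi>] \<phi> \<psi>(3) Z by (auto simp: sum_subtractf)
    moreover have "\<forall>k\<in>{..N}. 0 \<le> w \<phi> k - w \<psi> k" using le by (auto simp: w_def intro!: add_mono mult_left_mono)
    ultimately have "\<forall>k\<in>{..N}. w \<phi> k - w \<psi> k = 0"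
      using sum_nonneg_eq_0_iff[of "{..N}" "\<lambda>k. w \<phi> k - w \<psi> k"] by blast
    hence "w \<phi> m = w \<psi> m" by (simp add: N_def)
    hence eq: "int (n - r) * (int (S \<phi> m) - int (S \<psi> m)) + int r * (int (Q \<phi> m) - int (Q \<psi> m)) = 0"
      by (simp add: w_def algebra_simps)
    moreover have "0 \<le> int (n - r) * (int (S \<phi> m) - int (S \<psi> m))" "0 \<le> int r * (int (Q \<phi> m) - int (Q \<psi> m))"
      using le by (auto simp: N_def)
    ultimately have "int (n - r) * (int (S \<phi> m) - int (S \<psi> m)) = 0" "int r * (int (Q \<phi> m) - int (Q \<psi> m)) = 0"
      by linarith+
    thus ?thesis using r by auto
  qed
  have "S \<phi>1 m = S \<phi>2 m \<and> Q \<phi>1 m = Q \<phi>2 m"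
    using agree[of \<phi>1] agree[of \<phi>2] U1(3) U2(3) \<psi> \<phi> by metis
  thus "pv.dim (sub_sections n \<phi>1 m) = pv.dim (sub_sections n \<phi>2 m)"
    "pv.dim (conormal_sections n \<phi>1 m) = pv.dim (conormal_sections n \<phi>2 m)"
    by (simp_all add: S_def Q_def)
qed

text \<open>The number of entries equal to \<open>x\<close> is a second difference of the dimensions.\<close>

lemma sorted_eq_of_section_dims:
  assumes "sorted a" "sorted b" "\<forall>x\<in>set a. 0 \<le> x" "\<forall>x\<in>set b. 0 \<le> x"
    and eq: "\<And>m. (\<Sum>x\<leftarrow>a. nat (int m + 1 - x)) = (\<Sum>x\<leftarrow>b. nat (int m + 1 - x))"
  shows "a = b"
proof -
  define f where "f l k = (\<Sum>x\<leftarrow>l. int (nat (k + 1 - x)))" for l and k :: int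
  have neg: "f l k = 0" if "k < 0" "\<forall>x\<in>set l. 0 \<le> x" for l k
    using that(2,1) by (induction l) (auto simp: f_def)
  have "f l (int m) = int (\<Sum>x\<leftarrow>l. nat (int m + 1 - x))" for l m
    by (induction l) (auto simp: f_def)
  hence "f a k = f b k" for k
    using eq[of "nat k"] neg[of k a] neg[of k b] assms(3,4) by (cases "k < 0") (metis int_nat_eq not_less)+
  moreover have "int (count (mset l) x) = f l x - 2 * f l (x - 1) + f l (x - 2)" for l x
    by (induction l) (auto simp: f_def)
  ultimately have "count (mset a) x = count (mset b) x" for x by (metis of_nat_eq_iff)
  hence "mset a = mset b" by (simp add: multiset_eq_iff)
  thus ?thesis using assms(1,2) by (metis properties_for_sort)
qed

section \<open>Fillings\<close>

lemma map_with_splitting_types: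
  assumes a: "length a = r" "\<forall>x\<in>set a. 0 \<le> x" "sum_list a = int e"
    and b: "length b = q" "\<forall>x\<in>set b. 0 \<le> x" "sum_list b = int e" and rq: "0 < r" "0 < q"
  shows "\<exists>\<phi> :: 'a::{alg_closed_field, field_char_0} vec set \<Rightarrow> 'a vec set.
    \<phi> \<in> tangent_locus r (r + q) e (mset (tensor_exponents a b)) \<and>
    (\<forall>m. pv.dim (sub_sections (r + q) \<phi> m) = (\<Sum>x\<leftarrow>a. nat (int m + 1 - x))) \<and>
    (\<forall>m. pv.dim (conormal_sections (r + q) \<phi> m) = (\<Sum>x\<leftarrow>b. nat (int m + 1 - x)))"
proof -
  have nat: "map int (map nat l) = l" "int (sum_list (map nat l)) = sum_list l"
    if "\<forall>x\<in>set l. 0 \<le> x" for l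
    using that by (induction l) auto
  have "sum_list (map nat a) = e" "sum_list (map nat b) = e"
    using nat(2)[OF a(2)] nat(2)[OF b(2)] a(3) b(3) by simp_all
  moreover have "staircase TYPE('a) (map nat a) (map nat b)"
    by (rule staircase_exists) (use calculation a b rq in auto)
  ultimately obtain \<phi> :: "'a vec set \<Rightarrow> 'a vec set" where \<phi>: "\<phi> \<in> Mor r (r + q) e"
    and ut: "universal_transitions r (r + q) \<phi> (power_diag (map uminus a)) (power_diag b)"
    using map_from_staircase[of "map nat a" "map nat b"] nat(1)[OF a(2)] nat(1)[OF b(2)] a(1) b(1)
    by (metis length_map)
  have types: "splits_as (power_diag (map uminus a) :: 'a poly fract mat) (map uminus a)"
      "splits_as (power_diag b :: 'a poly fract mat) b"
    by (rule splits_as_power_diag)+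
  have "\<phi> \<in> tangent_locus r (r + q) e (mset (tensor_exponents a b))"
    using \<phi> tangent_splitting_typeI[OF ut types] by (simp add: tangent_locus_def)
  thus ?thesis using universal_sections(4,5)[OF ut _ types] by (intro exI[of _ \<phi>]) simp
qed

lemma eq_increments:
  fixes f :: "nat \<Rightarrow> int"
  assumes "\<And>i. Suc i < n \<Longrightarrow> f (Suc i) - f i = g (Suc i) - g i" "i < n"
  shows "f i - f 0 = g i - g 0"
  using assms(2)
proof (induction i)
  case (Suc i)
  thus ?case using assms(1)[of i] by simp
qed simp

lemma filling_additive:
  assumes "filling r n M A" "i < r" "j < n - r"
  shows "A $$ (i, j) = A $$ (i, 0) + A $$ (0, j) - A $$ (0, 0)"
proof -
  have "0 < n - r" using assms(3) by simp
  hence "A $$ (Suc k, j) - A $$ (k, j) = A $$ (Suc k, 0) - A $$ (k, 0)" if "Suc k < r" for k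
    using assms(1,3) that unfolding filling_def by blast
  hence "A $$ (i, j) - A $$ (0, j) = A $$ (i, 0) - A $$ (0, 0)"
    using eq_increments[of r "\<lambda>i. A $$ (i, j)" "\<lambda>i. A $$ (i, 0)" i] assms(2) by blast
  thus ?thesis by simp
qed

text \<open>The conditions on the differences make the filling a sum \<open>\<alpha> i + \<beta> j\<close>, and \<open>a\<close> and \<open>b\<close> arise from \<open>\<alpha>\<close> and \<open>\<beta>\<close> by
  adding and subtracting a constant so that both have the sum \<open>e\<close>.\<close>

lemma filling_determines:
  assumes fill: "filling r n M A" and det: "determines r n e A a b" and r: "0 < r" "r < n"
  shows "\<And>i j. i < r \<Longrightarrow> j < n - r \<Longrightarrow> A $$ (i, j) = a ! i + b ! j"
    "sum_list a = int e" "sum_list b = int e" "M = mset (tensor_exponents a b)"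
proof -
  define q where "q = n - r"
  have q: "0 < q" "real n = real r + real q" using r by (auto simp: q_def)
  define \<alpha> where "\<alpha> i = real_of_int (A $$ (i, 0))" for i
  define \<beta> where "\<beta> j = real_of_int (A $$ (0, j) - A $$ (0, 0))" for j
  define s where "s = (\<Sum>i<r. \<alpha> i)"
  define t where "t = (\<Sum>j<q. \<beta> j)"
  have add: "real_of_int (A $$ (i, j)) = \<alpha> i + \<beta> j" if "i < r" "j < q" for i j
    using filling_additive[OF fill that(1), of j] that(2) unfolding \<alpha>_def \<beta>_def q_def by linarith
  have len: "length a = r" "length b = q" using det by (auto simp: determines_def q_def)
  have row: "(\<Sum>j<q. real_of_int (A $$ (i, j))) = real q * \<alpha> i + t" if "i < r" for i
    using that by (simp add: add t_def sum.distrib)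
  have col: "(\<Sum>i<r. real_of_int (A $$ (i, j))) = s + real r * \<beta> j" if "j < q" for j
    using that by (simp add: add s_def sum.distrib)
  have "real e = (\<Sum>i<r. \<Sum>j<q. real_of_int (A $$ (i, j))) / real n"
    using det by (simp add: determines_def q_def)
  also have "(\<Sum>i<r. \<Sum>j<q. real_of_int (A $$ (i, j))) = real q * s + real r * t"
    by (simp add: row sum.distrib s_def sum_distrib_left)
  finally have e: "real n * real e = real q * s + real r * t" using r by simp
  have a: "real q * real_of_int (a ! i) = real q * \<alpha> i + t - real e" if "i < r" for i
  proof -
    have "real_of_int (a ! i) = ((\<Sum>j<q. real_of_int (A $$ (i, j))) - real e) / real q"
      using det that by (simp add: determines_def q_def)
    thus ?thesis using q row[OF that] by simp
  qed
  have b: "real r * real_of_int (b ! j) = s + real r * \<beta> j - real e" if "j < q" for j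
  proof -
    have "real_of_int (b ! j) = ((\<Sum>i<r. real_of_int (A $$ (i, j))) - real e) / real r"
      using det that by (simp add: determines_def q_def)
    thus ?thesis using r col[OF that] by simp
  qed
  show entry: "A $$ (i, j) = a ! i + b ! j" if "i < r" "j < n - r" for i j
  proof -
    have j: "j < q" using that by (simp add: q_def)
    have "real r * real q * (real_of_int (a ! i) + real_of_int (b ! j)) =
        real r * (real q * real_of_int (a ! i)) + real q * (real r * real_of_int (b ! j))"
      by (simp add: algebra_simps)
    also have "\<dots> = real r * (real q * \<alpha> i + t - real e) + real q * (s + real r * \<beta> j - real e)"
      unfolding a[OF that(1)] b[OF j] ..
    also have "\<dots> = real r * real q * (\<alpha> i + \<beta> j) + (real q * s + real r * t - (real r + real q) * real e)"
      by (simp add: algebra_simps)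
    also have "\<dots> = real r * real q * (\<alpha> i + \<beta> j)" using e q by simp
    finally have "real_of_int (a ! i) + real_of_int (b ! j) = \<alpha> i + \<beta> j" using r q by simp
    thus ?thesis using add[OF that(1) j] by linarith
  qed
  have "real q * real_of_int (\<Sum>i<r. a ! i) = (\<Sum>i<r. real q * \<alpha> i + t - real e)"
    by (simp add: sum_distrib_left a)
  also have "\<dots> = real q * s + real r * t - real r * real e"
    by (simp add: sum.distrib sum_subtractf s_def sum_distrib_left right_diff_distrib)
  also have "\<dots> = real q * real e" using e q by (simp add: algebra_simps)
  finally have "real_of_int (\<Sum>i<r. a ! i) = real_of_int (int e)" using q by simp
  hence "(\<Sum>i<r. a ! i) = int e" by (simp only: of_int_eq_iff)
  thus "sum_list a = int e" by (simp add: sum_list_sum_nth len lessThan_atLeast0)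
  have "real r * real_of_int (\<Sum>j<q. b ! j) = (\<Sum>j<q. s + real r * \<beta> j - real e)"
    by (simp add: sum_distrib_left b)
  also have "\<dots> = real q * s + real r * t - real q * real e"
    by (simp add: sum.distrib sum_subtractf t_def sum_distrib_left right_diff_distrib)
  also have "\<dots> = real r * real e" using e q by (simp add: algebra_simps)
  finally have "real_of_int (\<Sum>j<q. b ! j) = real_of_int (int e)" using r by simp
  hence "(\<Sum>j<q. b ! j) = int e" by (simp only: of_int_eq_iff)
  thus "sum_list b = int e" by (simp add: sum_list_sum_nth len lessThan_atLeast0)
  have "M = image_mset (\<lambda>ij. A $$ ij) (mset_set ({..<r} \<times> {..<q}))"
    using fill by (simp add: filling_def q_def)
  also have "\<dots> = image_mset (\<lambda>(i, j). a ! i + b ! j) (mset_set ({..<r} \<times> {..<q}))"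
    using entry by (intro image_mset_cong) (auto simp: q_def)
  finally show "M = mset (tensor_exponents a b)" by (simp add: mset_tensor_exponents len)
qed

text \<open>The splitting types of the universal bundles are the same at all points of an irreducible set, so maps
  with the splitting types determined by different fillings lie in different components.\<close>

lemma minimal_fillings_lepoll_components:
  assumes r: "0 < r" "r < n"
  shows "{A. minimal_filling r n e c A} \<lesssim> irreducible_components
    (tangent_locus_topology r n e c :: ('a::{alg_closed_field, field_char_0} vec set \<Rightarrow> 'a vec set) topology)"
proof -
  let ?X = "tangent_locus_topology r n e c :: ('a vec set \<Rightarrow> 'a vec set) topology"
  define good where "good A Z \<longleftrightarrow> Z \<in> irreducible_components ?X \<and>
    (\<exists>a b. \<exists>\<phi>\<in>Z. determines r n e A a b \<and>
      (\<forall>m. pv.dim (sub_sections n \<phi> m) = (\<Sum>x\<leftarrow>a. nat (int m + 1 - x))) \<and>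
      (\<forall>m. pv.dim (conormal_sections n \<phi> m) = (\<Sum>x\<leftarrow>b. nat (int m + 1 - x))))" for A Z
  have ex: "\<exists>Z. good A Z" if A: "minimal_filling r n e c A" for A
  proof -
    obtain a b where fill: "filling r n c A" and det: "determines r n e A a b"
      using A unfolding minimal_filling_def by blast
    note types = filling_determines[OF fill det r]
    have "\<exists>\<phi> :: 'a vec set \<Rightarrow> 'a vec set. \<phi> \<in> tangent_locus r (r + (n - r)) e (mset (tensor_exponents a b)) \<and>
        (\<forall>m. pv.dim (sub_sections (r + (n - r)) \<phi> m) = (\<Sum>x\<leftarrow>a. nat (int m + 1 - x))) \<and>
        (\<forall>m. pv.dim (conormal_sections (r + (n - r)) \<phi> m) = (\<Sum>x\<leftarrow>b. nat (int m + 1 - x)))"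
      by (rule map_with_splitting_types)
        (use types(2,3) det r in \<open>auto simp: determines_def nonneg_increasing_def\<close>)
    then obtain \<phi> :: "'a vec set \<Rightarrow> 'a vec set" where
      \<phi>: "\<phi> \<in> tangent_locus r (r + (n - r)) e (mset (tensor_exponents a b))"
        "\<forall>m. pv.dim (sub_sections (r + (n - r)) \<phi> m) = (\<Sum>x\<leftarrow>a. nat (int m + 1 - x))"
        "\<forall>m. pv.dim (conormal_sections (r + (n - r)) \<phi> m) = (\<Sum>x\<leftarrow>b. nat (int m + 1 - x))"
      by (elim exE conjE)
    have n: "r + (n - r) = n" using r by simp
    have "\<phi> \<in> topspace ?X" using \<phi>(1) by (simp add: topspace_tangent_locus_topology n types(4))
    from irreducible_component_through_point[OF this]
    obtain Z where Z: "Z \<in> irreducible_components ?X" "\<phi> \<in> Z" by (elim bexE)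
    have "good A Z"
      unfolding good_def using Z det \<phi>(2,3)[unfolded n]
      by - (rule conjI, simp, rule exI[of _ a], rule exI[of _ b], rule bexI[of _ \<phi>], simp_all)
    thus ?thesis ..
  qed
  have unique: "A = B" if A: "minimal_filling r n e c A" "good A Z" and B: "minimal_filling r n e c B" "good B Z" for A B Z
  proof -
    have Z: "Z \<subseteq> tangent_locus r n e c" "irreducible_space (subtopology ?X Z)"
      using A(2) by (auto simp: good_def irreducible_components_def topspace_tangent_locus_topology)
    obtain a b \<phi> where a: "\<phi> \<in> Z" "determines r n e A a b"
      "\<And>m. pv.dim (sub_sections n \<phi> m) = (\<Sum>x\<leftarrow>a. nat (int m + 1 - x))"
      "\<And>m. pv.dim (conormal_sections n \<phi> m) = (\<Sum>x\<leftarrow>b. nat (int m + 1 - x))"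
      using A(2) unfolding good_def by (elim conjE exE bexE) (simp only:)
    obtain a' b' \<phi>' where a': "\<phi>' \<in> Z" "determines r n e B a' b'"
      "\<And>m. pv.dim (sub_sections n \<phi>' m) = (\<Sum>x\<leftarrow>a'. nat (int m + 1 - x))"
      "\<And>m. pv.dim (conormal_sections n \<phi>' m) = (\<Sum>x\<leftarrow>b'. nat (int m + 1 - x))"
      using B(2) unfolding good_def by (elim conjE exE bexE) (simp only:)
    note const = section_dims_constant[OF r Z a(1) a'(1)]
    have "a = a'" "b = b'"
      using a(2) a'(2) const a(3,4) a'(3,4)
      by (auto intro!: sorted_eq_of_section_dims simp: determines_def nonneg_increasing_def)
    moreover have fill: "filling r n c A" "filling r n c B"
      using A(1) B(1) by (auto simp: minimal_filling_def)
    ultimately have "A $$ (i, j) = B $$ (i, j)" if "i < r" "j < n - r" for i j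
      using filling_determines(1)[OF fill(1) a(2) r that] filling_determines(1)[OF fill(2) a'(2) r that] by simp
    moreover have "A \<in> carrier_mat r (n - r)" "B \<in> carrier_mat r (n - r)"
      using fill by (auto simp: filling_def)
    ultimately show "A = B" by (intro eq_matI) auto
  qed
  define comp where "comp A = (SOME Z. good A Z)" for A
  have comp: "good A (comp A)" if "minimal_filling r n e c A" for A
    unfolding comp_def using ex[OF that] by (rule someI_ex)
  show ?thesis
    unfolding lepoll_def
  proof (intro exI[of _ comp] conjI)
    show "inj_on comp {A. minimal_filling r n e c A}"
      using unique comp by (intro inj_onI) (metis mem_Collect_eq)
    show "comp ` {A. minimal_filling r n e c A} \<subseteq> irreducible_components ?X"
      using comp by (auto simp: good_def)
  qed
qed

text \<open>The pairs \<open>(0, 2), (1, 1)\<close> and \<open>(1, 1), (0, 2)\<close> of splitting types have the same sums, but only for the first pair does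
  the sub-bundle have a nonzero constant section.\<close>

lemma reducible_tangent_locus:
  defines "c \<equiv> {#1, 1, 3, 3#}"
  shows "(tangent_locus 2 4 2 c :: ('a::{alg_closed_field, field_char_0} vec set \<Rightarrow> 'a vec set) set) \<noteq> {}"
    and "\<not> irreducible_space (tangent_locus_topology 2 4 2 c :: ('a vec set \<Rightarrow> 'a vec set) topology)"
proof -
  let ?X = "tangent_locus_topology 2 4 2 c :: ('a vec set \<Rightarrow> 'a vec set) topology"
  have "Suc (Suc (Suc 0)) div Suc (Suc 0) = Suc 0" "Suc (Suc (Suc 0)) mod Suc (Suc 0) = Suc 0"
    by (simp_all flip: numeral_2_eq_2 numeral_3_eq_3)
  hence c: "mset (tensor_exponents [0, 2] [1, 1]) = c" "mset (tensor_exponents [1, 1] [0, 2]) = c"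
    by (simp_all add: tensor_exponents_def c_def upt_rec)
  have "\<exists>\<phi> :: 'a vec set \<Rightarrow> 'a vec set. \<phi> \<in> tangent_locus 2 (2 + 2) 2 (mset (tensor_exponents a b)) \<and>
      (\<forall>m. pv.dim (sub_sections (2 + 2) \<phi> m) = (\<Sum>x\<leftarrow>a. nat (int m + 1 - x))) \<and>
      (\<forall>m. pv.dim (conormal_sections (2 + 2) \<phi> m) = (\<Sum>x\<leftarrow>b. nat (int m + 1 - x)))"
    if "(a, b) \<in> {([0, 2], [1, 1]), ([1, 1], [0, 2])}" for a b
    by (rule map_with_splitting_types) (use that in auto)
  from this[of "[0, 2]" "[1, 1]"] this[of "[1, 1]" "[0, 2]"]
  obtain \<phi>1 \<phi>2 :: "'a vec set \<Rightarrow> 'a vec set" where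
    \<phi>1: "\<phi>1 \<in> tangent_locus 2 (2 + 2) 2 (mset (tensor_exponents [0, 2] [1, 1]))"
      "\<forall>m. pv.dim (sub_sections (2 + 2) \<phi>1 m) = (\<Sum>x\<leftarrow>[0, 2]. nat (int m + 1 - x))" and
    \<phi>2: "\<phi>2 \<in> tangent_locus 2 (2 + 2) 2 (mset (tensor_exponents [1, 1] [0, 2]))"
      "\<forall>m. pv.dim (sub_sections (2 + 2) \<phi>2 m) = (\<Sum>x\<leftarrow>[1, 1]. nat (int m + 1 - x))"
    by blast
  have mem: "\<phi>1 \<in> tangent_locus 2 4 2 c" "\<phi>2 \<in> tangent_locus 2 4 2 c"
    using \<phi>1(1) \<phi>2(1) by (simp_all add: c)
  thus "(tangent_locus 2 4 2 c :: ('a vec set \<Rightarrow> 'a vec set) set) \<noteq> {}" by blast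
  show "\<not> irreducible_space ?X"
  proof
    assume "irreducible_space ?X"
    hence "irreducible_space (subtopology ?X (tangent_locus 2 4 2 c))"
      using topspace_tangent_locus_topology[of 2 4 2 c] by (metis subtopology_topspace)
    from section_dims_constant(1)[OF _ _ subset_refl this mem, of 0]
    show False using \<phi>1(2)[rule_format, of 0] \<phi>2(2)[rule_format, of 0] by simp
  qed
qed

theorem corollary29:
  shows "(\<forall>n r e :: nat. \<forall>c :: int multiset.
            4 \<le> n \<and> 2 \<le> r \<and> r \<le> n - 2 \<and> 1 \<le> e \<and> size c = r * (n - r) \<longrightarrow>
              {A. minimal_filling r n e c A} \<lesssim>
                irreducible_components (tangent_locus_topology r n e c ::
                  ('a::{alg_closed_field, field_char_0} vec set \<Rightarrow> 'a vec set) topology))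
       \<and> (\<exists>n r e :: nat. \<exists>c :: int multiset.
            4 \<le> n \<and> 2 \<le> r \<and> r \<le> n - 2 \<and> 1 \<le> e \<and> size c = r * (n - r) \<and>
              (tangent_locus r n e c :: ('a vec set \<Rightarrow> 'a vec set) set) \<noteq> {} \<and>
              \<not> irreducible_space (tangent_locus_topology r n e c ::
                  ('a vec set \<Rightarrow> 'a vec set) topology))"
proof (intro conjI allI impI)
  fix n r e :: nat and c :: "int multiset"
  assume "4 \<le> n \<and> 2 \<le> r \<and> r \<le> n - 2 \<and> 1 \<le> e \<and> size c = r * (n - r)"
  thus "{A. minimal_filling r n e c A} \<lesssim> irreducible_components
      (tangent_locus_topology r n e c :: ('a vec set \<Rightarrow> 'a vec set) topology)"
    by (intro minimal_fillings_lepoll_components) auto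
next
  have "4 \<le> (4::nat) \<and> 2 \<le> (2::nat) \<and> 2 \<le> 4 - (2::nat) \<and> 1 \<le> (2::nat) \<and>
      size ({#1, 1, 3, 3#} :: int multiset) = 2 * (4 - 2)"
    by simp
  thus "\<exists>n r e :: nat. \<exists>c :: int multiset.
            4 \<le> n \<and> 2 \<le> r \<and> r \<le> n - 2 \<and> 1 \<le> e \<and> size c = r * (n - r) \<and>
              (tangent_locus r n e c :: ('a vec set \<Rightarrow> 'a vec set) set) \<noteq> {} \<and>
              \<not> irreducible_space (tangent_locus_topology r n e c ::
                  ('a vec set \<Rightarrow> 'a vec set) topology)"
    using reducible_tangent_locus by blast
qed

end
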